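(* Let $N\ge 6$ and consider the spin-$1/2$ chain on $N$ sites with periodic boundary conditions and Hamiltonian $$H=\sum_{i=1}^N \sum_{\alpha,\beta\in\{X,Y,Z\}} J_{\alpha\beta}\,\alpha_i\beta_{i+1}+\sum_{i=1}^N\sum_{\alpha\in\{X,Y,Z\}} h_\alpha\,\alpha_i ,$$ where $J_{\alpha\beta},h_\alpha$ are arbitrary real numbers with $J_{\alpha\beta}=J_{\beta\alpha}$ for all $\alpha,\beta$. Suppose that there is no global spin rotation $R\in SO(3)$ transforming $H$ into one of the following Hamiltonians (with arbitrary real parameters): (1) XXX: $\sum_i \big(J(X_iX_{i+1}+Y_iY_{i+1}+Z_iZ_{i+1})+hZ_i\big)$; (2) XXZ: $\sum_i \big(J_X(X_iX_{i+1}+Y_iY_{i+1})+J_ZZ_iZ_{i+1}+hZ_i\big)$; (3) XYZ: $\sum_i \big(J_XX_iX_{i+1}+J_YY_iY_{i+1}+J_ZZ_iZ_{i+1}\big)$; (4) XY: $\sum_i \big(J_XX_iX_{i+1}+J_YY_iY_{i+1}+h_ZZ_i\big)$; (5) transverse-field Ising: $\sum_i \big(J_ZZ_iZ_{i+1}+h_XX_i\big)$; (6) longitudinal-field Ising: $\sum_i \big(J_ZZ_iZ_{i+1}+h_ZZ_i\big)$; (7) free spins: $\sum_i h_ZZ_i$. Then for every integer $k$ with $3\le k\le N/2$, $H$ has no $k$-support conserved quantity.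
   Context: $X_i,Y_i,Z_i$ denote the Pauli matrices $\sigma^x,\sigma^y,\sigma^z$ acting on site $i$; site $N+1$ is identified with site $1$ (periodic boundary). A global spin rotation by $R\in SO(3)$ replaces $(X_i,Y_i,Z_i)^T$ by $R\,(X_i,Y_i,Z_i)^T$ simultaneously on every site (equivalently, conjugation of $H$ by the corresponding product unitary $U^{\otimes N}$). An operator is a $k$-support operator if it acts nontrivially only on $k$ consecutive sites of the ring (and not on fewer consecutive sites). An operator is a $k$-support quantity if it can be written as a sum of $l$-support operators with $l\le k$ but cannot be written as a sum of $l$-support operators with $l\le k-1$. A $k$-support conserved quantity is a $k$-support quantity commuting with $H$. *)

theory Defs
  imports "HOL-Analysis.Analysis" "HOL-Library.Function_Algebras"
begin

text \<open>Operators on the N-site spin-1/2 chain are 2^N x 2^N complex matrices, represented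
as functions on basis-state indices r, c < 2^N (entries outside this range are 0).
Bit j of a basis index is the state of site j (sites are 0..N-1, site N identified with 0).
Bit value 0 is the +1 eigenstate of Z.\<close>

type_synonym qop = "nat \<Rightarrow> nat \<Rightarrow> complex"

definition is_op :: "nat \<Rightarrow> qop \<Rightarrow> bool" where
  "is_op N A \<longleftrightarrow> (\<forall>r c. (2^N \<le> r \<or> 2^N \<le> c) \<longrightarrow> A r c = 0)"

definition bitv :: "nat \<Rightarrow> nat \<Rightarrow> nat" where
  "bitv c j = c div 2^j mod 2"

definition mmul :: "nat \<Rightarrow> qop \<Rightarrow> qop \<Rightarrow> qop" where
  "mmul N A B = (\<lambda>r c. \<Sum>k<2^N. A r k * B k c)"

definition smul :: "complex \<Rightarrow> qop \<Rightarrow> qop" where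
  "smul a A = (\<lambda>r c. a * A r c)"

definition pX :: 3 where "pX = 0"
definition pY :: 3 where "pY = 1"
definition pZ :: 3 where "pZ = 2"

definition sq :: "3 \<Rightarrow> nat \<Rightarrow> nat \<Rightarrow> complex" where
  "sq a x y =
    (if a = pX then (if x \<noteq> y then 1 else 0)
     else if a = pY then (if x = 0 \<and> y = 1 then - \<i> else if x = 1 \<and> y = 0 then \<i> else 0)
     else (if x = y then (if x = 0 then 1 else -1) else 0))"

definition pauli :: "nat \<Rightarrow> 3 \<Rightarrow> nat \<Rightarrow> qop" where
  "pauli N a i = (\<lambda>r c.
     if r < 2^N \<and> c < 2^N \<and> (\<forall>j<N. j \<noteq> i \<longrightarrow> bitv r j = bitv c j)
     then sq a (bitv r i) (bitv c i) else 0)"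

definition rot_pauli :: "nat \<Rightarrow> real^3^3 \<Rightarrow> 3 \<Rightarrow> nat \<Rightarrow> qop" where
  "rot_pauli N R a i = (\<Sum>b\<in>UNIV. smul (complex_of_real (R $ a $ b)) (pauli N b i))"

definition ham :: "nat \<Rightarrow> (3 \<Rightarrow> nat \<Rightarrow> qop) \<Rightarrow> (3 \<Rightarrow> 3 \<Rightarrow> real) \<Rightarrow> (3 \<Rightarrow> real) \<Rightarrow> qop" where
  "ham N P J h =
     (\<Sum>i<N. \<Sum>a\<in>UNIV. \<Sum>b\<in>UNIV.
        smul (complex_of_real (J a b)) (mmul N (P a i) (P b ((i + 1) mod N))))
   + (\<Sum>i<N. \<Sum>a\<in>UNIV. smul (complex_of_real (h a)) (P a i))"

definition diagJ :: "real \<Rightarrow> real \<Rightarrow> real \<Rightarrow> 3 \<Rightarrow> 3 \<Rightarrow> real" where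
  "diagJ jx jy jz = (\<lambda>a b. if a \<noteq> b then 0 else if a = pX then jx else if a = pY then jy else jz)"

definition vecH :: "real \<Rightarrow> real \<Rightarrow> real \<Rightarrow> 3 \<Rightarrow> real" where
  "vecH hx hy hz = (\<lambda>a. if a = pX then hx else if a = pY then hy else hz)"

definition excluded_model :: "nat \<Rightarrow> qop \<Rightarrow> bool" where
  "excluded_model N H \<longleftrightarrow>
     (\<exists>J h. H = ham N (pauli N) (diagJ J J J) (vecH 0 0 h)) \<comment> \<open>XXX\<close>
   \<or> (\<exists>JX JZ h. H = ham N (pauli N) (diagJ JX JX JZ) (vecH 0 0 h)) \<comment> \<open>XXZ\<close>
   \<or> (\<exists>JX JY JZ. H = ham N (pauli N) (diagJ JX JY JZ) (vecH 0 0 0)) \<comment> \<open>XYZ\<close>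
   \<or> (\<exists>JX JY hZ. H = ham N (pauli N) (diagJ JX JY 0) (vecH 0 0 hZ)) \<comment> \<open>XY\<close>
   \<or> (\<exists>JZ hX. H = ham N (pauli N) (diagJ 0 0 JZ) (vecH hX 0 0)) \<comment> \<open>TFIM\<close>
   \<or> (\<exists>JZ hZ. H = ham N (pauli N) (diagJ 0 0 JZ) (vecH 0 0 hZ)) \<comment> \<open>LFIM\<close>
   \<or> (\<exists>hZ. H = ham N (pauli N) (diagJ 0 0 0) (vecH 0 0 hZ)) \<comment> \<open>free spins\<close>"

text \<open>Support. A acts only on the site set S: A = B_S \<otimes> identity on the complement.\<close>
definition acts_within :: "nat \<Rightarrow> nat set \<Rightarrow> qop \<Rightarrow> bool" where
  "acts_within N S A \<longleftrightarrow>
     (\<forall>r<2^N. \<forall>c<2^N. (\<exists>j<N. j \<notin> S \<and> bitv r j \<noteq> bitv c j) \<longrightarrow> A r c = 0) \<and>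
     (\<forall>r<2^N. \<forall>c<2^N. \<forall>r'<2^N. \<forall>c'<2^N.
        (\<forall>j<N. j \<notin> S \<longrightarrow> bitv r j = bitv c j \<and> bitv r' j = bitv c' j) \<and>
        (\<forall>j\<in>S. bitv r j = bitv r' j \<and> bitv c j = bitv c' j)
        \<longrightarrow> A r c = A r' c')"

definition window :: "nat \<Rightarrow> nat \<Rightarrow> nat \<Rightarrow> nat set" where
  "window N s l = {(s + j) mod N | j. j < l}"

definition on_consecutive :: "nat \<Rightarrow> nat \<Rightarrow> qop \<Rightarrow> bool" where
  "on_consecutive N l A \<longleftrightarrow> (\<exists>s<N. acts_within N (window N s l) A)"

definition support_op :: "nat \<Rightarrow> nat \<Rightarrow> qop \<Rightarrow> bool" where
  "support_op N k A \<longleftrightarrow> on_consecutive N k A \<and> (\<forall>l<k. \<not> on_consecutive N l A)"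

definition sum_of_le_support :: "nat \<Rightarrow> nat \<Rightarrow> qop \<Rightarrow> bool" where
  "sum_of_le_support N k Q \<longleftrightarrow>
     (\<exists>As. Q = sum_list As \<and> (\<forall>A\<in>set As. is_op N A \<and> (\<exists>l\<le>k. support_op N l A)))"

definition support_quantity :: "nat \<Rightarrow> nat \<Rightarrow> qop \<Rightarrow> bool" where
  "support_quantity N k Q \<longleftrightarrow> sum_of_le_support N k Q \<and> \<not> sum_of_le_support N (k - 1) Q"

end

theory Submission
  imports Defs
begin

text \<open>
  Expand an operator commuting with the Hamiltonian in Pauli strings, in a rotated frame that
  diagonalises the coupling matrix. Comparing coefficients in the commutator gives linear equations
  between the coefficients of strings that differ by one bond or field term; since \<open>2 k \<le> N\<close> strings
  of width about \<open>k\<close> do not notice the periodicity, so these equations live on the line \<open>\<int>\<close>.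

  Strings of width \<open>k + 1\<close> in the commutator force the coefficients of width-\<open>k\<close> strings to follow the
  nested-commutator pattern of the integrable model with the same couplings, up to a constant factor.
  Acting with the field then produces strings of width \<open>k\<close> that can only be compensated by strings of
  width \<open>k - 1\<close>. Pushing a single defect through a string from one end to the other yields a
  telescoping chain of such equations whose sum is a non-zero multiple (such as \<open>k - 1\<close>) of the
  constant, which therefore vanishes. The chain needs a field component that breaks the rotation
  symmetry of the couplings, and one exists in a suitable frame unless the model is excluded. For a
  single coupling \<open>Z Z\<close> the same idea is applied twice, to the two families of charges of the
  transverse-field Ising model.
\<close>

section \<open>Coefficient equations for Pauli strings on the line\<close>

text \<open>Obstacle: coefficients of width \<open>k - 1\<close> are unknown, and the equation of a
  gapless target of width \<open>k\<close> contains two of them, one from contracting each end. The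
  targets are ordered so that shortening one of them on the right and its left neighbour on the left
  yields the same string; weighted by the ratios known from width \<open>k + 1\<close>, these
  unknowns cancel in pairs. Each target then leaves the same number \<kappa> times a known
  coefficient, so the contributions add up. The chain stops because at both of its ends the letter
  to be absorbed commutes with its neighbour. Here \<kappa> is \<open>- h LZ\<close> if
  \<open>J LY = 0\<close>, and \<open>h LZ * (J LY - J LX) / J LX\<close> at full rank, which
  vanishes for XXZ in an axial field. With a \<open>Z Z\<close> coupling alone only an end letter
  \<open>LZ\<close> can be contracted, so width \<open>k + 1\<close> does not fix the shape of the
  strings. The equations of width \<open>k\<close> with the transverse field have to do this first,
  and only then the longitudinal field removes the strings.\<close>

datatype letter = LI | LX | LY | LZ

text \<open>Pauli matrices modulo phases form the Klein four-group. The phases are kept apart in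
  \<open>eps\<close> and \<open>pm\<close>, so that products of letters commute.\<close>

instantiation letter :: comm_monoid_mult
begin

definition one_letter :: letter where "one_letter = LI"

fun times_letter :: "letter \<Rightarrow> letter \<Rightarrow> letter" where
  "LI * b = b"
| "a * LI = a"
| "LX * LX = LI" | "LY * LY = LI" | "LZ * LZ = LI"
| "LX * LY = LZ" | "LY * LX = LZ"
| "LY * LZ = LX" | "LZ * LY = LX"
| "LZ * LX = LY" | "LX * LZ = LY"

instance
proof
  fix a b c :: letter
  show "a * b * c = a * (b * c)" by (cases a; cases b; cases c; simp)
  show "a * b = b * a" by (cases a; cases b; simp)
  show "1 * a = a" by (cases a; simp add: one_letter_def)
qed

end

lemma letter_mult_LI [simp]: "LI * a = a" "a * LI = a" for a :: letter
  by (cases a; simp)+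

lemma letter_mult_self [simp]: "a * a = LI" for a :: letter
  by (cases a; simp)

lemma letter_mult_self_left [simp]: "a * (a * b) = b" for a b :: letter
  by (cases a; cases b; simp)

lemma letter_mult_eq_LI [simp]: "a * b = LI \<longleftrightarrow> a = b" for a b :: letter
  by (cases a; cases b; simp)

lemma letter_mult_cancel [simp]:
  "a = a * b \<longleftrightarrow> b = LI" "a * b = a \<longleftrightarrow> b = LI" "a = b * a \<longleftrightarrow> b = LI" "b * a = a \<longleftrightarrow> b = LI"
  for a b :: letter
  by (cases a; cases b; simp)+

lemma letter_UNIV: "(UNIV :: letter set) = {LI, LX, LY, LZ}"
  by (auto intro: letter.exhaust)

lemma sum_letter: "(\<Sum>a\<in>UNIV. f a) = f LI + f LX + f LY + f LZ" for f :: "letter \<Rightarrow> 'a::comm_monoid_add"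
  by (simp add: letter_UNIV add.assoc)

text \<open>\<open>eps a t\<close> is the sign in \<open>\<sigma>\<^sub>a \<sigma>\<^sub>b = \<i> \<epsilon> \<sigma>\<^sub>t\<close> with \<open>b = a * t\<close>, and 0 if \<open>\<sigma>\<^sub>a\<close> and \<open>\<sigma>\<^sub>t\<close> commute.\<close>
fun eps :: "letter \<Rightarrow> letter \<Rightarrow> complex" where
  "eps LX LZ = 1" | "eps LX LY = -1"
| "eps LY LX = 1" | "eps LY LZ = -1"
| "eps LZ LY = 1" | "eps LZ LX = -1"
| "eps _ _ = 0"

lemma eps_eq_0_iff [simp]: "eps a t = 0 \<longleftrightarrow> a = LI \<or> t = LI \<or> a = t"
  by (cases a; cases t; simp)

text \<open>The analogue of \<open>eps\<close> for a bond carrying \<open>a\<close> on both sites.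
  If both \<open>s\<close> and \<open>t\<close> anticommute with \<open>a\<close>, the two signs
  cancel and the bond commutes with the string.\<close>

definition bsg :: "letter \<Rightarrow> letter \<Rightarrow> letter \<Rightarrow> complex" where
  "bsg a s t = (if t = LI \<or> t = a then eps a s else if s = LI \<or> s = a then eps a t else 0)"

lemma bsg_LI [simp]: "bsg LI s t = 0"
  by (simp add: bsg_def)

lemma bsg_LI_LI [simp]: "bsg a LI LI = 0"
  by (simp add: bsg_def)

text \<open>\<open>c g\<close> stands for the coefficient of \<open>g\<close> in the conserved
  operator, and \<open>master\<close> says that \<open>T\<close> is absent from the commutator, a
  common factor \<open>2 * \<i>\<close> being dropped. Targets are limited to width
  \<open>k + 1\<close>, the range in which the ring can be unrolled. Bonds touching \<open>T\<close>
  begin between \<open>m - 1\<close> and \<open>m + k\<close>, hence the summation interval.\<close>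

locale spin_string_eq =
  fixes k :: nat and J h :: "letter \<Rightarrow> complex" and c :: "(int \<Rightarrow> letter) \<Rightarrow> complex"
  assumes k3: "3 \<le> k"
    and range: "\<And>g. c g \<noteq> 0 \<Longrightarrow> \<exists>m. \<forall>i. g i \<noteq> LI \<longrightarrow> m \<le> i \<and> i < m + int k"
    and master: "\<And>T m. (\<And>i. T i \<noteq> LI \<Longrightarrow> m \<le> i \<and> i \<le> m + int k) \<Longrightarrow>
      (\<Sum>i\<in>{m-1..m + int k + 1}.
         (\<Sum>a\<in>UNIV. h a * eps a (T i) * c (T(i := a * T i)))
       + (\<Sum>a\<in>UNIV. J a * bsg a (T i) (T (i+1)) * c (T(i := a * T i, i+1 := a * T (i+1))))) = 0"
begin

abbreviation K :: int where "K \<equiv> int k"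

lemma K3: "3 \<le> K" using k3 by simp

definition fieldt :: "(int \<Rightarrow> letter) \<Rightarrow> int \<Rightarrow> complex" where
  "fieldt T i = (\<Sum>a\<in>UNIV. h a * eps a (T i) * c (T(i := a * T i)))"

definition bondt :: "(int \<Rightarrow> letter) \<Rightarrow> int \<Rightarrow> complex" where
  "bondt T i = (\<Sum>a\<in>UNIV. J a * bsg a (T i) (T (i+1)) * c (T(i := a * T i, i+1 := a * T (i+1))))"

text \<open>The summand of the end bond whose letter equals the end of \<open>T\<close>, the only
  one that erases that end. \<open>Rterm\<close> is its mirror image.\<close>

definition Lterm :: "(int \<Rightarrow> letter) \<Rightarrow> int \<Rightarrow> complex" where
  "Lterm T m = J (T m) * eps (T m) (T (m+1)) * c (T(m := LI, m+1 := T m * T (m+1)))"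

definition Rterm :: "(int \<Rightarrow> letter) \<Rightarrow> int \<Rightarrow> complex" where
  "Rterm T n = J (T n) * eps (T n) (T (n-1)) * c (T(n := LI, n-1 := T n * T (n-1)))"

lemma master': "(\<And>i. T i \<noteq> LI \<Longrightarrow> m \<le> i \<and> i \<le> m + K) \<Longrightarrow>
      (\<Sum>i\<in>{m-1..m + K + 1}. fieldt T i + bondt T i) = 0"
  unfolding fieldt_def bondt_def by (rule master)

lemma mirror_upd: "(\<lambda>i. (f(a := x)) (- i)) = (\<lambda>i. f (- i))(- a := x)" for f :: "int \<Rightarrow> 'a"
  by (auto simp: fun_eq_iff)

lemma bsg_commute: "bsg a s t = bsg a t s"
  by (auto simp: bsg_def)

lemma mirror: "spin_string_eq k J h (\<lambda>g. c (\<lambda>i. g (- i)))"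
proof
  show "3 \<le> k" by (rule k3)
  fix g :: "int \<Rightarrow> letter"
  assume "c (\<lambda>i. g (- i)) \<noteq> 0"
  from range[OF this] obtain m where m: "\<And>i. g (- i) \<noteq> LI \<Longrightarrow> m \<le> i \<and> i < m + K" by blast
  have "- (m + K - 1) \<le> i \<and> i < - (m + K - 1) + K" if "g i \<noteq> LI" for i
    using m[of "- i"] that by auto
  then show "\<exists>m. \<forall>i. g i \<noteq> LI \<longrightarrow> m \<le> i \<and> i < m + K" by blast
next
  fix T :: "int \<Rightarrow> letter" and m
  assume T: "\<And>i. T i \<noteq> LI \<Longrightarrow> m \<le> i \<and> i \<le> m + K"
  define T' where "T' i = T (- i)" for i
  have T': "- (m + K) \<le> i \<and> i \<le> - (m + K) + K" if "T' i \<noteq> LI" for i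
    using T[of "- i"] that by (auto simp: T'_def)
  have out: "T' i = LI" if "i < - (m + K) \<or> - m < i" for i
    using T'[of i] that by force
  let ?B = "{- (m + K) - 1..- (m + K) + K + 1}"
  have F: "(\<Sum>i\<in>{m - 1..m + K + 1}. fieldt T' (- i)) = (\<Sum>i\<in>?B. fieldt T' i)"
    by (rule sum.reindex_bij_witness[of _ uminus uminus]) auto
  \<comment> \<open>The bond on \<open>i\<close>, \<open>i + 1\<close> is reflected to the bond on
    \<open>- i - 1\<close>, \<open>- i\<close>, which shifts the range; the bonds gained or lost lie
    outside the support.\<close>
  have "(\<Sum>i\<in>{m - 1..m + K + 1}. bondt T' (- i - 1)) = (\<Sum>i\<in>{- (m + K) - 2..- m}. bondt T' i)"
    by (rule sum.reindex_bij_witness[of _ "\<lambda>i. - i - 1" "\<lambda>i. - i - 1"]) auto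
  also have "\<dots> = (\<Sum>i\<in>{- (m + K) - 1..- m}. bondt T' i)"
    by (rule sum.mono_neutral_right) (use out in \<open>auto simp: bondt_def\<close>)
  also have "\<dots> = (\<Sum>i\<in>?B. bondt T' i)"
    by (rule sum.mono_neutral_left) (use out in \<open>auto simp: bondt_def\<close>)
  finally have "(\<Sum>i\<in>{m - 1..m + K + 1}. fieldt T' (- i) + bondt T' (- i - 1)) = (\<Sum>i\<in>?B. fieldt T' i + bondt T' i)"
    unfolding sum.distrib F by simp
  also have "\<dots> = 0" by (rule master'[OF T'])
  finally show "(\<Sum>i\<in>{m - 1..m + K + 1}.
         (\<Sum>a\<in>UNIV. h a * eps a (T i) * c (\<lambda>j. (T(i := a * T i)) (- j)))
       + (\<Sum>a\<in>UNIV. J a * bsg a (T i) (T (i+1)) * c (\<lambda>j. (T(i := a * T i, i+1 := a * T (i+1))) (- j)))) = 0"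
    unfolding mirror_upd fieldt_def bondt_def T'_def
    by (simp add: bsg_commute fun_upd_twist add.commute del: fun_upd_apply)
qed

lemma c_far: "c g = 0" if "g i \<noteq> LI" "g j \<noteq> LI" "i + K \<le> j"
proof (rule ccontr)
  assume "c g \<noteq> 0"
  then obtain m where "\<forall>i. g i \<noteq> LI \<longrightarrow> m \<le> i \<and> i < m + K" using range by blast
  then have "m \<le> i" "j < m + K" using that by auto
  then show False using that by linarith
qed

lemma fieldt_zeroI: "fieldt T i = 0" if "\<And>a. a \<noteq> T i \<Longrightarrow> a \<noteq> LI \<Longrightarrow> T i \<noteq> LI \<Longrightarrow> h a \<noteq> 0 \<Longrightarrow> c (T(i := a * T i)) = 0"
  unfolding fieldt_def using that by (intro sum.neutral ballI) auto

lemma bondt_zeroI: "bondt T i = 0"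
  if "\<And>a. a \<noteq> LI \<Longrightarrow> J a \<noteq> 0 \<Longrightarrow> T i \<noteq> a \<Longrightarrow> T i \<noteq> LI \<Longrightarrow> T (i+1) = LI \<or> T (i+1) = a \<Longrightarrow>
           c (T(i := a * T i, i+1 := a * T (i+1))) = 0"
    "\<And>a. a \<noteq> LI \<Longrightarrow> J a \<noteq> 0 \<Longrightarrow> T (i+1) \<noteq> a \<Longrightarrow> T (i+1) \<noteq> LI \<Longrightarrow> T i = LI \<or> T i = a \<Longrightarrow>
           c (T(i := a * T i, i+1 := a * T (i+1))) = 0"
  unfolding bondt_def
proof (intro sum.neutral ballI)
  fix a
  show "J a * bsg a (T i) (T (i + 1)) * c (T(i := a * T i, i + 1 := a * T (i + 1))) = 0"
    using that[of a] by (auto simp: bsg_def)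
qed

lemma sum_single:
  assumes "\<And>x. x \<noteq> a \<Longrightarrow> f x = (0::complex)"
  shows "(\<Sum>x\<in>UNIV. f x) = f (a::letter)"
  unfolding sum_letter using assms[of LI] assms[of LX] assms[of LY] assms[of LZ] by (cases a) auto

lemma bondt_left:
  assumes "\<And>a. a \<noteq> T m \<Longrightarrow> a \<noteq> LI \<Longrightarrow> bsg a (T m) (T (m+1)) \<noteq> 0 \<Longrightarrow> J a \<noteq> 0 \<Longrightarrow>
     c (T(m := a * T m, m+1 := a * T (m+1))) = 0" and "T m \<noteq> LI"
  shows "bondt T m = Lterm T m"
proof -
  have "bondt T m = J (T m) * bsg (T m) (T m) (T (m+1)) * c (T(m := T m * T m, m+1 := T m * T (m+1)))"
    unfolding bondt_def by (rule sum_single) (use assms(1) bsg_LI in force)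
  then show ?thesis using assms(2) by (auto simp: Lterm_def bsg_def)
qed

lemma bondt_right:
  assumes "\<And>a. a \<noteq> T n \<Longrightarrow> a \<noteq> LI \<Longrightarrow> bsg a (T (n-1)) (T n) \<noteq> 0 \<Longrightarrow> J a \<noteq> 0 \<Longrightarrow>
     c (T(n-1 := a * T (n-1), n := a * T n)) = 0" and "T n \<noteq> LI"
  shows "bondt T (n-1) = Rterm T n"
proof -
  have "bondt T (n-1) = J (T n) * bsg (T n) (T (n-1)) (T n) * c (T(n-1 := T n * T (n-1), n := T n * T n))"
    unfolding bondt_def diff_add_cancel by (rule sum_single) (use assms(1) bsg_LI in force)
  then show ?thesis using assms(2) by (auto simp: Rterm_def bsg_def fun_upd_twist)
qed

text \<open>A source string that keeps both ends has width \<open>k + 1\<close> and coefficient 0.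
  Only the two bonds that erase an end letter survive, so they must balance.\<close>

lemma level1:
  assumes T: "\<And>i. T i \<noteq> LI \<Longrightarrow> m \<le> i \<and> i \<le> m + K" and ends: "T m \<noteq> LI" "T (m+K) \<noteq> LI"
  shows "Lterm T m + Rterm T (m+K) = 0"
proof -
  have f: "fieldt T i = 0" for i
    by (rule fieldt_zeroI, rule c_far[of _ m "m+K"]) (use ends in auto)
  have b: "bondt T i = 0" if "i \<noteq> m" "i \<noteq> m+K-1" for i
    by (rule bondt_zeroI; rule c_far[of _ m "m+K"]) (use ends that T[of "m-1"] T[of "m+K+1"] in auto)
  have "(\<Sum>i\<in>{m-1..m + K + 1}. fieldt T i + bondt T i) = (\<Sum>i\<in>{m,m+K-1}. fieldt T i + bondt T i)"
    by (rule sum.mono_neutral_right) (use f b K3 in auto)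
  also have "\<dots> = bondt T m + bondt T (m+K-1)"
    using K3 f by simp
  also have "bondt T m = Lterm T m"
    by (rule bondt_left) (use ends K3 in \<open>auto intro!: c_far[of _ m "m+K"]\<close>)
  also have "bondt T (m+K-1) = Rterm T (m+K)"
    by (rule bondt_right) (use ends K3 in \<open>auto intro!: c_far[of _ m "m+K"]\<close>)
  finally show ?thesis using master'[of T m] T by simp
qed

text \<open>The bonds sticking out at either end widen the string to \<open>k + 1\<close> sites and
  drop out.\<close>

lemma level2:
  assumes T: "\<And>i. T i \<noteq> LI \<Longrightarrow> m \<le> i \<and> i \<le> m + K - 1" and ends: "T m \<noteq> LI" "T (m+K-1) \<noteq> LI"
  shows "(\<Sum>i\<in>{m..m+K-1}. fieldt T i) + (\<Sum>i\<in>{m..m+K-2}. bondt T i) = 0"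
proof -
  have out: "T i = LI" if "i < m \<or> i > m+K-1" for i using T[of i] that by force
  have f: "fieldt T i = 0" if "i < m \<or> i > m+K-1" for i
    by (rule fieldt_zeroI) (use out[OF that] in auto)
  have b: "bondt T i = 0" if "i < m \<or> i > m+K-2" for i
  proof -
    have "i = m-1 \<or> i = m+K-1 \<or> i < m - 1 \<or> i > m+K-1" using that by linarith
    then consider "i = m-1" | "i = m+K-1" | "i < m - 1 \<or> i > m+K-1" by blast
    then show ?thesis
    proof cases
      case 1
      then show ?thesis using ends K3 out
        by (intro bondt_zeroI; intro c_far[of _ "m-1" "m+K-1"]) auto
    next
      case 2
      then show ?thesis using ends K3 out
        by (intro bondt_zeroI; intro c_far[of _ "m" "m+K"]) auto
    next
      case 3
      then show ?thesis using out by (intro bondt_zeroI) auto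
    qed
  qed
  have "0 = (\<Sum>i\<in>{m-1..m + K + 1}. fieldt T i + bondt T i)"
    using master'[of T m] T by force
  also have "\<dots> = (\<Sum>i\<in>{m-1..m + K + 1}. fieldt T i) + (\<Sum>i\<in>{m-1..m + K + 1}. bondt T i)"
    by (rule sum.distrib)
  also have "(\<Sum>i\<in>{m-1..m + K + 1}. fieldt T i) = (\<Sum>i\<in>{m..m+K-1}. fieldt T i)"
    by (rule sum.mono_neutral_right) (use f K3 in auto)
  also have "(\<Sum>i\<in>{m-1..m + K + 1}. bondt T i) = (\<Sum>i\<in>{m..m+K-2}. bondt T i)"
    by (rule sum.mono_neutral_right) (use b K3 in auto)
  finally show ?thesis by simp
qed

text \<open>Between nontrivial neighbours a bond contributes only if one of them equals its letter,
  so it would leave \<open>LI\<close> there; at an inner site \<open>gap\<close> kills the source.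
  What remains are the contractions of the two ends.\<close>

lemma level2_full:
  assumes T: "\<And>i. T i \<noteq> LI \<longleftrightarrow> m \<le> i \<and> i \<le> m + K - 1"
    and gap: "\<And>g m i. g m \<noteq> LI \<Longrightarrow> g (m+K-1) \<noteq> LI \<Longrightarrow> m < i \<Longrightarrow> i < m+K-1 \<Longrightarrow> g i = LI \<Longrightarrow> c g = 0"
  shows "(\<Sum>i\<in>{m..m+K-1}. fieldt T i) + Lterm T m + Rterm T (m+K-1) = 0"
proof -
  have ends: "T m \<noteq> LI" "T (m+K-1) \<noteq> LI" using T K3 by auto
  have b: "bondt T i = 0" if "m < i" "i < m+K-2" for i
  proof (rule bondt_zeroI)
    show "c (T(i := a * T i, i+1 := a * T (i+1))) = 0" 
      if "T (i+1) = LI \<or> T (i+1) = a" for a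
    proof -
      have "T (i+1) = a" using that T[of "i+1"] \<open>m < i\<close> \<open>i < m+K-2\<close> by auto
      then show ?thesis using ends \<open>m < i\<close> \<open>i < m+K-2\<close> by (intro gap[of _ m "i+1"]) auto
    qed
    show "c (T(i := a * T i, i+1 := a * T (i+1))) = 0" 
      if "T i = LI \<or> T i = a" for a
    proof -
      have "T i = a" using that T[of "i"] \<open>m < i\<close> \<open>i < m+K-2\<close> by auto
      then show ?thesis using ends \<open>m < i\<close> \<open>i < m+K-2\<close> by (intro gap[of _ m "i"]) auto
    qed
  qed
  have "(\<Sum>i\<in>{m..m+K-2}. bondt T i) = (\<Sum>i\<in>{m,m+K-2}. bondt T i)"
    by (rule sum.mono_neutral_right) (use b K3 in auto)
  also have "\<dots> = bondt T m + bondt T (m+K-2)" using K3 by simp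
  also have "bondt T m = Lterm T m"
  proof (rule bondt_left)
    fix a assume a: "a \<noteq> T m" "a \<noteq> LI" "bsg a (T m) (T (m + 1)) \<noteq> 0"
    then have "T (m+1) = a" using ends T[of "m+1"] K3 by (auto simp: bsg_def split: if_splits)
    then show "c (T(m := a * T m, m+1 := a * T (m+1))) = 0"
      using ends a K3 by (intro gap[of _ m "m+1"]) auto
  qed (use ends in auto)
  also have "bondt T (m+K-2) = Rterm T (m+K-1)"
  proof -
    have "bondt T (m+K-1-1) = Rterm T (m+K-1)"
    proof (rule bondt_right)
      fix a assume a: "a \<noteq> T (m+K-1)" "a \<noteq> LI" "bsg a (T (m+K-1-1)) (T (m+K-1)) \<noteq> 0"
      then have "T (m+K-1-1) = a" using ends T[of "m+K-1-1"] K3 by (auto simp: bsg_def split: if_splits)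
      then show "c (T(m+K-1-1 := a * T (m+K-1-1), m+K-1 := a * T (m+K-1))) = 0"
        using ends a K3 by (intro gap[of _ m "m+K-1-1"]) auto
    qed (use ends in auto)
    then show ?thesis by simp
  qed
  finally show ?thesis using level2[of T m] T ends by (simp add: add.assoc)
qed

end

section \<open>The telescoping chain\<close>

text \<open>The shape of nested commutators of alternating \<open>X X\<close> and \<open>Z Z\<close>
  bonds: consecutive bonds overlap in the product of \<open>LX\<close> and \<open>LZ\<close>, which
  is \<open>LY\<close>.\<close>

definition ystring :: "nat \<Rightarrow> letter \<Rightarrow> int \<Rightarrow> letter \<Rightarrow> int \<Rightarrow> letter" where
  "ystring l u m v = (\<lambda>i. if i < m \<or> m + int l - 1 < i then LI else if i = m then u
                        else if i = m + int l - 1 then v else LY)"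

locale gapless_string_eq = spin_string_eq +
  assumes gap: "\<And>g m i. g m \<noteq> LI \<Longrightarrow> g (m+K-1) \<noteq> LI \<Longrightarrow> m < i \<Longrightarrow> i < m+K-1 \<Longrightarrow> g i = LI \<Longrightarrow> c g = 0"
    and JX: "J LX \<noteq> 0" and JZ: "J LZ \<noteq> 0"
begin

text \<open>The end letter of a \<open>ystring\<close> as a function of its position: absorbing an
  end into the adjacent \<open>LY\<close> exchanges \<open>LX\<close> and \<open>LZ\<close>.\<close>

definition alternating :: "(int \<Rightarrow> letter) \<Rightarrow> bool" where
  "alternating a \<longleftrightarrow> (\<forall>m. a m \<in> {LX, LZ} \<and> a (m+1) = a m * LY)"

lemma level2_gapless:
  assumes "\<And>i. T i \<noteq> LI \<longleftrightarrow> m \<le> i \<and> i \<le> m + K - 1"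
  shows "(\<Sum>i\<in>{m..m+K-1}. fieldt T i) + Lterm T m + Rterm T (m+K-1) = 0"
  by (rule level2_full[OF assms gap])

definition weight :: "letter \<Rightarrow> complex" where
  "weight a = J a * eps a LY"

lemma weight_nz: "alternating a \<Longrightarrow> weight (a m) \<noteq> 0"
  using JX JZ by (auto simp: weight_def alternating_def dest!: spec[of _ m])

lemma alternating_XZ: "alternating a \<Longrightarrow> a m \<in> {LX, LZ}"
  by (simp add: alternating_def)

lemma alternating_neq: "alternating a \<Longrightarrow> a m \<noteq> LI" "alternating a \<Longrightarrow> a m \<noteq> LY"
  using alternating_XZ[of a m] by auto

lemma alternating_Suc: "alternating a \<Longrightarrow> a (m+1) = a m * LY" "alternating a \<Longrightarrow> a m * LY = a (m+1)"
   "alternating a \<Longrightarrow> LY * a m = a (m+1)" "alternating a \<Longrightarrow> LY * a (m+1) = a m"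
   "alternating a \<Longrightarrow> a (m+1) * LY = a m"
  by (simp_all add: alternating_def mult.commute)

text \<open>Both strings are contractions of one string of width \<open>k + 1\<close>, at its left
  and at its right end.\<close>

lemma ystring_shift:
  assumes "alternating a" "alternating b"
  shows "weight (a m) * c (ystring k (a (m+1)) (m+1) (b (m+1))) + weight (b (m+1)) * c (ystring k (a m) m (b m)) = 0"
proof -
  let ?T = "ystring (k+1) (a m) m (b (m+1))"
  have "Lterm ?T m + Rterm ?T (m+K) = 0"
    by (rule level1) (use assms[THEN alternating_neq(1)] K3 in \<open>auto simp: ystring_def split: if_splits\<close>)
  moreover have "?T(m := LI, m+1 := ?T m * ?T (m+1)) = ystring k (a (m+1)) (m+1) (b (m+1))"
    using K3 assms alternating_Suc by (auto simp: ystring_def fun_eq_iff)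
  moreover have "?T(m+K := LI, m+K-1 := ?T (m+K) * ?T (m+K-1)) = ystring k (a m) m (b m)"
    using K3 assms alternating_Suc by (auto simp: ystring_def fun_eq_iff)
  moreover have "?T m = a m" "?T (m+1) = LY" "?T (m+K) = b (m+1)" "?T (m+K-1) = LY"
    using K3 by (auto simp: ystring_def)
  ultimately show ?thesis
    by (simp add: Lterm_def Rterm_def weight_def)
qed

text \<open>The defect \<open>LX\<close> stays at site \<open>M + 1\<close> while the string slides
  from start \<open>M\<close> (defect in second place) to start \<open>M - K + 3\<close> (defect
  next to last). \<open>a M = LX\<close> makes the very first contraction vanish. \<open>F\<close>
  is all that a particular model has to supply: the field terms of each target collapse to one
  multiple \<kappa> of the undisturbed coefficient.\<close>

context
  fixes a b :: "int \<Rightarrow> letter" and M :: int and \<kappa> :: complex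
  assumes a: "alternating a" and b: "alternating b" and aM: "a M = LX"
    and F: "\<And>m. M - K + 3 \<le> m \<Longrightarrow> m \<le> M \<Longrightarrow>
        (\<Sum>i\<in>{m..m+K-1}. fieldt ((ystring k (a m) m (b m))(M+1 := LX)) i) = \<kappa> * c (ystring k (a m) m (b m))"
begin

abbreviation "base m \<equiv> ystring k (a m) m (b m)"
abbreviation "defect m \<equiv> (base m)(M+1 := LX)"

lemma defect_eq:
  assumes "M - K + 3 \<le> m" "m \<le> M"
  shows "\<kappa> * c (base m) + Lterm (defect m) m + Rterm (defect m) (m+K-1) = 0"
proof -
  have "defect m i \<noteq> LI \<longleftrightarrow> m \<le> i \<and> i \<le> m + K - 1" for i
    using assms a b alternating_neq by (auto simp: ystring_def)
  from level2_gapless[of "defect m", OF this] F[OF assms] show ?thesis by argo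
qed

text \<open>The right contraction of the target at \<open>m + 1\<close> and the left contraction of
  the target at \<open>m\<close> involve the same string \<open>P\<close>. Each equation therefore
  hands on the accumulated multiple of \<kappa> together with one of its own.\<close>

lemma defect_left:
  "n \<le> k - 3 \<Longrightarrow> Lterm (defect (M - int n)) (M - int n) = of_nat n * \<kappa> * c (base (M - int n))"
proof (induction n)
  case 0
  have "defect M M = LX" "defect M (M+1) = LX" using aM K3 by (auto simp: ystring_def)
  then show ?case by (simp add: Lterm_def)
next
  case (Suc n)
  define m where "m = M - int (Suc n)"
  have m1: "M - int n = m + 1" by (simp add: m_def)
  have mM: "m + 1 \<le> M" "M - K + 3 \<le> m" using Suc.prems k3 by (auto simp: m_def)
  have IH: "Lterm (defect (m+1)) (m+1) = of_nat n * \<kappa> * c (base (m+1))"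
    using Suc unfolding m1 by (simp del: fun_upd_apply)
  have eqs: "\<kappa> * c (base (m+1)) + Lterm (defect (m+1)) (m+1) + Rterm (defect (m+1)) (m+K) = 0"
    using defect_eq[of "m+1"] mM by (simp add: algebra_simps)
  define P where "P = (defect (m+1))(m+K := LI, m+K-1 := defect (m+1) (m+K) * defect (m+1) (m+K-1))"
  have R: "Rterm (defect (m+1)) (m+K) = weight (b (m+1)) * c P"
    unfolding P_def Rterm_def weight_def using mM K3 by (simp add: ystring_def)
  have "(defect m)(m := LI, m+1 := defect m m * defect m (m+1)) = P"
    unfolding P_def using mM K3 alternating_Suc(2)[OF a, of m] alternating_Suc(5)[OF b, of m]
    by (auto simp: ystring_def fun_eq_iff)
  then have L: "Lterm (defect m) m = weight (a m) * c P"
    unfolding Lterm_def weight_def using mM K3 by (simp add: ystring_def)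
  have "weight (b (m+1)) * Lterm (defect m) m = weight (a m) * (weight (b (m+1)) * c P)"
    by (simp add: L)
  also have "weight (b (m+1)) * c P = - (of_nat (Suc n) * \<kappa> * c (base (m+1)))"
    using eqs unfolding R IH of_nat_Suc by algebra
  also have "weight (a m) * (- (of_nat (Suc n) * \<kappa> * c (base (m+1)))) = 
             weight (b (m+1)) * (of_nat (Suc n) * \<kappa> * c (base m))"
    using ystring_shift[OF a b, of m] by algebra
  finally show ?case using weight_nz[OF b] by (simp add: m_def)
qed

text \<open>In the last target the defect stands next to a right end \<open>LX\<close> with which it
  commutes. Nothing is handed on, so the \<open>k - 3\<close> earlier contributions and its own one
  must cancel.\<close>

lemma chain_closed:
  assumes "b (M - K + 3) = LX"
  shows "of_nat (k - 2) * \<kappa> * c (base (M - K + 3)) = 0"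
proof -
  define m where "m = M - K + 3"
  have m: "M - int (k - 3) = m" using k3 by (simp add: m_def)
  have "Lterm (defect m) m = of_nat (k - 3) * \<kappa> * c (base m)"
    using defect_left[of "k-3"] unfolding m by simp
  moreover have "Rterm (defect m) (m+K-1) = 0"
    using K3 assms by (simp add: Rterm_def m_def ystring_def)
  moreover have "\<kappa> * c (base m) + Lterm (defect m) m + Rterm (defect m) (m+K-1) = 0"
    using defect_eq[of m] K3 by (simp add: m_def)
  ultimately have "(of_nat (k - 3) + 1) * \<kappa> * c (base m) = 0"
    by algebra
  also have "of_nat (k - 3) + 1 = (of_nat (k - 2) :: complex)" using k3 
    by (metis Suc_diff_Suc Suc_eq_plus1 eval_nat_numeral(3) less_le_trans lessI of_nat_Suc add.commute)
  finally show ?thesis by (simp add: m_def)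
qed

text \<open>With right end \<open>LZ\<close> the contraction of the last target survives and ends in
  \<open>LY\<close> at \<open>M + 1\<close>. One more target, ending in two letters
  \<open>LY\<close>, takes it over; its right contraction vanishes, so its field terms carry the
  whole sum.\<close>

lemma chain_open:
  assumes "b (M - K + 3) = LZ"
  shows "(\<Sum>i\<in>{M-K+2..M+1}. fieldt ((base (M-K+2))(M+1 := LY)) i) = of_nat (k - 2) * \<kappa> * c (base (M - K + 2))"
proof -
  define m where "m = M - K + 3"
  have m: "M - int (k - 3) = m" using k3 by (simp add: m_def)
  have Lm: "Lterm (defect m) m = of_nat (k - 3) * \<kappa> * c (base m)"
    using defect_left[of "k-3"] unfolding m by simp
  define P where "P = (defect m)(m+K-1 := LI, m+K-2 := defect m (m+K-1) * defect m (m+K-2))"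
  have R: "Rterm (defect m) (m+K-1) = - weight (b m) * c P"
    using K3 assms by (simp add: Rterm_def m_def ystring_def weight_def P_def)
  have k2: "of_nat (k - 3) + 1 = (of_nat (k - 2) :: complex)" using k3
    by (metis Suc_diff_Suc Suc_eq_plus1 eval_nat_numeral(3) less_le_trans lessI of_nat_Suc add.commute)
  have cP: "weight (b m) * c P = of_nat (k - 2) * \<kappa> * c (base m)"
  proof -
    have "\<kappa> * c (base m) + of_nat (k - 3) * \<kappa> * c (base m) - weight (b m) * c P = 0"
      using defect_eq[of m] K3 unfolding Lm R by (simp add: m_def)
    then show ?thesis unfolding k2[symmetric] by algebra
  qed
  define T where "T = (base (m-1))(M+1 := LY)"
  have T: "T i \<noteq> LI \<longleftrightarrow> m-1 \<le> i \<and> i \<le> m - 1 + K - 1" for i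
    using a b alternating_neq K3 by (auto simp: T_def ystring_def m_def)
  have "(\<Sum>i\<in>{m-1..m-1+K-1}. fieldt T i) + Lterm T (m-1) + Rterm T (m-1+K-1) = 0"
    by (rule level2_gapless[OF T])
  moreover have "Rterm T (m-1+K-1) = 0"
    using K3 by (simp add: Rterm_def m_def T_def ystring_def)
  moreover have "Lterm T (m-1) = weight (a (m-1)) * c P"
  proof -
    have am: "a (m-1) * LY = a m" using alternating_Suc(2)[OF a, of "m-1"] by simp
    have bm: "b m = LZ" using assms by (simp add: m_def)
    have M: "M = m + K - 3" by (simp add: m_def)
    have "T(m-1 := LI, m := T (m-1) * T m) = P"
      unfolding T_def P_def M using K3 am bm
      by (auto simp: ystring_def fun_eq_iff)
    moreover have "T (m-1) = a (m-1)" "T m = LY"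
      using K3 by (auto simp: T_def M ystring_def)
    ultimately show ?thesis
      unfolding Lterm_def weight_def by (simp del: fun_upd_apply)
  qed
  ultimately have S: "(\<Sum>i\<in>{m-1..m-1+K-1}. fieldt T i) = - weight (a (m-1)) * c P"
    by (simp add: add_eq_0_iff2)
  have "weight (b m) * (weight (a (m-1)) * c P) = weight (a (m-1)) * (of_nat (k - 2) * \<kappa> * c (base m))"
    using cP by algebra
  also have "\<dots> = - weight (b m) * (of_nat (k - 2) * \<kappa> * c (base (m - 1)))"
    using ystring_shift[OF a b, of "m-1"] by (simp add: algebra_simps) algebra
  finally have "weight (a (m-1)) * c P = - (of_nat (k - 2) * \<kappa> * c (base (m - 1)))"
    using weight_nz[OF b, of m] by (metis minus_mult_commute mult_cancel_left)
  with S have "(\<Sum>i\<in>{m-1..m-1+K-1}. fieldt T i) = of_nat (k - 2) * \<kappa> * c (base (m - 1))"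
    by (simp del: fun_upd_apply)
  moreover have "M - K + 2 = m - 1" "M + 1 = m - 1 + K - 1" by (auto simp: m_def)
  ultimately show ?thesis unfolding T_def by (simp only:)
qed

end

end

section \<open>Couplings of rank two\<close>

context spin_string_eq begin

lemma c_supp:
  assumes "c g \<noteq> 0" "g m \<noteq> LI" "g (m+K-1) \<noteq> LI" "g i \<noteq> LI"
  shows "m \<le> i" "i \<le> m + K - 1"
  using c_far[of g i "m+K-1"] c_far[of g m i] assms by force+

text \<open>The target arises from \<open>g\<close> by a bond \<open>b\<close> at the right end, so
  its right contraction gives back \<open>g\<close> and is non-zero. The left contraction must then
  be non-zero too: the string reappears one site further right.\<close>

lemma step:
  assumes c: "c g \<noteq> 0" and ends: "g m \<noteq> LI" "g (m+K-1) \<noteq> LI"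
    and b: "b \<noteq> LI" "b \<noteq> g (m+K-1)" "J b \<noteq> 0"
  shows "J (g m) \<noteq> 0" "g (m+1) \<noteq> LI" "g (m+1) \<noteq> g m"
    "c (g(m := LI, m+1 := g m * g (m+1), m+K-1 := b * g (m+K-1), m+K := b)) \<noteq> 0"
proof -
  define T where "T = g(m+K-1 := b * g (m+K-1), m+K := b)"
  have "Lterm T m + Rterm T (m+K) = 0"
  proof (rule level1)
    show "m \<le> i \<and> i \<le> m + K" if "T i \<noteq> LI" for i
      using c_supp[OF c ends, of i] that K3 by (fastforce simp: T_def split: if_splits)
  qed (use ends b K3 in \<open>auto simp: T_def\<close>)
  moreover have "g (m+K) = LI" using c_supp(2)[OF c ends, of "m+K"] by force
  then have "T(m+K := LI, m+K-1 := T (m+K) * T (m+K-1)) = g"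
    by (auto simp: T_def fun_eq_iff)
  then have "Rterm T (m+K) \<noteq> 0"
    using b c ends by (auto simp: Rterm_def T_def)
  ultimately have "Lterm T m \<noteq> 0" by auto
  moreover have "T m = g m" "T (m+1) = g (m+1)" using K3 by (auto simp: T_def)
  moreover have "T(m := LI, m+1 := g m * g (m+1)) = g(m := LI, m+1 := g m * g (m+1), m+K-1 := b * g (m+K-1), m+K := b)"
    using K3 by (auto simp: T_def fun_eq_iff)
  ultimately show "J (g m) \<noteq> 0" "g (m+1) \<noteq> LI" "g (m+1) \<noteq> g m"
    "c (g(m := LI, m+1 := g m * g (m+1), m+K-1 := b * g (m+K-1), m+K := b)) \<noteq> 0"
    by (auto simp: Lterm_def simp del: fun_upd_apply)
qed

end

text \<open>\<open>LY\<close> is the direction without coupling. A field along it alone would be the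
  integrable XY chain, so some component along a coupled axis, here \<open>LZ\<close>, is
  required.\<close>

locale rank2_string_eq = spin_string_eq +
  assumes JX: "J LX \<noteq> 0" and JZ: "J LZ \<noteq> 0" and JY: "J LY = 0" and hZ: "h LZ \<noteq> 0"
begin

lemma ex_b: "\<exists>b. b \<noteq> LI \<and> b \<noteq> x \<and> J b \<noteq> 0"
  using JX JZ by (metis letter.distinct(1,3,5,9))

text \<open>A first letter must carry a coupling. After one \<open>step\<close> the first letter is
  the product of the first two, so it must also be \<open>LX\<close> or \<open>LZ\<close>; it
  differs from the old one, hence the second letter is \<open>LY\<close>.\<close>

lemma first_two:
  assumes c: "c g \<noteq> 0" and ends: "g m \<noteq> LI" "g (m+K-1) \<noteq> LI"
  shows "g m \<in> {LX, LZ} \<and> g (m+1) = LY"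
proof -
  obtain b where b: "b \<noteq> LI" "b \<noteq> g (m+K-1)" "J b \<noteq> 0" using ex_b by blast
  define g' where "g' = g(m := LI, m+1 := g m * g (m+1), m+K-1 := b * g (m+K-1), m+K := b)"
  have s: "J (g m) \<noteq> 0" "g (m+1) \<noteq> LI" "g (m+1) \<noteq> g m" "c g' \<noteq> 0"
    unfolding g'_def by (rule step[OF c ends b])+
  have g': "g' (m+1) = g m * g (m+1)" "g' (m+1+K-1) = b" using K3 by (auto simp: g'_def)
  have "g' (m+1) \<noteq> LI" "g' (m+1+K-1) \<noteq> LI" using s b g' by auto
  note e' = this
  obtain b' where b': "b' \<noteq> LI" "b' \<noteq> g' (m+1+K-1)" "J b' \<noteq> 0" using ex_b by blast
  have "J (g' (m+1)) \<noteq> 0" by (rule step(1)[OF s(4) e' b'])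
  then show ?thesis using s g' JY ends by (cases "g m"; cases "g (m+1)"; simp)
qed

text \<open>Sliding to the right brings every inner letter into second place, where
  \<open>first_two\<close> applies.\<close>

lemma interior_Y:
  assumes "n < k - 2" "c g \<noteq> 0" "g m \<noteq> LI" "g (m+K-1) \<noteq> LI"
  shows "g (m + 1 + int n) = LY"
  using assms
proof (induction n arbitrary: g m)
  case 0
  then show ?case using first_two[of g m] by simp
next
  case (Suc n)
  note c = Suc.prems(2) and ends = Suc.prems(3,4)
  obtain b where b: "b \<noteq> LI" "b \<noteq> g (m+K-1)" "J b \<noteq> 0" using ex_b by blast
  define g' where "g' = g(m := LI, m+1 := g m * g (m+1), m+K-1 := b * g (m+K-1), m+K := b)"
  have s: "J (g m) \<noteq> 0" "g (m+1) \<noteq> LI" "g (m+1) \<noteq> g m" "c g' \<noteq> 0"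
    unfolding g'_def by (rule step[OF c ends b])+
  have g': "g' (m+1) = g m * g (m+1)" "g' (m+1+K-1) = b" using K3 by (auto simp: g'_def)
  have "g' (m+1+1+int n) = LY"
    by (rule Suc.IH) (use Suc.prems s b g' in auto)
  moreover have "g' (m+1+1+int n) = g (m+1+int (Suc n))"
    using Suc.prems(1) K3 by (auto simp: g'_def algebra_simps)
  ultimately show ?case by simp
qed

text \<open>Appending \<open>LX\<close> would turn a last letter \<open>LY\<close> into the inner
  letter \<open>LZ\<close>.\<close>

lemma last_XZ:
  assumes c: "c g \<noteq> 0" and ends: "g m \<noteq> LI" "g (m+K-1) \<noteq> LI"
  shows "g (m+K-1) \<noteq> LY"
proof
  assume Y: "g (m+K-1) = LY"
  have b: "LX \<noteq> LI" "LX \<noteq> g (m+K-1)" "J LX \<noteq> 0" using Y JX by auto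
  define g' where "g' = g(m := LI, m+1 := g m * g (m+1), m+K-1 := LX * g (m+K-1), m+K := LX)"
  have s: "J (g m) \<noteq> 0" "g (m+1) \<noteq> LI" "g (m+1) \<noteq> g m" "c g' \<noteq> 0"
    unfolding g'_def by (rule step[OF c ends b])+
  have e': "g' (m+1) \<noteq> LI" "g' (m+1+K-1) \<noteq> LI" using s(3) K3 by (auto simp: g'_def)
  have "g' (m+1+1+int (k-3)) = LY"
    by (rule interior_Y[OF _ s(4) e']) (use k3 in auto)
  moreover have "m+1+1+int (k-3) = m+K-1" using k3 by simp
  ultimately have "g' (m+K-1) = LY" by simp
  then show False using Y by (simp add: g'_def)
qed

lemma c_form:
  assumes c: "c g \<noteq> 0" and ends: "g m \<noteq> LI" "g (m+K-1) \<noteq> LI"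
  shows "g m \<in> {LX, LZ}" "g (m+K-1) \<in> {LX,LZ}" "\<And>i. m < i \<Longrightarrow> i < m+K-1 \<Longrightarrow> g i = LY"
proof -
  show "g m \<in> {LX, LZ}" using first_two[OF assms] by simp
  show "g (m+K-1) \<in> {LX,LZ}" using last_XZ[OF assms] ends by (cases "g (m+K-1)") auto
  show "g i = LY" if "m < i" "i < m+K-1" for i
    using interior_Y[OF _ assms, of "nat (i - m - 1)"] that by auto
qed

sublocale gapless_string_eq
proof
  show "c g = 0" if "g m \<noteq> LI" "g (m + K - 1) \<noteq> LI" "m < i" "i < m + K - 1" "g i = LI" for g m i
    using c_form(3)[of g m i] that by auto
qed (fact JX JZ)+

lemma base_zero:
  assumes a: "alternating a" and b: "alternating b" and z: "c (ystring k (a m) m (b m)) = 0"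
  shows "c (ystring k (a n) n (b n)) = 0"
proof -
  have "c (ystring k (a (m+1)) (m+1) (b (m+1))) = 0 \<longleftrightarrow> c (ystring k (a m) m (b m)) = 0" for m
    using ystring_shift[OF a b, of m] weight_nz[OF a, of m] weight_nz[OF b, of "m+1"] by auto
  from this[of "_ - 1"] this show ?thesis
    using z by (induction n rule: int_induct[of _ m]) auto
qed

text \<open>By \<open>c_form\<close> a non-zero source has \<open>LY\<close> at
  \<open>M + 1\<close>. Only the field along \<open>LZ\<close> turns the defect into
  \<open>LY\<close>, with sign \<open>eps LZ LX = -1\<close>; this gives \<kappa>.\<close>

lemma defect_fields:
  assumes a: "alternating a" and b: "alternating b" and m: "M - K + 3 \<le> m" "m \<le> M"
  shows "(\<Sum>i\<in>{m..m+K-1}. fieldt ((ystring k (a m) m (b m))(M+1 := LX)) i) = - h LZ * c (ystring k (a m) m (b m))"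
proof -
  define T where "T = (ystring k (a m) m (b m))(M+1 := LX)"
  have ends: "T m \<noteq> LI" "T (m+K-1) \<noteq> LI"
    using alternating_neq[OF a] alternating_neq[OF b] K3 by (auto simp: T_def ystring_def)
  have TM: "T (M+1) = LX" by (simp add: T_def)
  have z: "fieldt T i = 0" if "i \<noteq> M+1" for i
  proof (rule fieldt_zeroI)
    fix x assume x: "x \<noteq> T i"
    show "c (T(i := x * T i)) = 0"
    proof (rule ccontr)
      assume nz: "c (T(i := x * T i)) \<noteq> 0"
      have "(T(i := x * T i)) (M+1) = LY"
        by (rule c_form(3)[OF nz, of m]) (use x ends m in auto)
      then show False using TM that by simp
    qed
  qed
  have "(\<Sum>i\<in>{m..m+K-1}. fieldt T i) = (\<Sum>i\<in>{M+1}. fieldt T i)"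
    by (rule sum.mono_neutral_right) (use z m in auto)
  also have "\<dots> = fieldt T (M+1)" by simp
  also have "\<dots> = h LY * eps LY LX * c (T(M+1 := LZ)) + h LZ * eps LZ LX * c (T(M+1 := LY))"
    by (simp add: fieldt_def sum_letter TM del: fun_upd_apply)
  also have "c (T(M+1 := LZ)) = 0"
    using c_form(3)[of "T(M+1 := LZ)" m "M+1"] ends m by auto
  also have "T(M+1 := LY) = ystring k (a m) m (b m)"
    using m by (auto simp: T_def ystring_def fun_eq_iff)
  finally show ?thesis unfolding T_def by (simp del: fun_upd_apply)
qed

lemma closed_zero:
  assumes a: "alternating a" and b: "alternating b" and "a M = LX" "b (M - K + 3) = LX"
  shows "c (ystring k (a n) n (b n)) = 0"
proof -
  have "of_nat (k - 2) * (- h LZ) * c (ystring k (a (M - K + 3)) (M - K + 3) (b (M - K + 3))) = 0"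
    by (rule chain_closed[OF a b assms(3) _ assms(4)]) (rule defect_fields[OF a b])
  moreover have "of_nat (k - 2) \<noteq> (0 :: complex)"
    using k3 by (simp only: of_nat_eq_0_iff)
  ultimately have "c (ystring k (a (M - K + 3)) (M - K + 3) (b (M - K + 3))) = 0"
    using hZ by simp
  then show ?thesis by (rule base_zero[OF a b])
qed

text \<open>On the final letter \<open>LY\<close> the field \<open>h LZ\<close> reproduces the
  string with end \<open>LX\<close>, while \<open>h LX\<close> gives the end \<open>LZ\<close>, a
  string already removed by \<open>closed_zero\<close>. The former adds one unit to
  \<open>k - 2\<close>, so the total factor is \<open>k - 1\<close>.\<close>

lemma open_zero:
  assumes a: "alternating a" and b: "alternating b" and aM: "a M = LX" and bM: "b (M - K + 3) = LZ"
  shows "c (ystring k (a n) n (b n)) = 0"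
proof -
  define m where "m = M - K + 2"
  define T where "T = (ystring k (a m) m (b m))(M+1 := LY)"
  have 1: "(\<Sum>i\<in>{m..M+1}. fieldt T i) = of_nat (k - 2) * (- h LZ) * c (ystring k (a m) m (b m))"
    unfolding m_def T_def by (rule chain_open[OF a b aM _ bM]) (rule defect_fields[OF a b])
  have bm: "b m = LX" using alternating_Suc(5)[OF b, of m] bM by (simp add: m_def add.commute add.left_commute)
  have T: "T m \<noteq> LI" "T (M+1) = LY" "M + 1 = m + K - 1" 
    using alternating_neq[OF a] K3 by (auto simp: T_def ystring_def m_def)
  have z: "fieldt T i = 0" if "i \<noteq> M+1" for i
  proof (rule fieldt_zeroI)
    fix x assume x: "x \<noteq> T i"
    show "c (T(i := x * T i)) = 0"
    proof (rule ccontr)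
      assume nz: "c (T(i := x * T i)) \<noteq> 0"
      have "(T(i := x * T i)) (m+K-1) \<in> {LX,LZ}"
        by (rule c_form(2)[OF nz]) (use x T in auto)
      then show False using T that by simp
    qed
  qed
  have "(\<Sum>i\<in>{m..M+1}. fieldt T i) = (\<Sum>i\<in>{M+1}. fieldt T i)"
    by (rule sum.mono_neutral_right) (use z K3 in \<open>auto simp: m_def\<close>)
  also have "\<dots> = h LX * eps LX LY * c (T(M+1 := LZ)) + h LZ * eps LZ LY * c (T(M+1 := LX))"
    by (simp add: fieldt_def sum_letter T(2) del: fun_upd_apply)
  also have "T(M+1 := LX) = ystring k (a m) m (b m)"
    using bm K3 unfolding T_def T(3) by (auto simp: ystring_def fun_eq_iff)
  also have "T(M+1 := LZ) = ystring k (a m) m (LY * b m)"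
    using bm K3 unfolding T_def T(3) by (auto simp: ystring_def fun_eq_iff)
  also have "c (ystring k (a m) m (LY * b m)) = 0"
  proof (rule closed_zero[where b = "\<lambda>i. LY * b i"])
    show "alternating (\<lambda>i. LY * b i)"
      using b by (auto simp: alternating_def mult.assoc) (metis times_letter.simps letter.exhaust)+
    show "LY * b (M - K + 3) = LX" using bM by simp
  qed (fact a aM)+
  finally have "(of_nat (k - 2) + 1) * h LZ * c (ystring k (a m) m (b m)) = 0"
    using 1 by (simp add: algebra_simps)
  moreover have "of_nat (k - 2) + 1 \<noteq> (0 :: complex)"
    by (metis of_nat_Suc of_nat_eq_0_iff nat.distinct(1) add.commute)
  ultimately have "c (ystring k (a m) m (b m)) = 0" using hZ by simp
  then show ?thesis by (rule base_zero[OF a b])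
qed

theorem c_zero:
  assumes ends: "g m \<noteq> LI" "g (m+K-1) \<noteq> LI"
  shows "c g = 0"
proof (rule ccontr)
  assume c: "c g \<noteq> 0"
  note f = c_form[OF c ends]
  \<comment> \<open>The chain results concern whole families of strings, so both end letters of
    \<open>g\<close> are continued to alternating sequences.\<close>
  define ext where "ext u i = (if even (i - m) then u else LY * u)" for u i
  have alt: "alternating (ext u)" if "u \<in> {LX, LZ}" for u
    using that by (auto simp: alternating_def ext_def)
  have g: "g = ystring k (g m) m (g (m+K-1))"
  proof
    fix i
    have "g i = LI" if "i < m \<or> m + K - 1 < i" using c_supp[OF c ends, of i] that by force
    then show "g i = ystring k (g m) m (g (m+K-1)) i"
      using f(3)[of i] K3 by (auto simp: ystring_def)
  qed
  have a: "alternating (ext (g m))" and b: "alternating (ext (g (m+K-1)))"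
    using f alt by auto
  obtain M where M: "ext (g m) M = LX" 
    using f(1) by (cases "g m = LX") (auto simp: ext_def dest: spec[of _ m] intro: that[of m] that[of "m+1"])
  have "ext (g (m+K-1)) (M-K+3) \<in> {LX,LZ}" using b alternating_XZ by blast
  then have "c (ystring k (ext (g m) m) m (ext (g (m+K-1)) m)) = 0"
    using closed_zero[OF a b M] open_zero[OF a b M] by auto
  then show False using c g by (simp add: ext_def)
qed

end

section \<open>Couplings of rank three\<close>

text \<open>A string is encoded by its domain walls: \<open>P i\<close> is the product of the letters at sites \<open>\<le> i\<close>,
  so that a bond term multiplies a single entry of \<open>P\<close>.\<close>
definition wall_string :: "nat \<Rightarrow> letter \<Rightarrow> (int \<Rightarrow> letter) \<Rightarrow> int \<Rightarrow> int \<Rightarrow> letter" where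
  "wall_string l t P m = (\<lambda>i. if i < m \<or> m + int l - 1 < i then LI else if i = m then P m
                        else if i = m + int l - 1 then P (i-1) * t else P (i-1) * P i)"

lemma letter_mult_eq_iff [simp]: "a * b = a * c \<longleftrightarrow> b = c" "b * a = c * a \<longleftrightarrow> b = c"
  "a * b = c * a \<longleftrightarrow> b = c" "b * a = a * c \<longleftrightarrow> b = c" for a b c :: letter
  by (cases a; cases b; cases c; simp)+

locale rank3_string_eq = spin_string_eq +
  assumes JX: "J LX \<noteq> 0" and JZ: "J LZ \<noteq> 0" and JY: "J LY \<noteq> 0"
    and hZ: "h LZ \<noteq> 0" and JXY: "J LX \<noteq> J LY"
begin

lemma J_nz: "a \<noteq> LI \<Longrightarrow> J a \<noteq> 0"
  using JX JY JZ by (cases a) auto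

lemma ex_b: "\<exists>b. b \<noteq> LI \<and> b \<noteq> x \<and> J b \<noteq> 0"
  using JX JZ by (metis letter.distinct(1,3,5,9))

lemma interior_nontrivial:
  assumes "n < k - 2" "c g \<noteq> 0" "g m \<noteq> LI" "g (m+K-1) \<noteq> LI"
  shows "g (m + 1 + int n) \<noteq> LI"
  using assms
proof (induction n arbitrary: g m)
  case 0
  then show ?case using step(2)[of g m] ex_b[of "g (m+K-1)"] by auto
next
  case (Suc n)
  note c = Suc.prems(2) and ends = Suc.prems(3,4)
  obtain b where b: "b \<noteq> LI" "b \<noteq> g (m+K-1)" "J b \<noteq> 0" using ex_b by blast
  define g' where "g' = g(m := LI, m+1 := g m * g (m+1), m+K-1 := b * g (m+K-1), m+K := b)"
  have s: "J (g m) \<noteq> 0" "g (m+1) \<noteq> LI" "g (m+1) \<noteq> g m" "c g' \<noteq> 0"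
    unfolding g'_def by (rule step[OF c ends b])+
  have g': "g' (m+1) = g m * g (m+1)" "g' (m+1+K-1) = b" using K3 by (auto simp: g'_def)
  have "g' (m+1+1+int n) \<noteq> LI"
    by (rule Suc.IH) (use Suc.prems s b g' in auto)
  moreover have "g' (m+1+1+int n) = g (m+1+int (Suc n))"
    using Suc.prems(1) K3 by (auto simp: g'_def algebra_simps)
  ultimately show ?case by simp
qed

sublocale gapless_string_eq
proof
  show "c g = 0" if "g m \<noteq> LI" "g (m + K - 1) \<noteq> LI" "m < i" "i < m + K - 1" "g i = LI" for g m i
  proof (rule ccontr)
    assume "c g \<noteq> 0"
    moreover have "nat (i - m - 1) < k - 2" using that k3 by linarith
    ultimately have "g (m + 1 + int (nat (i - m - 1))) \<noteq> LI"
      using interior_nontrivial that by blast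
    then show False using that by simp
  qed
qed (fact JX JZ)+

abbreviation "S \<equiv> wall_string k"

text \<open>In wall coordinates a move only shifts the window along a fixed sequence
  \<open>P\<close>; the total product \<open>t\<close> is conserved.\<close>

lemma wall_shift:
  assumes "P m \<noteq> LI" "P (m+K-1) \<noteq> t"
  shows "J (P m) * eps (P m) (P m * P (m+1)) * c (S t P (m+1))
       + J (P (m+K-1) * t) * eps (P (m+K-1) * t) (P (m+K-2) * P (m+K-1)) * c (S t P m) = 0"
proof -
  let ?T = "wall_string (k+1) t P m"
  have "Lterm ?T m + Rterm ?T (m+K) = 0"
    by (rule level1) (use assms K3 in \<open>auto simp: wall_string_def split: if_splits\<close>)
  moreover have "?T(m := LI, m+1 := ?T m * ?T (m+1)) = S t P (m+1)"
    using K3 by (auto simp: wall_string_def fun_eq_iff)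
  moreover have "?T(m+K := LI, m+K-1 := ?T (m+K) * ?T (m+K-1)) = S t P m"
  proof
    fix i
    show "(?T(m+K := LI, m+K-1 := ?T (m+K) * ?T (m+K-1))) i = S t P m i"
      using K3 by (auto simp: wall_string_def mult.commute mult.left_commute mult.assoc)
  qed
  moreover have "?T m = P m" "?T (m+1) = P m * P (m+1)" "?T (m+K) = P (m+K-1) * t" 
    "?T (m+K-1) = P (m+K-2) * P (m+K-1)"
    using K3 by (auto simp: wall_string_def)
  ultimately show ?thesis
    by (simp add: Lterm_def Rterm_def)
qed

text \<open>The walls to the right of the string are free: any continuation that avoids
  \<open>t\<close> and immediate repetition is a legal sequence of moves. Every wall that reaches
  the left end must be nontrivial there.\<close>

lemma wall_walk:
  assumes c: "c (S t P m) \<noteq> 0" and "P m \<noteq> LI" "P (m+K-2) \<noteq> t"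
    and ext: "\<And>i. i \<ge> m+K-1 \<Longrightarrow> P i \<noteq> t \<and> P i \<noteq> P (i-1)"
  shows "c (S t P (m + int n)) \<noteq> 0 \<and> P (m + int n) \<noteq> LI"
proof (induction n)
  case 0
  then show ?case using assms by simp
next
  case (Suc n)
  define m' where "m' = m + int n"
  have e: "P (m'+K-1) \<noteq> t" "P (m'+K-1) \<noteq> P (m'+K-2)" 
    using ext[of "m'+K-1"] by (simp_all add: m'_def algebra_simps)
  have e2: "P (m'+K-2) \<noteq> t" using ext[of "m'+K-2"] assms(3) by (cases "n = 0") (auto simp: m'_def)
  have "J (P (m'+K-1) * t) * eps (P (m'+K-1) * t) (P (m'+K-2) * P (m'+K-1)) * c (S t P m') \<noteq> 0"
    using Suc e e2 J_nz by (auto simp: m'_def mult.commute)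
  then have "J (P m') * eps (P m') (P m' * P (m'+1)) * c (S t P (m'+1)) \<noteq> 0"
    using wall_shift[of P m' t] e Suc by (auto simp: m'_def add_eq_0_iff2)
  then show ?case by (auto simp: m'_def algebra_simps)
qed

lemma ex_wall_string:
  assumes "c g \<noteq> 0" "g m \<noteq> LI" "g (m+K-1) \<noteq> LI"
  shows "\<exists>P t. g = S t P m \<and> P m \<noteq> LI \<and> P (m+K-2) \<noteq> t"
proof -
  define P where "P i = (\<Prod>j\<le>nat (i - m). g (m + int j))" for i
  have P0: "P m = g m" by (simp add: P_def)
  have PS: "P i = P (i-1) * g i" if "i > m" for i
  proof -
    have "nat (i - m) = Suc (nat (i - 1 - m))" using that by auto
    then show ?thesis using that by (simp add: P_def algebra_simps)
  qed
  have "P (i-1) * P i = g i" if "i > m" for i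
    by (simp add: PS[OF that])
  moreover have "P (m+K-2) * P (m+K-1) = g (m+K-1)" using PS[of "m+K-1"] K3 by simp
  moreover have "g i = LI" if "i < m \<or> m + K - 1 < i" for i using c_supp[OF assms, of i] that by force
  ultimately have "g = S (P (m+K-1)) P m"
    using P0 K3 by (auto simp: wall_string_def fun_eq_iff)
  moreover have "P (m+K-2) \<noteq> P (m+K-1)"
    using PS[of "m+K-1"] K3 assms(3) by auto
  ultimately show ?thesis using P0 assms(2) by metis
qed

text \<open>If \<open>t\<close> is nontrivial, \<open>LI\<close> is an admissible new wall. It can
  then be walked to the left end, where it is forbidden.\<close>

lemma wall_total:
  assumes c: "c (S t P m) \<noteq> 0" and ends: "P m \<noteq> LI" "P (m+K-2) \<noteq> t"
  shows "t = LI"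
proof (rule ccontr)
  assume t: "t \<noteq> LI"
  obtain x where x: "x \<noteq> LI" "x \<noteq> t" using t by (metis letter.distinct(1,3,5,9))
  \<comment> \<open>The parity makes the first new wall differ from the last old one; one of the
    first two new walls is \<open>LI\<close>.\<close>
  define P' where "P' i = (if i < m+K-1 then P i else if even (i-(m+K-1)) = (P (m+K-2) \<noteq> LI) then LI else x)" for i
  have "S t P' m = S t P m" using K3 by (auto simp: wall_string_def fun_eq_iff P'_def)
  then have c': "c (S t P' m) \<noteq> 0" using c by simp
  have "c (S t P' (m + int n)) \<noteq> 0 \<and> P' (m + int n) \<noteq> LI" for n
  proof (rule wall_walk[OF c'])
    show "P' m \<noteq> LI" "P' (m+K-2) \<noteq> t" using ends K3 by (auto simp: P'_def)
    show "P' i \<noteq> t \<and> P' i \<noteq> P' (i-1)" if "i \<ge> m+K-1" for i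
      using that x t by (cases "i = m+K-1") (auto simp: P'_def)
  qed
  from this[of "k-1"] this[of k] show False
    using k3 by (auto simp: P'_def of_nat_diff split: if_splits)
qed


text \<open>Each old wall can itself be walked to the left end. With \<open>wall_total\<close> this
  shows that a non-zero string of width \<open>k\<close> is, up to a phase, a product of
  \<open>k - 1\<close> nontrivial bonds, one for each wall.\<close>

lemma wall_nontrivial:
  assumes c: "c (S t P m) \<noteq> 0" and ends: "P m \<noteq> LI" "P (m+K-2) \<noteq> t" and l: "m \<le> l" "l \<le> m+K-2"
  shows "P l \<noteq> LI"
proof -
  have t: "t = LI" by (rule wall_total[OF c ends])
  define P' where "P' i = (if i < m+K-1 then P i else if even (i-(m+K-1)) = (P (m+K-2) \<noteq> LX) then LX else LZ)" for i
  have "S t P' m = S t P m" using K3 by (auto simp: wall_string_def fun_eq_iff P'_def)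
  then have c': "c (S t P' m) \<noteq> 0" using c by simp
  have "c (S t P' (m + int n)) \<noteq> 0 \<and> P' (m + int n) \<noteq> LI" for n
  proof (rule wall_walk[OF c'])
    show "P' m \<noteq> LI" "P' (m+K-2) \<noteq> t" using ends K3 by (auto simp: P'_def)
    show "P' i \<noteq> t \<and> P' i \<noteq> P' (i-1)" if "i \<ge> m+K-1" for i
      using that t by (cases "i = m+K-1") (auto simp: P'_def)
  qed
  from this[of "nat (l - m)"] show ?thesis using l by (simp add: P'_def)
qed

text \<open>The walls of a \<open>ystring\<close>, with bonds \<open>X X\<close> and
  \<open>Z Z\<close> only. \<open>alt_wall M\<close> replaces the \<open>X X\<close> bond at
  \<open>M\<close> by a \<open>Y Y\<close> bond.\<close>

definition alt :: "int \<Rightarrow> int \<Rightarrow> letter" where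
  "alt M i = (if even (i - M) then LX else LZ)"

definition alt_wall :: "int \<Rightarrow> int \<Rightarrow> letter" where
  "alt_wall M = (alt M)(M := LY)"

text \<open>The letter \<open>LZ\<close> applied at a site multiplies all later walls and the total
  by \<open>LZ\<close>. This sequence, with total \<open>LZ\<close>, results both from
  \<open>alt M\<close> at site \<open>M + 1\<close> and from \<open>alt_wall M\<close> at site
  \<open>M\<close>.\<close>

definition defect_wall :: "int \<Rightarrow> int \<Rightarrow> letter" where
  "defect_wall M i = (if i \<le> M then alt M i else LZ * alt M i)"

lemma alt_alternating: "alternating (alt M)" "alternating (\<lambda>m. alt M (m + j))"
  by (auto simp: alternating_def alt_def)

lemma alt_mult [simp]: "alt M i * alt M (i+1) = LY" "alt M (j-2) * alt M (j-1) = LY"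
  by (auto simp: alt_def)

lemma alt_neq_LI [simp]: "alt M i \<noteq> LI"
  by (simp add: alt_def)

lemma S_alt: "S LI (alt M) m = ystring k (alt M m) m (alt M (m+K-2))"
  using K3 by (auto simp: wall_string_def ystring_def alt_def fun_eq_iff)

text \<open>Contracting the wall at \<open>M\<close> forgets it, so both families meet in the same
  string at \<open>M + 1\<close>. The two contraction factors \<open>- J LX\<close> and
  \<open>J LY\<close> give the ratio.\<close>

lemma ratio_at:
  "J LX * c (S LI (alt_wall M) M) = - J LY * c (S LI (alt M) M)"
proof -
  have eq: "S LI (alt_wall M) (M+1) = S LI (alt M) (M+1)"
    using K3 by (auto simp: wall_string_def alt_wall_def fun_eq_iff)
  define w where "w = J (alt M (M+K-1)) * eps (alt M (M+K-1)) LY"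
  have w: "w \<noteq> 0" using J_nz by (auto simp: w_def alt_def)
  have "J LX * (-1) * c (S LI (alt M) (M+1)) + w * c (S LI (alt M) M) = 0"
    using wall_shift[of "alt M" M LI] K3 by (auto simp: alt_def w_def)
  moreover have "J LY * c (S LI (alt M) (M+1)) + w * c (S LI (alt_wall M) M) = 0"
    using wall_shift[of "alt_wall M" M LI, unfolded eq] K3 by (auto simp: alt_def w_def alt_wall_def)
  ultimately have "w * (J LX * c (S LI (alt_wall M) M)) = w * (- J LY * c (S LI (alt M) M))"
    by algebra
  with w show ?thesis using mult_left_cancel by blast
qed

text \<open>At \<open>M - 1\<close> the end \<open>LZ\<close> is absorbed into \<open>LY\<close> in
  one family and into \<open>LX\<close> in the other, with opposite signs. Further to the left both
  families move with equal factors.\<close>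

lemma ratio_before:
  "Suc n \<le> k - 3 \<Longrightarrow>
   J LX * c (S LI (alt_wall M) (M - 1 - int n)) = J LY * c (S LI (alt M) (M - 1 - int n))"
proof (induction n)
  case 0
  define w where "w = J (alt M (M+K-2)) * eps (alt M (M+K-2)) LY"
  have w: "w \<noteq> 0" using J_nz by (auto simp: w_def alt_def)
  have k4: "K \<ge> 4" using 0 by simp
  have "J LZ * c (S LI (alt M) M) + w * c (S LI (alt M) (M-1)) = 0"
    using wall_shift[of "alt M" "M-1" LI] K3 by (auto simp: alt_def w_def)
  moreover have "J LZ * (-1) * c (S LI (alt_wall M) M) + w * c (S LI (alt_wall M) (M-1)) = 0"
    using wall_shift[of "alt_wall M" "M-1" LI] k4 by (auto simp: alt_def w_def alt_wall_def)
  ultimately have "w * (J LX * c (S LI (alt_wall M) (M-1))) = w * (J LY * c (S LI (alt M) (M-1)))"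
    using ratio_at[of M] by algebra
  then show ?case using w mult_left_cancel by simp
next
  case (Suc n)
  define m where "m = M - 1 - int (Suc n)"
  have m1: "M - 1 - int n = m + 1" by (simp add: m_def)
  have m: "m + 1 < M" "M + 2 \<le> m+K-1" using Suc.prems k3 by (auto simp: m_def)
  define w where "w = J (alt M (m+K-1)) * eps (alt M (m+K-1)) LY"
  define u where "u = J (alt M m) * eps (alt M m) LY"
  have w: "w \<noteq> 0" using J_nz by (auto simp: w_def alt_def)
  have "u * c (S LI (alt M) (m+1)) + w * c (S LI (alt M) m) = 0"
    using wall_shift[of "alt M" m LI] m by (simp add: w_def u_def)
  moreover have "u * c (S LI (alt_wall M) (m+1)) + w * c (S LI (alt_wall M) m) = 0"
    using wall_shift[of "alt_wall M" m LI] m by (simp add: w_def u_def alt_wall_def)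
  moreover have "J LX * c (S LI (alt_wall M) (m+1)) = J LY * c (S LI (alt M) (m+1))"
    using Suc.IH[unfolded m1] Suc.prems by simp
  ultimately have "w * (J LX * c (S LI (alt_wall M) m)) = w * (J LY * c (S LI (alt M) m))"
    by algebra
  with w show ?case by (simp add: m_def)
qed

text \<open>Here \<open>M\<close> is the last wall of the string and enters the factor of the right
  contraction, which flips the sign once more. For \<open>k = 3\<close> the wall is adjacent to both
  ends, hence the case distinction.\<close>

lemma ratio_first:
  "J LX * c (S LI (alt_wall M) (M - K + 2)) = - J LY * c (S LI (alt M) (M - K + 2))"
proof -
  define m where "m = M - K + 2"
  define u where "u = J (alt M m) * eps (alt M m) LY"
  have m: "m + K - 1 = M + 1" "m + K - 2 = M" "m + 1 \<le> M" using K3 by (auto simp: m_def)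
  have A: "u * c (S LI (alt M) (m+1)) + J LZ * c (S LI (alt M) m) = 0"
    using wall_shift[of "alt M" m LI, unfolded m] by (auto simp: alt_def u_def)
  show ?thesis
  proof (cases "m + 1 = M")
    case True
    then have m': "m = M - 1" by simp
    have "- u * c (S LI (alt_wall M) M) + J LZ * (-1) * c (S LI (alt_wall M) m) = 0"
      using wall_shift[of "alt_wall M" m LI, unfolded m] unfolding m' by (auto simp: alt_def u_def alt_wall_def m')
    then have "J LZ * (J LX * c (S LI (alt_wall M) m)) = J LZ * (- J LY * c (S LI (alt M) m))"
      using A ratio_at[of M] unfolding True by algebra
    with JZ have "J LX * c (S LI (alt_wall M) m) = - J LY * c (S LI (alt M) m)"
      using mult_left_cancel by blast
    then show ?thesis by (simp add: m_def)
  next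
    case False
    have "u * c (S LI (alt_wall M) (m+1)) + J LZ * (-1) * c (S LI (alt_wall M) m) = 0"
      using wall_shift[of "alt_wall M" m LI, unfolded m] False m by (auto simp: alt_def u_def alt_wall_def)
    moreover have "J LX * c (S LI (alt_wall M) (m+1)) = J LY * c (S LI (alt M) (m+1))"
      using ratio_before[of "k-4" M] False m K3 by (auto simp: m_def of_nat_diff algebra_simps)
    ultimately have "J LZ * (J LX * c (S LI (alt_wall M) m)) = J LZ * (- J LY * c (S LI (alt M) m))"
      using A by algebra
    with JZ have "J LX * c (S LI (alt_wall M) m) = - J LY * c (S LI (alt M) m)"
      using mult_left_cancel by blast
    then show ?thesis by (simp add: m_def)
  qed
qed

text \<open>Another field letter makes the total differ from \<open>LI\<close>, and
  \<open>LZ\<close> at another site leaves the wall at \<open>M - 1\<close> or at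
  \<open>M + 1\<close> equal to \<open>LI\<close>. So only the two ways of undoing the defect
  survive.\<close>

lemma defect_field_sum:
  assumes m: "M - K + 2 \<le> m" "m \<le> M"
  defines "T \<equiv> S LZ (defect_wall M) m"
  shows "(\<Sum>i\<in>{m..m+K-1}. fieldt T i)
     = h LZ * (eps LZ (T M) * c (S LI (alt_wall M) m) + eps LZ (T (M+1)) * c (S LI (alt M) m))"
proof -
  define PP where "PP a i j = (if j < i then defect_wall M j else a * defect_wall M j)" for a i j
  have upd: "T(i := a * T i) = S (a * LZ) (PP a i) m" if "m \<le> i" "i \<le> m + K - 1" for a i
    using that K3 by (auto simp: T_def wall_string_def PP_def fun_eq_iff mult.left_commute mult.assoc mult.commute)
  have ends: "defect_wall M m \<noteq> LI" "defect_wall M (m+K-2) \<noteq> LZ"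
  proof -
    show "defect_wall M m \<noteq> LI" using m by (simp add: defect_wall_def)
    have "m+K-2 = M \<or> m+K-2 > M" using m by linarith
    then show "defect_wall M (m+K-2) \<noteq> LZ" by (auto simp: defect_wall_def alt_def)
  qed
  have "T m = defect_wall M m" "T (m+K-1) = defect_wall M (m+K-2) * LZ"
    using K3 by (auto simp: T_def wall_string_def)
  then have Tends: "T m \<noteq> LI" "T (m+K-1) \<noteq> LI" using ends by auto
  have z: "c (T(i := a * T i)) = 0" if i: "m \<le> i" "i \<le> m + K - 1" and a: "a \<noteq> T i" 
    and bad: "a \<noteq> LZ \<or> i \<noteq> M \<and> i \<noteq> M + 1" for i a
  proof (rule ccontr)
    assume "c (T(i := a * T i)) \<noteq> 0"
    then have nz: "c (S (a * LZ) (PP a i) m) \<noteq> 0" unfolding upd[OF i] .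
    have e1: "PP a i m \<noteq> LI" 
      using Tends i a \<open>T m = _\<close> by (cases "i = m") (auto simp: PP_def)
    have e2: "PP a i (m+K-2) \<noteq> a * LZ"
      using ends a \<open>T (m+K-1) = _\<close> i by (cases "i = m+K-1") (auto simp: PP_def mult.commute)
    have "a * LZ = LI" by (rule wall_total[OF nz e1 e2])
    then have aZ: "a = LZ" by simp
    then have iM: "i < M \<or> i > M + 1" using bad by auto
    define l where "l = (if i < M then M - 1 else M + 1)"
    have l: "PP a i l = LI" "m \<le> l" "l \<le> m + K - 2"
      using iM aZ i m by (auto simp: PP_def l_def defect_wall_def alt_def)
    show False using wall_nontrivial[OF nz e1 e2 l(2,3)] l(1) by simp
  qed
  have f: "fieldt T i = 0" if "i \<in> {m..m+K-1} - {M, M+1}" for i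
    by (rule fieldt_zeroI, rule z) (use that in auto)
  have g: "fieldt T i = h LZ * eps LZ (T i) * c (T(i := LZ * T i))" if i: "i \<in> {M,M+1}" for i
    unfolding fieldt_def
  proof (rule sum_single)
    fix a assume a: "a \<noteq> LZ"
    show "h a * eps a (T i) * c (T(i := a * T i)) = 0"
      by (cases "a = T i") (use z[of i a] i m K3 a in auto)
  qed
  have "(\<Sum>i\<in>{m..m+K-1}. fieldt T i) = (\<Sum>i\<in>{M,M+1}. fieldt T i)"
    by (rule sum.mono_neutral_right) (use f m K3 in auto)
  also have "\<dots> = fieldt T M + fieldt T (M+1)" by simp
  also have "\<dots> = h LZ * (eps LZ (T M) * c (T(M := LZ * T M)) + eps LZ (T (M+1)) * c (T(M+1 := LZ * T (M+1))))"
    by (simp add: g algebra_simps del: fun_upd_apply)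
  also have "T(M := LZ * T M) = S LI (alt_wall M) m"
    using m K3 by (subst upd) (auto simp: wall_string_def PP_def fun_eq_iff defect_wall_def alt_wall_def alt_def)
  also have "T(M+1 := LZ * T (M+1)) = S LI (alt M) m"
    using m K3 by (subst upd) (auto simp: wall_string_def PP_def fun_eq_iff defect_wall_def alt_def)
  finally show ?thesis .
qed

text \<open>Along the chain the two field terms combine to \<open>h LZ * (J LY / J LX - 1)\<close>;
  at \<open>m = M\<close> the sign of \<open>eps\<close> and that of the ratio change together, so
  \<kappa> is constant. On the final target they give \<open>- \<kappa>\<close>, which turns
  \<open>k - 2\<close> into \<open>k - 1\<close>.\<close>

lemma alt_zero: "c (S LI (alt M) (M - K + 2)) = 0"
proof -
  define \<kappa> where "\<kappa> = h LZ * (J LY - J LX) / J LX"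
  define b where "b m = alt M (m + (K - 2))" for m
  have b: "alternating b" unfolding b_def by (rule alt_alternating)
  have S: "S LI (alt M) m = ystring k (alt M m) m (b m)" for m
    by (simp add: S_alt b_def add_diff_eq)
  have T: "S LZ (defect_wall M) m = (ystring k (alt M m) m (b m))(M+1 := LX)" if "M - K + 3 \<le> m" "m \<le> M" for m
    using that unfolding S[symmetric] by (auto simp: wall_string_def fun_eq_iff defect_wall_def alt_def)
  have T': "S LZ (defect_wall M) (M-K+2) = (ystring k (alt M (M-K+2)) (M-K+2) (b (M-K+2)))(M+1 := LY)"
    using K3 unfolding S[symmetric] by (auto simp: wall_string_def fun_eq_iff defect_wall_def alt_def)
  have F: "(\<Sum>i\<in>{m..m+K-1}. fieldt ((ystring k (alt M m) m (b m))(M+1 := LX)) i) = \<kappa> * c (ystring k (alt M m) m (b m))"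
    if m: "M - K + 3 \<le> m" "m \<le> M" for m
  proof -
    have T1: "S LZ (defect_wall M) m (M+1) = LX" unfolding T[OF m] by simp
    have T0: "S LZ (defect_wall M) m M = (if m = M then LX else LY)"
      unfolding T[OF m] using m by (auto simp: ystring_def alt_def)
    have r: "J LX * c (S LI (alt_wall M) m) = (if m = M then - 1 else 1) * J LY * c (S LI (alt M) m)"
    proof (cases "m = M")
      case True then show ?thesis using ratio_at[of M] by simp
    next
      case False
      then have "M - 1 - int (nat (M - 1 - m)) = m" "Suc (nat (M - 1 - m)) \<le> k - 3" using m k3 by auto
      then show ?thesis using ratio_before[of "nat (M - 1 - m)" M] False by simp
    qed
    have "(\<Sum>i\<in>{m..m+K-1}. fieldt (S LZ (defect_wall M) m) i)
      = h LZ * ((if m = M then -1 else 1) * c (S LI (alt_wall M) m) - c (S LI (alt M) m))"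
      using defect_field_sum[of M m] m by (simp add: T0 T1)
    also have "\<dots> = \<kappa> * c (S LI (alt M) m)"
      using r JX by (auto simp: \<kappa>_def field_simps split: if_splits)
    finally show ?thesis using T[OF m] S by metis
  qed
  have "(\<Sum>i\<in>{M-K+2..M+1}. fieldt ((ystring k (alt M (M-K+2)) (M-K+2) (b (M-K+2)))(M+1 := LY)) i)
     = of_nat (k - 2) * \<kappa> * c (ystring k (alt M (M-K+2)) (M-K+2) (b (M-K+2)))"
    by (rule chain_open[OF alt_alternating(1) b _ F]) (auto simp: alt_def b_def)
  then have 1: "(\<Sum>i\<in>{M-K+2..M+1}. fieldt (S LZ (defect_wall M) (M-K+2)) i) = of_nat (k - 2) * \<kappa> * c (S LI (alt M) (M-K+2))"
    unfolding T' S .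
  have e: "M-K+2+K-1 = M+1" by simp
  have T1: "S LZ (defect_wall M) (M-K+2) (M+1) = LY" unfolding T' by simp
  have T0: "S LZ (defect_wall M) (M-K+2) M = LY"
    unfolding T' using K3 by (auto simp: ystring_def alt_def b_def)
  have r: "c (S LI (alt_wall M) (M-K+2)) = - J LY / J LX * c (S LI (alt M) (M-K+2))"
    using ratio_first[of M] JX by (simp add: field_simps)
  have "(\<Sum>i\<in>{M-K+2..M+1}. fieldt (S LZ (defect_wall M) (M-K+2)) i) = 
     h LZ * (c (S LI (alt_wall M) (M-K+2)) + c (S LI (alt M) (M-K+2)))"
    using defect_field_sum[of M "M-K+2", unfolded e] K3 by (simp add: T0 T1)
  also have "\<dots> = - \<kappa> * c (S LI (alt M) (M-K+2))"
    unfolding r using JX by (simp add: \<kappa>_def field_simps)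
  finally have "(of_nat (k - 2) + 1) * \<kappa> * c (S LI (alt M) (M-K+2)) = 0"
    using 1 by algebra
  moreover have "of_nat (k - 2) + 1 \<noteq> (0 :: complex)"
    by (metis of_nat_Suc of_nat_eq_0_iff nat.distinct(1) add.commute)
  moreover have "\<kappa> \<noteq> 0" using hZ JX JXY by (simp add: \<kappa>_def)
  ultimately show ?thesis by simp
qed

theorem c_zero:
  assumes ends: "g m \<noteq> LI" "g (m+K-1) \<noteq> LI"
  shows "c g = 0"
proof (rule ccontr)
  assume "c g \<noteq> 0"
  then obtain P t where P: "g = S t P m" "P m \<noteq> LI" "P (m+K-2) \<noteq> t"
    using ex_wall_string[of g m] ends by blast
  then have c: "c (S t P m) \<noteq> 0" using \<open>c g \<noteq> 0\<close> by simp
  have t: "t = LI" by (rule wall_total[OF c P(2,3)])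
  \<comment> \<open>The parity of \<open>M\<close> makes the first appended wall differ from the
    last old one; \<open>2 * K\<close> moves the final window beyond all old walls.\<close>
  define M where "M = (if P (m+K-2) = LX then m+K else m+K-1) + 2 * K"
  have M: "alt M (m+K-1) \<noteq> P (m+K-2)" by (auto simp: alt_def M_def)
  define P' where "P' i = (if i < m+K-1 then P i else alt M i)" for i
  have "S t P' m = S t P m" using K3 by (auto simp: wall_string_def fun_eq_iff P'_def)
  then have c': "c (S t P' m) \<noteq> 0" using c by simp
  have "c (S t P' (m + int (nat (M - K + 2 - m)))) \<noteq> 0 \<and> P' (m + int (nat (M - K + 2 - m))) \<noteq> LI"
  proof (rule wall_walk[OF c'])
    show "P' m \<noteq> LI" "P' (m+K-2) \<noteq> t" using P K3 by (auto simp: P'_def)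
    show "P' i \<noteq> t \<and> P' i \<noteq> P' (i-1)" if "i \<ge> m+K-1" for i
      using that t M by (cases "i = m+K-1") (auto simp: P'_def alt_def)
  qed
  moreover have "m + int (nat (M - K + 2 - m)) = M - K + 2" using K3 by (simp add: M_def)
  moreover have "S t P' (M - K + 2) = S LI (alt M) (M - K + 2)"
    using K3 t by (auto simp: wall_string_def fun_eq_iff P'_def M_def)
  ultimately show False using alt_zero[of M] by simp
qed

end

section \<open>Couplings of rank one\<close>

text \<open>With ends in \<open>LY\<close> and \<open>LZ\<close> these are the Jordan-Wigner fermion
  bilinears, out of which the charges of the transverse-field Ising chain are built.\<close>

definition xstring :: "nat \<Rightarrow> letter \<Rightarrow> int \<Rightarrow> letter \<Rightarrow> int \<Rightarrow> letter" where
  "xstring l u m v = (\<lambda>i. if i < m \<or> m + int l - 1 < i then LI else if i = m then u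
                        else if i = m + int l - 1 then v else LX)"

definition zmult :: "(int \<Rightarrow> letter) \<Rightarrow> int \<Rightarrow> int \<Rightarrow> letter" where
  "zmult f i = f(i := LZ * f i)"

lemma xstring_mirror:
  "l \<ge> 2 \<Longrightarrow> (\<lambda>i. xstring l u m v (- i)) = xstring l v (- (m + int l - 1)) u"
  by (auto simp: xstring_def fun_eq_iff)

lemma zmult_mirror: "(\<lambda>i. zmult f p (- i)) = zmult (\<lambda>i. f (- i)) (- p)"
  by (auto simp: zmult_def fun_eq_iff)

lemma LZ_mult_XY [simp]: "LZ * a = LX \<longleftrightarrow> a = LY" "LZ * a = LY \<longleftrightarrow> a = LX"
  by (cases a; simp)+

text \<open>\<open>h LY = 0\<close> is a choice of frame, the coupling being invariant under
  rotations about \<open>LZ\<close>. The other two conditions keep the model away from both Ising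
  chains.\<close>

locale rank1_string_eq = spin_string_eq +
  assumes JX [simp]: "J LX = 0" and JY [simp]: "J LY = 0" and JZ: "J LZ \<noteq> 0"
    and hY [simp]: "h LY = 0" and hX: "h LX \<noteq> 0" and hZ: "h LZ \<noteq> 0"
begin

abbreviation "XY \<equiv> {LX, LY}"

lemma J_nz_iff: "a \<noteq> LI \<Longrightarrow> J a \<noteq> 0 \<longleftrightarrow> a = LZ"
  using JZ by (cases a) auto

lemma fieldt_XZ: "fieldt T i = h LX * eps LX (T i) * c (T(i := LX * T i)) + h LZ * eps LZ (T i) * c (T(i := LZ * T i))"
  by (simp add: fieldt_def sum_letter del: fun_upd_apply)

lemma bondt_Z: "bondt T i = J LZ * bsg LZ (T i) (T (i+1)) * c (T(i := LZ * T i, i+1 := LZ * T (i+1)))"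
  by (simp add: bondt_def sum_letter del: fun_upd_apply)

text \<open>The quantitative form of \<open>step\<close>: the signs matter once coefficients are
  compared.\<close>

lemma shift:
  assumes supp: "\<And>i. g i \<noteq> LI \<Longrightarrow> m \<le> i \<and> i \<le> m+K-1"
    and "g m = LZ" "g (m+K-1) \<in> XY"
  shows "eps LZ (g (m+1)) * c (g(m := LI, m+1 := LZ * g (m+1), m+K-1 := LZ * g (m+K-1), m+K := LZ))
       + eps LZ (LZ * g (m+K-1)) * c g = 0"
proof -
  define T where "T = g(m+K-1 := LZ * g (m+K-1), m+K := LZ)"
  have "Lterm T m + Rterm T (m+K) = 0"
  proof (rule level1)
    show "m \<le> i \<and> i \<le> m + K" if "T i \<noteq> LI" for i
      using supp[of i] that K3 by (auto simp: T_def split: if_splits)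
  qed (use assms K3 in \<open>auto simp: T_def\<close>)
  moreover have "g (m+K) = LI" using supp[of "m+K"] by force
  then have "T(m+K := LI, m+K-1 := T (m+K) * T (m+K-1)) = g"
    by (auto simp: T_def fun_eq_iff)
  moreover have "T(m := LI, m+1 := T m * T (m+1)) = g(m := LI, m+1 := LZ * g (m+1), m+K-1 := LZ * g (m+K-1), m+K := LZ)"
    using K3 assms by (auto simp: T_def fun_eq_iff)
  moreover have "T m = LZ" "T (m+1) = g (m+1)" "T (m+K) = LZ" "T (m+K-1) = LZ * g (m+K-1)"
    using K3 assms by (auto simp: T_def)
  ultimately have "J LZ * (eps LZ (g (m+1)) * c (g(m := LI, m+1 := LZ * g (m+1), m+K-1 := LZ * g (m+K-1), m+K := LZ))
       + eps LZ (LZ * g (m+K-1)) * c g) = 0"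
    by (simp add: Lterm_def Rterm_def algebra_simps del: fun_upd_apply)
  then show ?thesis using JZ by (metis mult_eq_0_iff)
qed

lemma XY_right:
  assumes c: "c g \<noteq> 0" and "g m \<noteq> LI" "g (m+K-1) \<in> XY"
  shows "g m = LZ" "g (m+1) \<in> XY"
proof -
  have ends: "g (m+K-1) \<noteq> LI" and b: "LZ \<noteq> LI" "LZ \<noteq> g (m+K-1)" "J LZ \<noteq> 0" using assms JZ by auto
  show Z: "g m = LZ" using step(1)[OF c assms(2) ends b] assms(2) J_nz_iff by blast
  show "g (m+1) \<in> XY" using step(2,3)[OF c assms(2) ends b] Z by (cases "g (m+1)") auto
qed

lemma XY_XY_zero: "g m \<in> XY \<Longrightarrow> g (m+K-1) \<in> XY \<Longrightarrow> c g = 0"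
  using XY_right(1)[of g m] by fastforce

text \<open>Multiplying by \<open>LZ\<close> keeps both ends in \<open>XY\<close>, and such sources
  vanish by \<open>XY_XY_zero\<close>. Only the transverse field acting on an end remains, which
  relates the two ends in a way that contractions alone do not.\<close>

lemma flip_eq:
  assumes supp: "\<And>i. T i \<noteq> LI \<Longrightarrow> m \<le> i \<and> i \<le> m+K-1"
    and ends: "T m \<in> XY" "T (m+K-1) \<in> XY"
  shows "eps LX (T m) * c (T(m := LX * T m)) + eps LX (T (m+K-1)) * c (T(m+K-1 := LX * T (m+K-1))) = 0"
proof -
  have l2: "(\<Sum>i\<in>{m..m+K-1}. fieldt T i) + (\<Sum>i\<in>{m..m+K-2}. bondt T i) = 0"
    by (rule level2[OF supp]) (use ends in auto)
  have b: "bondt T i = 0" for i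
  proof -
    have "c (T(i := LZ * T i, i+1 := LZ * T (i+1))) = 0"
      by (rule XY_XY_zero[of _ m]) (use ends K3 in \<open>auto simp: algebra_simps\<close>)
    then show ?thesis by (simp add: bondt_Z)
  qed
  have z: "c (T(i := LZ * T i)) = 0" for i
    by (rule XY_XY_zero[of _ m]) (use ends K3 in auto)
  have x: "c (T(i := LX * T i)) = 0" if "i \<noteq> m" "i \<noteq> m+K-1" for i
    by (rule XY_XY_zero[of _ m]) (use ends K3 that in auto)
  have "(\<Sum>i\<in>{m..m+K-1}. fieldt T i) = (\<Sum>i\<in>{m,m+K-1}. fieldt T i)"
    by (rule sum.mono_neutral_right) (use x z K3 in \<open>auto simp: fieldt_XZ\<close>)
  also have "\<dots> = fieldt T m + fieldt T (m+K-1)" using K3 by simp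
  finally have "h LX * (eps LX (T m) * c (T(m := LX * T m)) + eps LX (T (m+K-1)) * c (T(m+K-1 := LX * T (m+K-1)))) = 0"
    using l2 b z by (simp add: fieldt_XZ algebra_simps)
  then show ?thesis using hX by (metis mult_eq_0_iff)
qed

text \<open>Replace the left end by \<open>LY\<close>: the transverse field brings it back, but
  commutes with the right end \<open>LX\<close>, so nothing balances this coefficient.\<close>

lemma Z_X_zero:
  assumes "g m = LZ" "g (m+K-1) = LX"
  shows "c g = 0"
proof (rule ccontr)
  assume c: "c g \<noteq> 0"
  define T where "T = g(m := LY)"
  have "eps LX (T m) * c (T(m := LX * T m)) + eps LX (T (m+K-1)) * c (T(m+K-1 := LX * T (m+K-1))) = 0"
  proof (rule flip_eq)
    show "m \<le> i \<and> i \<le> m+K-1" if "T i \<noteq> LI" for i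
      using c_supp[OF c, of m i] assms that by (auto simp: T_def split: if_splits)
  qed (use assms K3 in \<open>auto simp: T_def\<close>)
  moreover have "T(m := LX * T m) = g" using assms by (auto simp: T_def)
  moreover have "T m = LY" "T (m+K-1) = LX" using assms K3 by (auto simp: T_def)
  ultimately show False using c by simp
qed

lemma mirrored: "rank1_string_eq k J h (\<lambda>g. c (\<lambda>i. g (- i)))"
  using rank1_string_eq_axioms unfolding rank1_string_eq_def by (simp add: mirror)

lemma X_Z_zero:
  assumes "g m = LX" "g (m+K-1) = LZ"
  shows "c g = 0"
proof -
  interpret R: rank1_string_eq k J h "\<lambda>g. c (\<lambda>i. g (- i))" by (rule mirrored)
  show ?thesis using R.Z_X_zero[of "\<lambda>i. g (- i)" "- (m+K-1)"] assms by simp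
qed

lemma flip_ends:
  assumes supp: "\<And>i. g i \<noteq> LI \<Longrightarrow> m \<le> i \<and> i \<le> m+K-1" and "g m = LZ" "g (m+K-1) = LY"
  shows "c (g(m := LY, m+K-1 := LZ)) = - c g"
proof -
  define T where "T = g(m := LY)"
  have "eps LX (T m) * c (T(m := LX * T m)) + eps LX (T (m+K-1)) * c (T(m+K-1 := LX * T (m+K-1))) = 0"
  proof (rule flip_eq)
    show "m \<le> i \<and> i \<le> m+K-1" if "T i \<noteq> LI" for i
      using supp[of i] assms that K3 by (auto simp: T_def split: if_splits)
  qed (use assms K3 in \<open>auto simp: T_def\<close>)
  moreover have "T(m := LX * T m) = g" using assms by (auto simp: T_def)
  moreover have T: "T m = LY" "T (m+K-1) = LY" using assms K3 by (auto simp: T_def)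
  moreover have "T(m+K-1 := LX * T (m+K-1)) = g(m := LY, m+K-1 := LZ)"
    unfolding T by (simp add: T_def)
  ultimately show ?thesis by (simp add: add_eq_0_iff2 del: fun_upd_apply)
qed

text \<open>A contraction moves the string but leaves its \<open>LZ\<close> on the right, where it
  blocks the next move; \<open>flip_ends\<close> brings it back to the left. Alternating the two,
  every inner letter reaches second place, where \<open>X_Z_zero\<close> forces
  \<open>LX\<close>.\<close>

lemma Z_Y_interior:
  assumes "n < k - 2" "c g \<noteq> 0" "g m = LZ" "g (m+K-1) = LY"
  shows "g (m+1+int n) = LX"
  using assms
proof (induction n arbitrary: g m rule: nat_less_induct)
  case (1 n)
  note c = 1(3) and ends = 1(4,5)
  have supp: "m \<le> i \<and> i \<le> m+K-1" if "g i \<noteq> LI" for i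
    using c_supp[OF c, of m i] ends that by auto
  have g1: "g (m+1) \<in> XY" using XY_right(2)[OF c, of m] ends by simp
  define g' where "g' = g(m := LI, m+1 := LZ * g (m+1), m+K-1 := LX, m+K := LZ)"
  have "eps LZ (g (m+1)) * c g' + eps LZ LX * c g = 0"
    using shift[of g m, OF supp ends(1)] ends(2) unfolding g'_def by (simp add: ends del: fun_upd_apply)
  then have c': "c g' \<noteq> 0" using c by auto
  have g': "g' (m+1) = LZ * g (m+1)" "g' (m+1+K-1) = LZ" using K3 by (auto simp: g'_def)
  have "g' (m+1) \<noteq> LX" using X_Z_zero[of g' "m+1"] c' g' by auto
  then have gX: "g (m+1) = LX" using g1 g' by auto
  then have gY: "g' (m+1) = LY" using g' by simp
  show ?case
  proof (cases n)
    case 0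
    then show ?thesis using gX by simp
  next
    case (Suc n')
    define g2 where "g2 = g'(m+1 := LZ, m+1+K-1 := LY)"
    have supp': "m+1 \<le> i \<and> i \<le> m+1+K-1" if "g2 i \<noteq> LI" for i
      using supp[of i] that K3 by (auto simp: g2_def g'_def split: if_splits)
    have "c (g2(m+1 := LY, m+1+K-1 := LZ)) = - c g2"
      by (rule flip_ends[OF supp']) (use K3 in \<open>auto simp: g2_def\<close>)
    moreover have "g2(m+1 := LY, m+1+K-1 := LZ) = g'"
      using gY g' K3 by (auto simp: g2_def)
    ultimately have "c g2 \<noteq> 0" using c' by auto
    then have "g2 (m+1+1+int n') = LX"
      using 1(1)[rule_format, of n' g2 "m+1"] 1(2) Suc K3 by (auto simp: g2_def)
    moreover have "g2 (m+1+1+int n') = g (m+1+int n)"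
      using 1(2) Suc K3 by (auto simp: g2_def g'_def algebra_simps)
    ultimately show ?thesis by simp
  qed
qed

lemma xstring_eqI:
  assumes "\<And>i. g i \<noteq> LI \<Longrightarrow> m \<le> i \<and> i \<le> m + int l - 1" "\<And>i. m < i \<Longrightarrow> i < m + int l - 1 \<Longrightarrow> g i = LX" "l \<ge> 2"
  shows "g = xstring l (g m) m (g (m + int l - 1))"
proof
  fix i
  have "g i = LI" if "i < m \<or> m + int l - 1 < i" using assms(1)[of i] that by force
  then show "g i = xstring l (g m) m (g (m + int l - 1)) i"
    using assms(2)[of i] by (auto simp: xstring_def)
qed

lemma Z_Y_form:
  assumes c: "c g \<noteq> 0" and ends: "g m = LZ" "g (m+K-1) = LY"
  shows "g = xstring k LZ m LY"
proof -
  have "g = xstring k (g m) m (g (m+K-1))"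
  proof (rule xstring_eqI)
    show "m \<le> i \<and> i \<le> m+K-1" if "g i \<noteq> LI" for i
      using c_supp[OF c, of m i] ends that by auto
    show "g i = LX" if "m < i" "i < m + K - 1" for i
    proof -
      have "nat (i - m - 1) < k - 2" using that k3 by linarith
      from Z_Y_interior[OF this c ends] that show ?thesis by simp
    qed
  qed (use k3 in auto)
  then show ?thesis using ends by simp
qed

lemma full_form:
  assumes c: "c g \<noteq> 0" and ends: "g m \<noteq> LI" "g (m+K-1) \<noteq> LI"
  shows "g = xstring k LZ m LY \<or> g = xstring k LY m LZ \<or> g m = LZ \<and> g (m+K-1) = LZ"
proof -
  have supp: "m \<le> i \<and> i \<le> m+K-1" if "g i \<noteq> LI" for i
    using c_supp[OF c ends, of i] that by auto
  consider "g (m+K-1) = LX" | "g (m+K-1) = LY" | "g (m+K-1) = LZ" "g m = LX" | "g (m+K-1) = LZ" "g m = LY" 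
    | "g (m+K-1) = LZ" "g m = LZ"
    using ends by (cases "g m"; cases "g (m+K-1)") auto
  then show ?thesis
  proof cases
    case 1
    then show ?thesis using Z_X_zero[of g m] XY_right(1)[OF c ends(1)] c by simp
  next
    case 2
    then show ?thesis using Z_Y_form[OF c] XY_right(1)[OF c ends(1)] by simp
  next
    case 3
    then show ?thesis using X_Z_zero c by simp
  next
    case 4
    define g2 where "g2 = g(m := LZ, m+K-1 := LY)"
    have "c (g2(m := LY, m+K-1 := LZ)) = - c g2"
    proof (rule flip_ends)
      show "m \<le> i \<and> i \<le> m+K-1" if "g2 i \<noteq> LI" for i
        using supp[of i] that K3 by (auto simp: g2_def split: if_splits)
    qed (use K3 in \<open>auto simp: g2_def\<close>)
    moreover have g: "g = g2(m := LY, m+K-1 := LZ)" using 4 by (auto simp: g2_def)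
    ultimately have "c g2 \<noteq> 0" using c by (metis neg_equal_0_iff_equal)
    then have "g2 = xstring k LZ m LY"
      by (rule Z_Y_form) (use K3 in \<open>auto simp: g2_def\<close>)
    then have "g = xstring k LY m LZ" unfolding g using K3 by (auto simp: xstring_def fun_eq_iff)
    then show ?thesis by simp
  qed simp
qed

end

section \<open>Rank one: the reflection-odd Ising charge, built from Z X ... X Y\<close>

context rank1_string_eq begin

abbreviation "U m \<equiv> xstring k LZ m LY"
abbreviation "V m \<equiv> xstring k LY m LZ"
abbreviation "W m \<equiv> xstring k LZ m LZ"
abbreviation "Pp m \<equiv> xstring (k-1) LY m LY"
abbreviation "zz m j \<equiv> c (zmult (W m) (m+j))"
abbreviation "pp m j \<equiv> c (zmult (Pp m) (m+j))"

lemma k1: "int (k - 1) = K - 1" using k3 by simp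

lemma U_V: "c (V m) = - c (U m)"
proof -
  have "c ((U m)(m := LY, m+K-1 := LZ)) = - c (U m)"
    by (rule flip_ends) (use K3 in \<open>auto simp: xstring_def split: if_splits\<close>)
  moreover have "(U m)(m := LY, m+K-1 := LZ) = V m" using K3 by (auto simp: xstring_def fun_eq_iff)
  ultimately show ?thesis by simp
qed

lemma U_Suc: "c (U (m+1)) = c (U m)"
proof -
  let ?g = "U m"
  have "eps LZ (?g (m+1)) * c (?g(m := LI, m+1 := LZ * ?g (m+1), m+K-1 := LZ * ?g (m+K-1), m+K := LZ))
       + eps LZ (LZ * ?g (m+K-1)) * c ?g = 0"
    by (rule shift) (use K3 in \<open>auto simp: xstring_def split: if_splits\<close>)
  moreover have "?g(m := LI, m+1 := LZ * ?g (m+1), m+K-1 := LZ * ?g (m+K-1), m+K := LZ) = V (m+1)"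
    using K3 by (auto simp: xstring_def fun_eq_iff)
  moreover have "?g (m+1) = LX" "?g (m+K-1) = LY" using K3 by (auto simp: xstring_def)
  ultimately show ?thesis using U_V[of "m+1"] by simp
qed

lemma Z_XY_zero:
  assumes "g m = LZ" "g (m+K-1) \<in> XY" "g \<noteq> U m"
  shows "c g = 0"
proof (rule ccontr)
  assume c: "c g \<noteq> 0"
  have "g m \<noteq> LI" "g (m+K-1) \<noteq> LI" using assms by auto
  from full_form[OF c this] show False using assms K3 by (auto simp: xstring_def)
qed

lemma bsg_XY [simp]: "s \<in> XY \<Longrightarrow> t \<in> XY \<Longrightarrow> bsg LZ s t = 0"
  by (auto simp: bsg_def)

lemma bsg_Z_Z [simp]: "bsg LZ LZ t = eps LZ t" "bsg LZ s LZ = eps LZ s"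
  by (auto simp: bsg_def)

text \<open>The target is \<open>U m\<close> with site \<open>m + j\<close> multiplied by
  \<open>LZ\<close>. The field \<open>h LZ\<close> undoes this, \<open>h LX\<close> turns the right
  end into \<open>LZ\<close>, and the left end contracts; other sources are excluded by
  \<open>full_form\<close>. The signs depend on whether the touched sites hold \<open>LX\<close> or
  \<open>LY\<close>.\<close>

lemma U_eq:
  assumes j: "1 \<le> j" "j \<le> K-1"
  shows "h LZ * (if j = K-1 then -1 else 1) * c (U m) + (if j \<le> K-2 then - h LX * zz m j else 0)
     + J LZ * (if j = 1 then 1 else -1) * pp (m+1) (j-1) = 0"
proof -
  define T where "T = zmult (U m) (m+j)"
  have TU: "T i = (if i = m+j then LZ * U m i else U m i)" for i by (simp add: T_def zmult_def)
  have Tm: "T m = LZ" using j K3 by (simp add: TU xstring_def)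
  have Tin: "T i \<in> XY" if "m < i" "i \<le> m+K-1" for i using that j by (auto simp: TU xstring_def)
  have Tj: "T (m+j) = (if j = K-1 then LX else LY)" using j by (auto simp: TU xstring_def)
  have T1: "T (m+1) = (if j = 1 then LY else LX)" using j K3 by (auto simp: TU xstring_def)
  have Tl: "T (m+K-1) = (if j = K-1 then LX else LY)" using j by (auto simp: TU xstring_def)
  have l2: "(\<Sum>i\<in>{m..m+K-1}. fieldt T i) + (\<Sum>i\<in>{m..m+K-2}. bondt T i) = 0"
    by (rule level2) (use j K3 Tl in \<open>auto simp: TU xstring_def split: if_splits\<close>)
  have "bondt T i = 0" if "i \<in> {m..m+K-2} - {m}" for i
    unfolding bondt_Z using Tin[of i] Tin[of "i+1"] that by simp
  then have "(\<Sum>i\<in>{m..m+K-2}. bondt T i) = (\<Sum>i\<in>{m}. bondt T i)"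
    by (intro sum.mono_neutral_right) (use K3 in auto)
  also have "\<dots> = J LZ * eps LZ (T (m+1)) * c (T(m := LZ * T m, m+1 := LZ * T (m+1)))"
    by (simp add: bondt_Z Tm del: fun_upd_apply)
  also have "T(m := LZ * T m, m+1 := LZ * T (m+1)) = zmult (Pp (m+1)) (m+1+(j-1))"
    using j K3 by (auto simp: TU zmult_def xstring_def fun_eq_iff k1)
  finally have B: "(\<Sum>i\<in>{m..m+K-2}. bondt T i) = J LZ * (if j = 1 then 1 else -1) * pp (m+1) (j-1)"
    by (simp add: T1)
  have z1: "h LZ * eps LZ (T i) * c (T(i := LZ * T i)) = 0" if "i \<noteq> m+j" "m \<le> i" "i \<le> m+K-1" for i
  proof (cases "i = m")
    case True then show ?thesis by (simp add: Tm)
  next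
    case False
    have "c (T(i := LZ * T i)) = 0"
    proof (rule Z_XY_zero[of _ m])
      show "T(i := LZ * T i) \<noteq> U m" using Tin[OF _ that(3)] False that 
        by (auto dest: fun_cong[of _ _ "m+j"] simp: TU xstring_def split: if_splits)
    qed (use False Tm Tin[of "m+K-1"] K3 in auto)
    then show ?thesis by simp
  qed
  have x1: "eps LX (T i) * c (T(i := LX * T i)) = 0" if "i \<noteq> m+K-1" "m \<le> i" "i \<le> m+K-1" for i
  proof (cases "i = m")
    case True
    have "c (T(i := LX * T i)) = 0"
      by (rule XY_XY_zero[of _ m]) (use True Tm Tin[of "m+K-1"] K3 in auto)
    then show ?thesis by simp
  next
    case False
    show ?thesis
    proof (cases "T i = LX")
      case False
      then have TY: "T i = LY" using Tin[OF _ that(3)] \<open>i \<noteq> m\<close> that by auto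
      have "c (T(i := LX * T i)) = 0"
      proof (rule Z_XY_zero[of _ m])
        show "T(i := LX * T i) \<noteq> U m" using TY \<open>i \<noteq> m\<close> that
          by (auto dest!: fun_cong[of _ _ i] simp: xstring_def)
      qed (use \<open>i \<noteq> m\<close> that Tm Tin[of "m+K-1"] K3 in auto)
      then show ?thesis by simp
    qed simp
  qed
  have "(\<Sum>i\<in>{m..m+K-1}. fieldt T i) = (\<Sum>i\<in>{m..m+K-1}. h LX * (eps LX (T i) * c (T(i := LX * T i))))
      + (\<Sum>i\<in>{m..m+K-1}. h LZ * eps LZ (T i) * c (T(i := LZ * T i)))"
    unfolding fieldt_XZ by (simp only: sum.distrib mult.assoc)
  also have "(\<Sum>i\<in>{m..m+K-1}. h LX * (eps LX (T i) * c (T(i := LX * T i))))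
     = (\<Sum>i\<in>{m+K-1}. h LX * (eps LX (T i) * c (T(i := LX * T i))))"
    by (rule sum.mono_neutral_right) (use x1 K3 in \<open>auto simp del: fun_upd_apply\<close>)
  also have "\<dots> = (if j \<le> K-2 then - h LX * zz m j else 0)"
  proof -
    have "T(m+K-1 := LZ) = zmult (W m) (m+j)" if "j \<le> K-2"
      using that j by (auto simp: TU zmult_def xstring_def fun_eq_iff)
    then show ?thesis using j by (auto simp: Tl simp del: fun_upd_apply)
  qed
  also have "(\<Sum>i\<in>{m..m+K-1}. h LZ * eps LZ (T i) * c (T(i := LZ * T i)))
     = (\<Sum>i\<in>{m+j}. h LZ * eps LZ (T i) * c (T(i := LZ * T i)))"
    by (rule sum.mono_neutral_right) (use z1 j K3 in \<open>auto simp del: fun_upd_apply\<close>)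
  also have "\<dots> = h LZ * (if j = K-1 then -1 else 1) * c (U m)"
  proof -
    have "T(m+j := LZ * T (m+j)) = U m" by (auto simp: TU fun_eq_iff)
    then show ?thesis by (simp add: Tj del: fun_upd_apply)
  qed
  finally show ?thesis using l2 B by (simp add: algebra_simps)
qed

lemma V_eq:
  assumes j: "0 \<le> j" "j \<le> K-2"
  shows "h LZ * (if j = 0 then -1 else 1) * c (V m) + (if 1 \<le> j then - h LX * zz m j else 0)
     + J LZ * (if j = K-2 then 1 else -1) * pp m j = 0"
proof -
  interpret R: rank1_string_eq k J h "\<lambda>g. c (\<lambda>i. g (- i))" by (rule mirrored)
  have k2: "2 \<le> k" "2 \<le> k - 1" using k3 by auto
  have ends: "- (- (m+K-1) + K - 1) = m" "- (- (m+K-1) + 1 + int (k-1) - 1) = m"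
    "- (- (m+K-1) + (K-1-j)) = m + j" "- (- (m+K-1) + 1 + (K-1-j-1)) = m + j"
    using k1 by auto
  have if_eqs: "K-1-j = K-1 \<longleftrightarrow> j = 0" "K-1-j \<le> K-2 \<longleftrightarrow> 1 \<le> j" "K-1-j = 1 \<longleftrightarrow> j = K-2" by auto
  show ?thesis
    using R.U_eq[of "K-1-j" "- (m+K-1)"] j
    unfolding zmult_mirror xstring_mirror[OF k2(1)] xstring_mirror[OF k2(2)] ends if_eqs by simp
qed

text \<open>\<open>U_eq\<close> at \<open>m\<close>, \<open>j\<close> and \<open>V_eq\<close> at
  \<open>m + 1\<close>, \<open>j - 1\<close> share the unknown \<open>pp (m+1) (j-1)\<close>.
  Eliminating it gives a recursion that gains \<open>2 * h LZ * c (U m)\<close> per step.\<close>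

lemma zz_value: "1 \<le> n \<Longrightarrow> int n \<le> K-2 \<Longrightarrow> h LX * zz m (int n) = 2 * of_nat n * h LZ * c (U m)"
proof (induction n arbitrary: m rule: nat_induct_at_least)
  case base
  have "h LZ * c (U m) - h LX * zz m 1 + J LZ * pp (m+1) 0 = 0"
    using U_eq[of 1 m] base K3 by (simp add: algebra_simps)
  moreover have "h LZ * c (U (m+1)) - J LZ * pp (m+1) 0 = 0"
    using V_eq[of 0 "m+1"] U_V[of "m+1"] K3 by simp
  ultimately show ?case using U_Suc[of m] by simp algebra
next
  case (Suc n)
  define j where "j = int (Suc n)"
  have j: "2 \<le> j" "j \<le> K-2" and n: "int n = j-1" using Suc by (auto simp: j_def)
  have "h LZ * c (U m) - h LX * zz m j - J LZ * pp (m+1) (j-1) = 0"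
    using U_eq[of j m] j by (simp add: algebra_simps)
  moreover have "- h LZ * c (U (m+1)) - h LX * zz (m+1) (j-1) - J LZ * pp (m+1) (j-1) = 0"
    using V_eq[of "j-1" "m+1"] U_V[of "m+1"] j by (simp add: algebra_simps)
  moreover have "h LX * zz (m+1) (j-1) = 2 * of_nat n * h LZ * c (U (m+1))"
    using Suc.IH[of "m+1"] Suc.prems by (simp add: n)
  ultimately have "h LX * zz m j = 2 * (1 + of_nat n) * h LZ * c (U m)"
    unfolding U_Suc by algebra
  then show ?case by (simp add: j_def)
qed

text \<open>At \<open>j = K - 1\<close> the \<open>zz\<close> term is absent from
  \<open>U_eq\<close>, which closes the recursion with total factor
  \<open>2 * (k - 1)\<close>.\<close>

lemma U_zero: "c (U m) = 0"
proof -
  have j: "1 \<le> k - 2" "int (k - 2) = K - 2" "int (k-2) \<le> K - 2" using k3 by auto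
  have "h LX * zz (m+1) (K-2) = 2 * of_nat (k-2) * h LZ * c (U (m+1))"
    using zz_value[OF j(1,3), of "m+1"] unfolding j(2) .
  moreover have "- h LZ * c (U m) - J LZ * pp (m+1) (K-2) = 0"
    using U_eq[of "K-1" m] K3 by simp
  moreover have "- h LZ * c (U (m+1)) - h LX * zz (m+1) (K-2) + J LZ * pp (m+1) (K-2) = 0"
    using V_eq[of "K-2" "m+1"] U_V[of "m+1"] K3 by simp
  ultimately have "2 * (of_nat (k-2) + 1) * h LZ * c (U m) = 0"
    unfolding U_Suc by algebra
  moreover have "of_nat (k - 2) + 1 \<noteq> (0 :: complex)"
    by (metis of_nat_Suc of_nat_eq_0_iff nat.distinct(1) add.commute)
  ultimately show ?thesis using hZ by (metis mult_eq_0_iff zero_neq_numeral)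
qed

end

section \<open>Rank one: shape of the reflection-even Ising charge, Z X ... X Z and Y X ... X
  Y\<close>

context rank1_string_eq begin

abbreviation "xx m j \<equiv> c (zmult (xstring (k-1) LZ m LY) (m+j))"
abbreviation "yy m j \<equiv> c (zmult (xstring (k-1) LY m LZ) (m+j))"

lemma V_zero: "c (V m) = 0"
  using U_V U_zero by simp

lemma XY_end_zero:
  assumes "g m \<noteq> LI" "g (m+K-1) \<noteq> LI" "g m \<in> XY \<or> g (m+K-1) \<in> XY"
  shows "c g = 0"
proof (rule ccontr)
  assume "c g \<noteq> 0"
  from full_form[OF this assms(1,2)] assms(3) this show False
    using U_zero V_zero by auto
qed

text \<open>With \<open>U\<close> and \<open>V\<close> gone, strings of width \<open>k\<close> with
  an end in \<open>XY\<close> vanish. A source must therefore turn the right end into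
  \<open>LZ\<close> by the field or contract the left end.\<close>

lemma Z_XY_eq:
  assumes supp: "\<And>i. T i \<noteq> LI \<Longrightarrow> m \<le> i \<and> i \<le> m+K-1" and ends: "T m = LZ" "T (m+K-1) \<in> XY"
  shows "h LX * eps LX (T (m+K-1)) * c (T(m+K-1 := LX * T (m+K-1)))
     + J LZ * eps LZ (T (m+1)) * c (T(m := LI, m+1 := LZ * T (m+1))) = 0"
proof -
  have l2: "(\<Sum>i\<in>{m..m+K-1}. fieldt T i) + (\<Sum>i\<in>{m..m+K-2}. bondt T i) = 0"
    by (rule level2[OF supp]) (use ends in auto)
  have "bondt T i = 0" if "i \<in> {m..m+K-2} - {m}" for i
  proof -
    have "c (T(i := LZ * T i, i+1 := LZ * T (i+1))) = 0"
      by (rule XY_end_zero[of _ m]) (use ends K3 that in \<open>auto simp: algebra_simps\<close>)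
    then show ?thesis by (simp add: bondt_Z)
  qed
  then have "(\<Sum>i\<in>{m..m+K-2}. bondt T i) = (\<Sum>i\<in>{m}. bondt T i)"
    by (intro sum.mono_neutral_right) (use K3 in auto)
  then have B: "(\<Sum>i\<in>{m..m+K-2}. bondt T i) = J LZ * eps LZ (T (m+1)) * c (T(m := LI, m+1 := LZ * T (m+1)))"
    by (simp add: bondt_Z ends(1) del: fun_upd_apply)
  have z: "eps LZ (T i) * c (T(i := LZ * T i)) = 0" for i
  proof (cases "i = m")
    case False
    have "c (T(i := LZ * T i)) = 0"
      by (rule XY_end_zero[of _ m]) (use ends K3 False in auto)
    then show ?thesis by simp
  qed (simp add: ends)
  have x: "c (T(i := LX * T i)) = 0" if "i \<noteq> m+K-1" for i
    by (rule XY_end_zero[of _ m]) (use ends K3 that in auto)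
  have "(\<Sum>i\<in>{m..m+K-1}. fieldt T i) = (\<Sum>i\<in>{m+K-1}. fieldt T i)"
    by (rule sum.mono_neutral_right) (use x z K3 in \<open>auto simp: fieldt_XZ\<close>)
  also have "\<dots> = h LX * eps LX (T (m+K-1)) * c (T(m+K-1 := LX * T (m+K-1)))"
    using z by (simp add: fieldt_XZ)
  finally show ?thesis using l2 B by simp
qed

text \<open>Prepending \<open>LZ\<close> to \<open>g\<close> makes it the left contraction of a
  target for \<open>Z_XY_eq\<close>, which expresses a coefficient of width \<open>k - 1\<close>
  through one of width \<open>k\<close>.\<close>

lemma short_left:
  assumes supp: "\<And>i. g i \<noteq> LI \<Longrightarrow> m \<le> i \<and> i \<le> m+K-2" and ends: "g m \<in> XY" "g (m+K-2) \<in> XY"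
  shows "h LX * eps LX (g (m+K-2)) * c (g(m-1 := LZ, m := LZ * g m, m+K-2 := LX * g (m+K-2)))
     - J LZ * eps LZ (g m) * c g = 0"
proof -
  define T where "T = g(m-1 := LZ, m := LZ * g m)"
  have "h LX * eps LX (T (m-1+K-1)) * c (T(m-1+K-1 := LX * T (m-1+K-1)))
     + J LZ * eps LZ (T (m-1+1)) * c (T(m-1 := LI, m-1+1 := LZ * T (m-1+1))) = 0"
  proof (rule Z_XY_eq)
    show "m-1 \<le> i \<and> i \<le> m-1+K-1" if "T i \<noteq> LI" for i
      using supp[of i] that K3 by (auto simp: T_def split: if_splits)
  qed (use ends K3 in \<open>auto simp: T_def\<close>)
  moreover have "m-1+K-1 = m+K-2" "m-1+1 = m" by auto
  moreover have "T (m+K-2) = g (m+K-2)" using K3 by (simp add: T_def)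
  moreover have "T m = LZ * g m" by (simp add: T_def)
  moreover have "g (m-1) = LI" using supp[of "m-1"] by force
  then have "T(m-1 := LI, m := LZ * T m) = g" by (auto simp: T_def fun_eq_iff)
  moreover have "eps LZ (LZ * g m) = - eps LZ (g m)" using ends by auto
  ultimately show ?thesis by (simp add: T_def del: fun_upd_apply)
qed

lemma short_right:
  assumes supp: "\<And>i. g i \<noteq> LI \<Longrightarrow> m \<le> i \<and> i \<le> m+K-2" and ends: "g m \<in> XY" "g (m+K-2) \<in> XY"
  shows "h LX * eps LX (g m) * c (g(m+K-1 := LZ, m+K-2 := LZ * g (m+K-2), m := LX * g m))
     - J LZ * eps LZ (g (m+K-2)) * c g = 0"
proof -
  interpret R: rank1_string_eq k J h "\<lambda>g. c (\<lambda>i. g (- i))" by (rule mirrored)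
  have e: "- (m+K-2) + K - 2 = - m" "- (m+K-2) - 1 = - (m+K-1)" by auto
  have supp': "- (m+K-2) \<le> i \<and> i \<le> - (m+K-2) + K - 2" if "g (- i) \<noteq> LI" for i
    using supp[OF that] by auto
  show ?thesis
    using R.short_left[of "\<lambda>i. g (- i)" "- (m+K-2)", OF supp'] ends
    unfolding e mirror_upd minus_minus by blast
qed

text \<open>An end \<open>LX\<close> would commute with the transverse field and force
  \<open>c g = 0\<close> through \<open>short_left\<close> or \<open>short_right\<close>. The
  surviving terms give non-zero strings on either side.\<close>

lemma short_form:
  assumes c: "c g \<noteq> 0" and supp: "\<And>i. g i \<noteq> LI \<Longrightarrow> m \<le> i \<and> i \<le> m+K-2" 
    and ends: "g m \<in> XY" "g (m+K-2) \<in> XY"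
  shows "g m = LY" "g (m+K-2) = LY"
    "c (g(m-1 := LZ, m := LX, m+K-2 := LZ)) \<noteq> 0" "c (g(m+K-1 := LZ, m+K-2 := LX, m := LZ)) \<noteq> 0"
proof -
  have nz: "J LZ * eps LZ (g m) * c g \<noteq> 0" "J LZ * eps LZ (g (m+K-2)) * c g \<noteq> 0"
    using c ends JZ by auto
  have 1: "h LX * eps LX (g (m+K-2)) * c (g(m-1 := LZ, m := LZ * g m, m+K-2 := LX * g (m+K-2))) \<noteq> 0"
    using short_left[OF supp ends] nz by auto
  have 2: "h LX * eps LX (g m) * c (g(m+K-1 := LZ, m+K-2 := LZ * g (m+K-2), m := LX * g m)) \<noteq> 0"
    using short_right[OF supp ends] nz by auto
  show Y: "g m = LY" "g (m+K-2) = LY" using 1 2 ends by auto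
  show "c (g(m-1 := LZ, m := LX, m+K-2 := LZ)) \<noteq> 0" "c (g(m+K-1 := LZ, m+K-2 := LX, m := LZ)) \<noteq> 0"
    using 1 2 unfolding Y by auto
qed

text \<open>A move is now a detour through width \<open>k - 1\<close>: contraction gives a string
  with ends \<open>LY\<close>, and \<open>short_form\<close> extends it again one site further
  right.\<close>

lemma Z_Z_interior:
  assumes "n < k - 2" "c g \<noteq> 0" "g m = LZ" "g (m+K-1) = LZ"
  shows "g (m+1+int n) = LX"
  using assms
proof (induction n arbitrary: g m rule: nat_less_induct)
  case (1 n)
  note c = 1(3) and ends = 1(4,5)
  have supp: "m \<le> i \<and> i \<le> m+K-1" if "g i \<noteq> LI" for i
    using c_supp[OF c, of m i] ends that by auto
  define T where "T = g(m+K-1 := LY)"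
  define p where "p = T(m := LI, m+1 := LZ * T (m+1))"
  have "h LX * eps LX (T (m+K-1)) * c (T(m+K-1 := LX * T (m+K-1)))
     + J LZ * eps LZ (T (m+1)) * c (T(m := LI, m+1 := LZ * T (m+1))) = 0"
  proof (rule Z_XY_eq)
    show "m \<le> i \<and> i \<le> m+K-1" if "T i \<noteq> LI" for i
      using supp[of i] that K3 by (auto simp: T_def split: if_splits)
  qed (use ends K3 in \<open>auto simp: T_def\<close>)
  moreover have "T(m+K-1 := LX * T (m+K-1)) = g" using ends by (auto simp: T_def)
  moreover have "T (m+K-1) = LY" by (simp add: T_def)
  ultimately have nz: "J LZ * eps LZ (T (m+1)) * c p \<noteq> 0"
    using c hX by (auto simp: p_def)
  have T1: "T (m+1) = g (m+1)" using K3 by (simp add: T_def)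
  have p1: "p (m+1) = LZ * g (m+1)" by (simp add: p_def T1)
  have psupp: "m+1 \<le> i \<and> i \<le> m+1+K-2" if "p i \<noteq> LI" for i
    using supp[of i] that K3 by (auto simp: p_def T_def split: if_splits)
  have pends: "p (m+1) \<in> XY" "p (m+1+K-2) \<in> XY"
  proof -
    show "p (m+1) \<in> XY" using nz unfolding T1 by (cases "g (m+1)") (auto simp: p1)
    show "p (m+1+K-2) \<in> XY" using K3 by (simp add: p_def T_def)
  qed
  have "c p \<noteq> 0" using nz by auto
  note sf = short_form[OF this psupp pends]
  have gX: "g (m+1) = LX" using sf(1) p1 by simp
  show ?case
  proof (cases n)
    case 0
    then show ?thesis using gX by simp
  next
    case (Suc n')
    define g2 where "g2 = p(m+1+K-1 := LZ, m+1+K-2 := LX, m+1 := LZ)"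
    have "g2 (m+1+1+int n') = LX"
      using 1(1)[rule_format, of n' g2 "m+1"] 1(2) Suc K3 sf(4) by (auto simp: g2_def)
    moreover have "g2 (m+1+1+int n') = g (m+1+int n)"
      using 1(2) Suc K3 by (auto simp: g2_def p_def T_def algebra_simps)
    ultimately show ?thesis by simp
  qed
qed

lemma Z_Z_form:
  assumes c: "c g \<noteq> 0" and ends: "g m \<noteq> LI" "g (m+K-1) \<noteq> LI"
  shows "g = W m"
proof -
  have Z: "g m = LZ" "g (m+K-1) = LZ"
    using XY_end_zero[OF ends] c ends by (cases "g m"; cases "g (m+K-1)"; auto)+
  have "g = xstring k (g m) m (g (m+K-1))"
  proof (rule xstring_eqI)
    show "m \<le> i \<and> i \<le> m+K-1" if "g i \<noteq> LI" for i
      using c_supp[OF c, of m i] ends that by auto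
    show "g i = LX" if "m < i" "i < m + K - 1" for i
    proof -
      have "nat (i - m - 1) < k - 2" using that k3 by linarith
      from Z_Z_interior[OF this c Z] that show ?thesis by simp
    qed
  qed (use k3 in auto)
  then show ?thesis using Z by simp
qed

lemma short_eq_Pp:
  assumes c: "c g \<noteq> 0" and supp: "\<And>i. g i \<noteq> LI \<Longrightarrow> m \<le> i \<and> i \<le> m+K-2" 
    and ends: "g m \<in> XY" "g (m+K-2) \<in> XY"
  shows "g = Pp m"
proof -
  note sf = short_form[OF assms]
  have "g(m+K-1 := LZ, m+K-2 := LX, m := LZ) = W m"
    by (rule Z_Z_form[OF sf(4)]) (use K3 in auto)
  note W = fun_cong[OF this]
  have "g = xstring (k-1) (g m) m (g (m + int (k-1) - 1))"
  proof (rule xstring_eqI)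
    show "m \<le> i \<and> i \<le> m+int (k-1) - 1" if "g i \<noteq> LI" for i
      using supp[OF that] k1 by auto
    show "g i = LX" if "m < i" "i < m + int (k-1) - 1" for i
      using W[of i] that k1 K3 by (auto simp: xstring_def)
  qed (use k3 in auto)
  moreover have "m + int (k-1) - 1 = m+K-2" using k1 by simp
  ultimately show ?thesis using sf by simp
qed

lemma W_Pp: "h LX * c (W m) = - J LZ * c (Pp m)" "h LX * c (W m) = - J LZ * c (Pp (m+1))"
proof -
  have supp: "n \<le> i \<and> i \<le> n+K-2" if "Pp n i \<noteq> LI" for n i
    using that by (auto simp: xstring_def k1 split: if_splits)
  have e: "Pp n n = LY" "Pp n (n+K-2) = LY" for n
    using K3 by (auto simp: xstring_def k1)
  have e': "Pp n n \<in> XY" "Pp n (n+K-2) \<in> XY" for n unfolding e by simp_all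
  have "(Pp m)(m+K-1 := LZ, m+K-2 := LX, m := LZ) = W m"
    using K3 by (auto simp: xstring_def k1 fun_eq_iff)
  then have "- (h LX * c (W m)) = J LZ * c (Pp m)"
    using short_right[of "Pp m" m, OF supp e', unfolded e] by (simp del: fun_upd_apply)
  then show "h LX * c (W m) = - J LZ * c (Pp m)" by algebra
  have "(Pp (m+1))(m := LZ, m+1 := LX, m+1+K-2 := LZ) = W m"
    using K3 by (auto simp: xstring_def k1 fun_eq_iff)
  then have "- (h LX * c (W m)) = J LZ * c (Pp (m+1))"
    using short_left[of "Pp (m+1)" "m+1", OF supp e', unfolded e] by (simp del: fun_upd_apply)
  then show "h LX * c (W m) = - J LZ * c (Pp (m+1))" by algebra
qed

lemma W_Suc: "c (W (m+1)) = c (W m)"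
  using W_Pp(2)[of m] W_Pp(1)[of "m+1"] hX by (metis mult_left_cancel)

end

section \<open>Rank one: the longitudinal field removes the reflection-even charge\<close>

context rank1_string_eq begin

lemma sum_fieldt_split:
  "(\<Sum>i\<in>A. fieldt T i) = (\<Sum>i\<in>A. h LX * (eps LX (T i) * c (T(i := LX * T i))))
      + (\<Sum>i\<in>A. h LZ * eps LZ (T i) * c (T(i := LZ * T i)))"
  unfolding fieldt_XZ by (simp only: sum.distrib mult.assoc)

text \<open>For this target of width \<open>k - 1\<close> inner bonds commute with the string, and
  outer bonds lead to width \<open>k\<close> with an end in \<open>XY\<close>. So only field terms
  remain.\<close>

lemma Pp_eq:
  assumes j: "0 \<le> j" "j \<le> K-2"
  shows "h LZ * (if j = 0 \<or> j = K-2 then -1 else 1) * c (Pp m)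
     - h LX * ((if 1 \<le> j then xx m j else 0) + (if j \<le> K-3 then yy m j else 0)) = 0"
proof -
  define T where "T = zmult (Pp m) (m+j)"
  have TU: "T i = (if i = m+j then LZ * Pp m i else Pp m i)" for i by (simp add: T_def zmult_def)
  have Tin: "T i \<in> XY" if "m \<le> i" "i \<le> m+K-2" for i using that j by (auto simp: TU xstring_def k1)
  have Tout: "T i = LI" if "i < m \<or> m+K-2 < i" for i using that j by (auto simp: TU xstring_def k1)
  have Tj: "T (m+j) = (if j = 0 \<or> j = K-2 then LX else LY)" using j K3 by (auto simp: TU xstring_def k1)
  have Tm: "T m = (if j = 0 then LX else LY)" using j K3 by (auto simp: TU xstring_def k1)
  have Tl: "T (m+K-2) = (if j = K-2 then LX else LY)" using j K3 by (auto simp: TU xstring_def k1)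
  have TinLI: "T i \<noteq> LI" if "m \<le> i" "i \<le> m+K-2" for i using Tin[OF that] by auto
  have zero: "c g = 0" if "g \<noteq> Pp m" "g m \<in> XY" "g (m+K-2) \<in> XY" "\<And>i. g i \<noteq> LI \<Longrightarrow> m \<le> i \<and> i \<le> m+K-2" for g
    using short_eq_Pp[of g m] that by blast
  have "(\<Sum>i\<in>{m-1..m + K + 1}. fieldt T i + bondt T i) = 0"
    using master'[of T m] Tout by force
  moreover have "bondt T i = 0" for i
  proof -
    consider "i = m-1" | "i = m+K-2" | "m \<le> i" "i+1 \<le> m+K-2" | "i < m-1 \<or> m+K-2 < i" by linarith
    then show ?thesis
    proof cases
      case 1
      have "c (T(i := LZ * T i, i+1 := LZ * T (i+1))) = 0"
        by (rule XY_end_zero[of _ "m-1"]) (use 1 Tin[of m] Tin[of "m+K-2"] Tout[of "m-1"] K3 in auto)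
      then show ?thesis by (simp add: bondt_Z)
    next
      case 2
      have "c (T(i := LZ * T i, i+1 := LZ * T (i+1))) = 0"
        by (rule XY_end_zero[of _ m]) (use 2 Tin[of m] Tin[of "m+K-2"] Tout[of "m+K-1"] K3 in auto)
      then show ?thesis by (simp add: bondt_Z)
    next
      case 3
      then show ?thesis using Tin[of i] Tin[of "i+1"] by (simp add: bondt_Z)
    next
      case 4
      then have "T i = LI" "T (i+1) = LI" using Tout by auto
      then show ?thesis by (simp add: bondt_Z)
    qed
  qed
  ultimately have "(\<Sum>i\<in>{m-1..m + K + 1}. fieldt T i) = 0" by simp
  also have "(\<Sum>i\<in>{m-1..m + K + 1}. fieldt T i) = (\<Sum>i\<in>{m..m+K-2}. fieldt T i)"
    by (rule sum.mono_neutral_right) (use Tout in \<open>auto simp: fieldt_XZ\<close>)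
  finally have l2: "(\<Sum>i\<in>{m..m+K-2}. fieldt T i) = 0" .
  have z1: "c (T(i := LZ * T i)) = 0" if "i \<noteq> m+j" "m \<le> i" "i \<le> m+K-2" for i
  proof (rule zero)
    show "T(i := LZ * T i) \<noteq> Pp m" using that j
      by (auto dest!: fun_cong[of _ _ "m+j"] simp: Tj) (auto simp: xstring_def k1 split: if_splits)
    show "m \<le> i' \<and> i' \<le> m+K-2" if "(T(i := LZ * T i)) i' \<noteq> LI" for i'
      using that Tout[of i'] \<open>m \<le> i\<close> \<open>i \<le> m+K-2\<close> by (force split: if_splits)
  qed (use Tin[of m] Tin[of "m+K-2"] K3 in auto)
  have x1: "eps LX (T i) * c (T(i := LX * T i)) = 0" if "i \<noteq> m" "i \<noteq> m+K-2" "m \<le> i" "i \<le> m+K-2" for i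
  proof (cases "T i = LX")
    case False
    then have TY: "T i = LY" using Tin[OF that(3,4)] by auto
    have "c (T(i := LX * T i)) = 0"
    proof (rule zero)
      show "T(i := LX * T i) \<noteq> Pp m" using that
        by (auto dest!: fun_cong[of _ _ i] simp: TY xstring_def k1)
      show "m \<le> i' \<and> i' \<le> m+K-2" if "(T(i := LX * T i)) i' \<noteq> LI" for i'
        using that Tout[of i'] \<open>m \<le> i\<close> \<open>i \<le> m+K-2\<close> by (force split: if_splits)
    qed (use Tin[of m] Tin[of "m+K-2"] K3 that in auto)
    then show ?thesis by simp
  qed simp
  have "(\<Sum>i\<in>{m..m+K-2}. h LX * (eps LX (T i) * c (T(i := LX * T i))))
     = (\<Sum>i\<in>{m,m+K-2}. h LX * (eps LX (T i) * c (T(i := LX * T i))))"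
    by (rule sum.mono_neutral_right) (use x1 K3 in \<open>auto simp del: fun_upd_apply\<close>)
  also have "\<dots> = - h LX * ((if 1 \<le> j then xx m j else 0) + (if j \<le> K-3 then yy m j else 0))"
  proof -
    have "T(m := LZ) = zmult (xstring (k-1) LZ m LY) (m+j)" if "1 \<le> j"
      using that j by (auto simp: TU zmult_def xstring_def fun_eq_iff k1)
    moreover have "T(m+K-2 := LZ) = zmult (xstring (k-1) LY m LZ) (m+j)" if "j \<le> K-3"
      using that j by (auto simp: TU zmult_def xstring_def fun_eq_iff k1)
    ultimately show ?thesis using j K3 by (auto simp: Tm Tl algebra_simps simp del: fun_upd_apply)
  qed
  finally have X: "(\<Sum>i\<in>{m..m+K-2}. h LX * (eps LX (T i) * c (T(i := LX * T i)))) = \<dots>" .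
  have "(\<Sum>i\<in>{m..m+K-2}. h LZ * eps LZ (T i) * c (T(i := LZ * T i)))
     = (\<Sum>i\<in>{m+j}. h LZ * eps LZ (T i) * c (T(i := LZ * T i)))"
    by (rule sum.mono_neutral_right) (use z1 j K3 in \<open>auto simp del: fun_upd_apply\<close>)
  also have "\<dots> = h LZ * (if j = 0 \<or> j = K-2 then -1 else 1) * c (Pp m)"
  proof -
    have "T(m+j := LZ * T (m+j)) = Pp m" by (auto simp: TU fun_eq_iff)
    then show ?thesis by (simp add: Tj del: fun_upd_apply)
  qed
  finally show ?thesis using l2 X unfolding sum_fieldt_split by (simp add: algebra_simps)
qed

text \<open>Here the transverse field contributes nothing, since none of its sources has the form
  \<open>W m\<close>; both end bonds contract.\<close>

lemma W_eq:
  assumes j: "1 \<le> j" "j \<le> K-2"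
  shows "h LZ * c (W m) + J LZ * (if j = 1 then 1 else -1) * yy (m+1) (j-1)
     + J LZ * (if j = K-2 then 1 else -1) * xx m j = 0"
proof -
  define T where "T = zmult (W m) (m+j)"
  have TU: "T i = (if i = m+j then LZ * W m i else W m i)" for i by (simp add: T_def zmult_def)
  have Tm: "T m = LZ" using j K3 by (simp add: TU xstring_def)
  have Tl: "T (m+K-1) = LZ" using j K3 by (simp add: TU xstring_def)
  have Tin: "T i \<in> XY" if "m < i" "i < m+K-1" for i using that j by (auto simp: TU xstring_def)
  have Tj: "T (m+j) = LY" using j by (auto simp: TU xstring_def)
  have T1: "T (m+1) = (if j = 1 then LY else LX)" using j K3 by (auto simp: TU xstring_def)
  have T2: "T (m+K-2) = (if j = K-2 then LY else LX)" using j K3 by (auto simp: TU xstring_def)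
  have l2: "(\<Sum>i\<in>{m..m+K-1}. fieldt T i) + (\<Sum>i\<in>{m..m+K-2}. bondt T i) = 0"
    by (rule level2) (use j K3 Tl in \<open>auto simp: TU xstring_def split: if_splits\<close>)
  have "bondt T i = 0" if "i \<in> {m..m+K-2} - {m,m+K-2}" for i
    unfolding bondt_Z using Tin[of i] Tin[of "i+1"] that by simp
  then have "(\<Sum>i\<in>{m..m+K-2}. bondt T i) = (\<Sum>i\<in>{m,m+K-2}. bondt T i)"
    by (intro sum.mono_neutral_right) (use K3 in auto)
  also have "\<dots> = bondt T m + bondt T (m+K-2)" using K3 by simp
  also have "bondt T m = J LZ * eps LZ (T (m+1)) * c (T(m := LZ * T m, m+1 := LZ * T (m+1)))"
    by (simp add: bondt_Z Tm del: fun_upd_apply)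
  also have "T(m := LZ * T m, m+1 := LZ * T (m+1)) = zmult (xstring (k-1) LY (m+1) LZ) (m+1+(j-1))"
    using j K3 by (auto simp: TU zmult_def xstring_def fun_eq_iff k1)
  also have "bondt T (m+K-2) = J LZ * eps LZ (T (m+K-2)) * c (T(m+K-2 := LZ * T (m+K-2), m+K-1 := LZ * T (m+K-1)))"
  proof -
    have "m+K-2+1 = m+K-1" by simp
    then show ?thesis by (simp add: bondt_Z Tl del: fun_upd_apply)
  qed
  also have "T(m+K-2 := LZ * T (m+K-2), m+K-1 := LZ * T (m+K-1)) = zmult (xstring (k-1) LZ m LY) (m+j)"
    using j K3 by (auto simp: TU zmult_def xstring_def fun_eq_iff k1)
  finally have B: "(\<Sum>i\<in>{m..m+K-2}. bondt T i) = J LZ * (if j = 1 then 1 else -1) * yy (m+1) (j-1)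
     + J LZ * (if j = K-2 then 1 else -1) * xx m j"
    by (simp add: T1 T2)
  have z1: "eps LZ (T i) * c (T(i := LZ * T i)) = 0" if "i \<noteq> m+j" "m \<le> i" "i \<le> m+K-1" for i
  proof (cases "i = m \<or> i = m+K-1")
    case True then show ?thesis using Tm Tl by auto
  next
    case False
    have "c (T(i := LZ * T i)) = 0"
    proof (rule ccontr)
      assume "c (T(i := LZ * T i)) \<noteq> 0"
      then have "T(i := LZ * T i) = W m"
        by (rule Z_Z_form) (use False Tm Tl in auto)
      from fun_cong[OF this, of "m+j"] show False using that j Tj by (auto simp: xstring_def)
    qed
    then show ?thesis by simp
  qed
  have x1: "eps LX (T i) * c (T(i := LX * T i)) = 0" if "m \<le> i" "i \<le> m+K-1" for i
  proof (cases "i = m \<or> i = m+K-1")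
    case True 
    have "c (T(i := LX * T i)) = 0"
      by (rule XY_end_zero[of _ m]) (use True Tm Tl K3 in auto)
    then show ?thesis by simp
  next
    case False
    show ?thesis
    proof (cases "T i = LX")
      case F: False
      then have TY: "T i = LY" using Tin[of i] False that by auto
      have "c (T(i := LX * T i)) = 0"
      proof (rule ccontr)
        assume "c (T(i := LX * T i)) \<noteq> 0"
        then have "T(i := LX * T i) = W m"
          by (rule Z_Z_form) (use False Tm Tl in auto)
        from fun_cong[OF this, of i] show False using that False TY by (auto simp: xstring_def)
      qed
      then show ?thesis by simp
    qed simp
  qed
  have "(\<Sum>i\<in>{m..m+K-1}. h LX * (eps LX (T i) * c (T(i := LX * T i)))) = 0"
    by (rule sum.neutral) (use x1 in \<open>auto simp del: fun_upd_apply\<close>)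
  moreover have "(\<Sum>i\<in>{m..m+K-1}. h LZ * eps LZ (T i) * c (T(i := LZ * T i)))
     = (\<Sum>i\<in>{m+j}. h LZ * eps LZ (T i) * c (T(i := LZ * T i)))"
    by (rule sum.mono_neutral_right) (use z1 j K3 in \<open>auto simp del: fun_upd_apply\<close>)
  moreover have "\<dots> = h LZ * c (W m)"
  proof -
    have "T(m+j := LZ * T (m+j)) = W m" by (auto simp: TU fun_eq_iff)
    then show ?thesis by (simp add: Tj del: fun_upd_apply)
  qed
  ultimately show ?thesis using l2 B unfolding sum_fieldt_split by algebra
qed

lemma yy_0: "J LZ * yy m 0 = h LZ * c (W m)"
proof -
  have "- h LZ * c (Pp m) - h LX * yy m 0 = 0"
    using Pp_eq[of 0 m] K3 by simp
  with W_Pp(1)[of m] have "h LX * (J LZ * yy m 0) = h LX * (h LZ * c (W m))" by algebra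
  then show ?thesis using hX by (metis mult_left_cancel)
qed

lemma xx_last: "J LZ * xx m (K-2) = h LZ * c (W m)"
proof -
  have "- h LZ * c (Pp m) - h LX * xx m (K-2) = 0"
    using Pp_eq[of "K-2" m] K3 by simp
  with W_Pp(1)[of m] have "h LX * (J LZ * xx m (K-2)) = h LX * (h LZ * c (W m))" by algebra
  then show ?thesis using hX by (metis mult_left_cancel)
qed

lemma xx_yy:
  assumes "1 \<le> j" "j \<le> K-3"
  shows "J LZ * yy m j = - h LZ * c (W m) - J LZ * xx m j"
proof -
  have "h LZ * c (Pp m) - h LX * (xx m j + yy m j) = 0"
    using Pp_eq[of j m] assms by simp
  with W_Pp(1)[of m] have "h LX * (J LZ * yy m j) = h LX * (- h LZ * c (W m) - J LZ * xx m j)" by algebra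
  then show ?thesis using hX by (metis mult_left_cancel)
qed

text \<open>\<open>xx_yy\<close> eliminates \<open>yy\<close> from \<open>W_eq\<close>, which leaves
  a recursion of the same kind as \<open>zz_value\<close>, started by \<open>yy_0\<close>.\<close>

lemma xx_value: "1 \<le> n \<Longrightarrow> int n \<le> K-3 \<Longrightarrow> J LZ * xx m (int n) = 2 * of_nat n * h LZ * c (W m)"
proof (induction n arbitrary: m rule: nat_induct_at_least)
  case base
  have "h LZ * c (W m) + J LZ * yy (m+1) 0 - J LZ * xx m 1 = 0"
    using W_eq[of 1 m] base K3 by (simp add: algebra_simps)
  then show ?case unfolding yy_0 W_Suc by simp algebra
next
  case (Suc n)
  define j where "j = int (Suc n)"
  have j: "2 \<le> j" "j \<le> K-3" and n: "int n = j-1" using Suc by (auto simp: j_def)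
  have "h LZ * c (W m) - J LZ * yy (m+1) (j-1) - J LZ * xx m j = 0"
    using W_eq[of j m] j by (simp add: algebra_simps)
  moreover have "J LZ * yy (m+1) (j-1) = - h LZ * c (W (m+1)) - J LZ * xx (m+1) (j-1)"
    using xx_yy[of "j-1" "m+1"] j by simp
  moreover have "J LZ * xx (m+1) (j-1) = 2 * of_nat n * h LZ * c (W (m+1))"
    using Suc.IH[of "m+1"] Suc.prems by (simp add: n)
  ultimately have "J LZ * xx m j = 2 * (1 + of_nat n) * h LZ * c (W m)"
    unfolding W_Suc by algebra
  then show ?case by (simp add: j_def)
qed

text \<open>The boundary value \<open>xx_last\<close> meets the recursion, with total factor
  \<open>2 * (k - 3) + 3\<close>. For \<open>k = 3\<close> both boundary values occur in one
  equation.\<close>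

lemma W_zero: "c (W m) = 0"
proof (cases "k = 3")
  case True
  then have "h LZ * c (W m) + J LZ * yy (m+1) 0 + J LZ * xx m (K-2) = 0"
    using W_eq[of 1 m] by simp
  then have "3 * (h LZ * c (W m)) = 0" unfolding yy_0 xx_last W_Suc by algebra
  then show ?thesis using hZ by simp
next
  case False
  then have j: "1 \<le> k - 3" "int (k - 3) = K - 3" "int (k-3) \<le> K - 3" "K \<ge> 4" using k3 by auto
  have "J LZ * xx (m+1) (K-3) = 2 * of_nat (k-3) * h LZ * c (W (m+1))"
    using xx_value[OF j(1,3), of "m+1"] unfolding j(2) .
  moreover have "h LZ * c (W m) - J LZ * yy (m+1) (K-3) + J LZ * xx m (K-2) = 0"
    using W_eq[of "K-2" m] j by simp
  moreover have "J LZ * yy (m+1) (K-3) = - h LZ * c (W (m+1)) - J LZ * xx (m+1) (K-3)"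
    using xx_yy[of "K-3" "m+1"] j by simp
  ultimately have "(of_nat (2 * (k-3)) + 3) * (h LZ * c (W m)) = 0"
    unfolding W_Suc xx_last of_nat_mult of_nat_numeral by algebra
  moreover have "of_nat (2 * (k-3)) + 3 = (of_nat (2 * (k-3) + 3) :: complex)" by simp
  then have "of_nat (2 * (k-3)) + 3 \<noteq> (0 :: complex)" by (metis of_nat_eq_0_iff add_is_0 zero_neq_numeral)
  ultimately show ?thesis using hZ by (metis mult_eq_0_iff)
qed

theorem c_zero:
  assumes ends: "g m \<noteq> LI" "g (m+K-1) \<noteq> LI"
  shows "c g = 0"
  using Z_Z_form[OF _ ends] W_zero by metis

end

section \<open>Operators on the ring\<close>

lemma additive_sum:
  fixes F :: "'a::comm_monoid_add \<Rightarrow> 'b::comm_monoid_add"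
  assumes "F 0 = 0" "\<And>A B. F (A + B) = F A + F B"
  shows "F (\<Sum>i\<in>I. f i) = (\<Sum>i\<in>I. F (f i))"
  by (induction I rule: infinite_finite_induct) (simp_all add: assms)

definition idop :: "nat \<Rightarrow> qop" where
  "idop N = (\<lambda>r c. if r < 2^N \<and> r = c then 1 else 0)"

definition tr :: "nat \<Rightarrow> qop \<Rightarrow> complex" where
  "tr N A = (\<Sum>r<2^N. A r r)"

lemma qop_sum_apply: "(\<Sum>i\<in>I. A i) r c = (\<Sum>i\<in>I. (A i :: qop) r c)"
  by (rule additive_sum[where F = "\<lambda>A. A r c"]) (simp_all only: zero_fun_apply plus_fun_apply)

lemma mmul_assoc: "mmul N (mmul N A B) C = mmul N A (mmul N B C)"
proof (intro ext)
  fix r c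
  have "mmul N (mmul N A B) C r c = (\<Sum>k<2^N. \<Sum>l<2^N. A r l * B l k * C k c)"
    by (simp add: mmul_def sum_distrib_right)
  also have "\<dots> = (\<Sum>l<2^N. \<Sum>k<2^N. A r l * B l k * C k c)" by (rule sum.swap)
  also have "\<dots> = mmul N A (mmul N B C) r c"
    by (simp add: mmul_def sum_distrib_left mult.assoc)
  finally show "mmul N (mmul N A B) C r c = mmul N A (mmul N B C) r c" .
qed

lemma mmul_add_left: "mmul N (A + B) C = mmul N A C + mmul N B C"
  by (simp add: mmul_def fun_eq_iff sum.distrib distrib_right)

lemma mmul_add_right: "mmul N C (A + B) = mmul N C A + mmul N C B"
  by (simp add: mmul_def fun_eq_iff sum.distrib distrib_left)

lemma mmul_smul_left: "mmul N (smul a A) C = smul a (mmul N A C)"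
  by (simp add: mmul_def smul_def fun_eq_iff sum_distrib_left mult.assoc)

lemma mmul_smul_right: "mmul N C (smul a A) = smul a (mmul N C A)"
  by (simp add: mmul_def smul_def fun_eq_iff sum_distrib_left mult.left_commute)

lemma mmul_zero [simp]: "mmul N 0 A = 0" "mmul N A 0 = 0"
  by (simp_all add: mmul_def fun_eq_iff)

lemma mmul_sum_left: "mmul N (\<Sum>i\<in>I. A i) C = (\<Sum>i\<in>I. mmul N (A i) C)"
  by (rule additive_sum[where F = "\<lambda>A. mmul N A C"]) (simp_all only: mmul_zero mmul_add_left)

lemma mmul_sum_right: "mmul N C (\<Sum>i\<in>I. A i) = (\<Sum>i\<in>I. mmul N C (A i))"
  by (rule additive_sum[where F = "\<lambda>A. mmul N C A"]) (simp_all only: mmul_zero mmul_add_right)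

lemma smul_simps [simp]:
  "smul a (smul b A) = smul (a * b) A" "smul 1 A = A" "smul 0 A = 0" "smul a 0 = 0"
  by (simp_all add: smul_def fun_eq_iff)

lemma smul_add: "smul a (A + B) = smul a A + smul a B" "smul (a + b) A = smul a A + smul b A"
  by (simp_all add: smul_def fun_eq_iff algebra_simps)

lemma smul_sum: "smul a (\<Sum>i\<in>I. A i) = (\<Sum>i\<in>I. smul a (A i))"
  by (rule additive_sum[where F = "\<lambda>A. smul a A"]) (simp_all only: smul_simps smul_add)

lemma idop_mmul [simp]: "is_op N A \<Longrightarrow> mmul N (idop N) A = A"
  "is_op N A \<Longrightarrow> mmul N A (idop N) = A"
proof -
  assume A: "is_op N A"
  have "(\<Sum>k<2^N. idop N r k * A k c) = A r c" for r c
  proof (cases "r < 2^N")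
    case True
    have "(\<Sum>k<2^N. idop N r k * A k c) = (\<Sum>k\<in>{r}. idop N r k * A k c)"
      by (rule sum.mono_neutral_right) (use True in \<open>auto simp: idop_def\<close>)
    then show ?thesis using True by (simp add: idop_def)
  next
    case False
    then show ?thesis using A by (simp add: idop_def is_op_def)
  qed
  then show "mmul N (idop N) A = A" by (simp add: mmul_def fun_eq_iff)
  have "(\<Sum>k<2^N. A r k * idop N k c) = A r c" for r c
  proof (cases "c < 2^N")
    case True
    have "(\<Sum>k<2^N. A r k * idop N k c) = (\<Sum>k\<in>{c}. A r k * idop N k c)"
      by (rule sum.mono_neutral_right) (use True in \<open>auto simp: idop_def\<close>)
    then show ?thesis using True by (simp add: idop_def)
  next
    case False
    then have "idop N k c = 0" for k by (auto simp: idop_def)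
    then show ?thesis using A False by (simp add: is_op_def)
  qed
  then show "mmul N A (idop N) = A" by (simp add: mmul_def fun_eq_iff)
qed

lemma is_op_simps [simp]: "is_op N (idop N)" "is_op N 0"
  by (auto simp: is_op_def idop_def)

lemma is_op_mmul: "is_op N A \<Longrightarrow> is_op N B \<Longrightarrow> is_op N (mmul N A B)"
  by (auto simp: is_op_def mmul_def)

lemma is_op_smul: "is_op N A \<Longrightarrow> is_op N (smul a A)"
  by (auto simp: is_op_def smul_def)

lemma is_op_sum: "(\<And>i. i \<in> I \<Longrightarrow> is_op N (A i)) \<Longrightarrow> is_op N (\<Sum>i\<in>I. A i)"
  by (auto simp: is_op_def qop_sum_apply)

lemma tr_add: "tr N (A + B) = tr N A + tr N B"
  by (simp add: tr_def sum.distrib)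

lemma tr_smul: "tr N (smul a A) = a * tr N A"
  by (simp add: tr_def smul_def sum_distrib_left)

lemma tr_zero [simp]: "tr N 0 = 0"
  by (simp add: tr_def)

lemma tr_mmul_commute: "tr N (mmul N A B) = tr N (mmul N B A)"
proof -
  have "tr N (mmul N A B) = (\<Sum>r<2^N. \<Sum>k<2^N. A r k * B k r)" by (simp add: tr_def mmul_def)
  also have "\<dots> = (\<Sum>k<2^N. \<Sum>r<2^N. A r k * B k r)" by (rule sum.swap)
  also have "\<dots> = tr N (mmul N B A)" by (simp add: tr_def mmul_def mult.commute)
  finally show ?thesis .
qed

lemma tr_idop: "tr N (idop N) = 2^N"
  by (simp add: tr_def idop_def)

section \<open>Single-site matrices inside the N-site algebra\<close>

type_synonym mat2 = "bool \<Rightarrow> bool \<Rightarrow> complex"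

definition agree_off :: "nat \<Rightarrow> nat \<Rightarrow> nat \<Rightarrow> nat \<Rightarrow> bool" where
  "agree_off N i r c \<longleftrightarrow> r < 2^N \<and> c < 2^N \<and> (\<forall>j<N. j \<noteq> i \<longrightarrow> bit r j = bit c j)"

definition lift :: "nat \<Rightarrow> nat \<Rightarrow> mat2 \<Rightarrow> qop" where
  "lift N i m = (\<lambda>r c. if agree_off N i r c then m (bit r i) (bit c i) else 0)"

definition mul2 :: "mat2 \<Rightarrow> mat2 \<Rightarrow> mat2" where
  "mul2 m m' = (\<lambda>x y. m x False * m' False y + m x True * m' True y)"

definition id2 :: mat2 where "id2 = (\<lambda>x y. if x = y then 1 else 0)"

lemma bitv_eq: "bitv r j = of_bool (bit r j)"
  by (simp add: bitv_def bit_iff_odd mod_2_eq_odd)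

lemma bitv_eq_iff: "bitv r j = bitv c j \<longleftrightarrow> bit r j = bit c j"
  by (simp only: bitv_eq of_bool_eq_iff)

lemma bit_ge_size: "\<not> bit r j" if "r < 2^N" "N \<le> j" for r :: nat
proof -
  have "r < 2^j" using that by (meson less_le_trans one_le_numeral power_increasing)
  then show ?thesis by (simp add: bit_iff_odd)
qed

lemma lt_size_iff: "r < 2^N \<longleftrightarrow> (\<forall>j\<ge>N. \<not> bit r j)" for r :: nat
proof
  assume h: "\<forall>j\<ge>N. \<not> bit r j"
  have "take_bit N r = r"
  proof (rule bit_eqI)
    fix n show "bit (take_bit N r) n = bit r n"
      using h by (cases "n < N") (auto simp: bit_take_bit_iff)
  qed
  then show "r < 2^N" by (metis take_bit_nat_less_exp)
qed (use bit_ge_size in blast)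

lemma bit_flip: "bit (flip_bit i r) j = (if j = i then \<not> bit r j else bit r j)" for r :: nat
  by (auto simp: bit_flip_bit_iff)

lemma flip_flip [simp]: "flip_bit i (flip_bit i r) = r" for r :: nat
  by (rule bit_eqI) (auto simp: bit_flip)

lemma flip_lt: "i < N \<Longrightarrow> r < 2^N \<Longrightarrow> flip_bit i r < 2^N" for r :: nat
  by (auto simp: lt_size_iff bit_flip)

lemma flip_neq [simp]: "flip_bit i r \<noteq> r" "r \<noteq> flip_bit i r" for r :: nat
proof -
  show "flip_bit i r \<noteq> r" 
  proof
    assume "flip_bit i r = r"
    then have "bit (flip_bit i r) i = bit r i" by simp
    then show False by (simp add: bit_flip)
  qed
  then show "r \<noteq> flip_bit i r" by simp
qed

lemma eq_or_flip:
  assumes "agree_off N i r c"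
  shows "c = (if bit r i = bit c i then r else flip_bit i r)"
proof (rule bit_eqI)
  fix n
  show "bit c n = bit (if bit r i = bit c i then r else flip_bit i r) n"
    using assms bit_ge_size[of r N n] bit_ge_size[of c N n]
    by (cases "n < N"; cases "n = i") (auto simp: bit_flip agree_off_def)
qed

lemma lift_diag: "r < 2^N \<Longrightarrow> lift N i m r r = m (bit r i) (bit r i)"
  by (simp add: lift_def agree_off_def)

lemma lift_flip: "r < 2^N \<Longrightarrow> i < N \<Longrightarrow> lift N i m r (flip_bit i r) = m (bit r i) (\<not> bit r i)"
  "r < 2^N \<Longrightarrow> i < N \<Longrightarrow> lift N i m (flip_bit i r) r = m (\<not> bit r i) (bit r i)"
  by (auto simp: lift_def bit_flip flip_lt agree_off_def)

lemma lift_zero: "c \<noteq> r \<Longrightarrow> c \<noteq> flip_bit i r \<Longrightarrow> lift N i m r c = 0"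
proof -
  assume *: "c \<noteq> r" "c \<noteq> flip_bit i r"
  have "\<not> agree_off N i r c"
  proof
    assume "agree_off N i r c"
    from eq_or_flip[OF this] * show False by (cases "bit r i = bit c i") simp_all
  qed
  then show ?thesis by (simp add: lift_def)
qed

lemma lift_zero': "c \<noteq> r \<Longrightarrow> r \<noteq> flip_bit i c \<Longrightarrow> lift N i m r c = 0"
  using lift_zero[of c r i] by (metis flip_flip)

lemma is_op_lift [simp]: "is_op N (lift N i m)"
  by (auto simp: is_op_def lift_def agree_off_def)

lemma lift_mmul:
  assumes "r < 2^N" "i < N"
  shows "mmul N (lift N i m) A r c = m (bit r i) (bit r i) * A r c + m (bit r i) (\<not> bit r i) * A (flip_bit i r) c"
proof -
  have "(\<Sum>k<2^N. lift N i m r k * A k c) = (\<Sum>k\<in>{r, flip_bit i r}. lift N i m r k * A k c)"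
    by (rule sum.mono_neutral_right) (use assms flip_lt lift_zero[of _ r i N m] in auto)
  then show ?thesis using assms by (simp add: mmul_def lift_diag lift_flip)
qed

lemma mmul_lift:
  assumes "c < 2^N" "i < N"
  shows "mmul N A (lift N i m) r c = A r c * m (bit c i) (bit c i) + A r (flip_bit i c) * m (\<not> bit c i) (bit c i)"
proof -
  have "(\<Sum>k<2^N. A r k * lift N i m k c) = (\<Sum>k\<in>{c, flip_bit i c}. A r k * lift N i m k c)"
    by (rule sum.mono_neutral_right) (use assms flip_lt lift_zero'[of c _ i N m] in auto)
  then show ?thesis using assms by (simp add: mmul_def lift_diag lift_flip)
qed

lemma op_eqI:
  assumes "is_op N A" "is_op N B" "\<And>r c. r < 2^N \<Longrightarrow> c < 2^N \<Longrightarrow> A r c = B r c"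
  shows "A = B"
proof (intro ext)
  fix r c show "A r c = B r c"
  proof (cases "r < 2^N \<and> c < 2^N")
    case True then show ?thesis using assms(3) by blast
  next
    case False
    then have "2^N \<le> r \<or> 2^N \<le> c" by (simp add: not_less)
    then have "A r c = 0" "B r c = 0" using assms(1,2) unfolding is_op_def by blast+
    then show ?thesis by simp
  qed
qed

lemma lift_mult: "i < N \<Longrightarrow> mmul N (lift N i m) (lift N i m') = lift N i (mul2 m m')"
proof (rule op_eqI[of N])
  fix r c :: nat assume *: "i < N" "r < 2^N" "c < 2^N"
  then have f: "flip_bit i r < 2^N" by (simp add: flip_lt)
  show "mmul N (lift N i m) (lift N i m') r c = lift N i (mul2 m m') r c"
    unfolding lift_mmul[OF *(2,1)] using * f
    by (cases "bit r i") (auto simp: lift_def mul2_def bit_flip agree_off_def)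
qed (auto simp: is_op_mmul)

lemma lift_id2: "i < N \<Longrightarrow> lift N i id2 = idop N"
proof (rule op_eqI[of N])
  fix r c :: nat assume *: "i < N" "r < 2^N" "c < 2^N"
  show "lift N i id2 r c = idop N r c"
  proof (cases "agree_off N i r c")
    case True
    from eq_or_flip[OF this] show ?thesis
      by (cases "bit r i = bit c i") (use * True in \<open>auto simp: lift_def id2_def idop_def\<close>)
  next
    case False
    then have "r \<noteq> c" using * by (auto simp: agree_off_def)
    then show ?thesis using False by (simp add: lift_def idop_def)
  qed
qed auto

lemma lift_commute:
  assumes "i < N" "j < N" "i \<noteq> j"
  shows "mmul N (lift N i m) (lift N j m') = mmul N (lift N j m') (lift N i m)"
proof (rule op_eqI[of N])
  fix r c :: nat assume *: "r < 2^N" "c < 2^N"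
  have f: "flip_bit i r < 2^N" "flip_bit i c < 2^N" using * assms by (simp_all add: flip_lt)
  have e: "bit (flip_bit i r) j = bit r j" "bit (flip_bit i c) j = bit c j" using assms by (auto simp: bit_flip)
  show "mmul N (lift N i m) (lift N j m') r c = mmul N (lift N j m') (lift N i m) r c"
    unfolding lift_mmul[OF *(1) assms(1)] mmul_lift[OF *(2) assms(1)]
    using * f e assms by (cases "bit r i"; cases "bit c i") (auto simp: lift_def bit_flip agree_off_def)
qed (auto simp: is_op_mmul)

lemma lift_smul: "lift N i (\<lambda>x y. a * m x y) = smul a (lift N i m)"
  by (auto simp: lift_def smul_def fun_eq_iff)

lemma lift_sum: "lift N i (\<lambda>x y. \<Sum>b\<in>B. m b x y) = (\<Sum>b\<in>B. lift N i (m b))"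
proof (intro ext)
  fix r c show "lift N i (\<lambda>x y. \<Sum>b\<in>B. m b x y) r c = (\<Sum>b\<in>B. lift N i (m b)) r c"
    by (cases "agree_off N i r c") (simp_all add: lift_def qop_sum_apply)
qed

definition sqb :: "3 \<Rightarrow> mat2" where
  "sqb a x y = sq a (of_bool x) (of_bool y)"

lemma pauli_index_distinct [simp]: "pX \<noteq> pY" "pX \<noteq> pZ" "pY \<noteq> pX" "pY \<noteq> pZ" "pZ \<noteq> pX" "pZ \<noteq> pY"
  by (simp_all add: pX_def pY_def pZ_def)

lemma sqb_simps:
  "sqb pX = (\<lambda>x y. if x = y then 0 else 1)"
  "sqb pY = (\<lambda>x y. if x = y then 0 else if x then \<i> else - \<i>)"
  "sqb pZ = (\<lambda>x y. if x = y then if x then -1 else 1 else 0)"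
  unfolding fun_eq_iff by (simp_all add: sqb_def sq_def split: if_splits)

lemma pauli_lift: "pauli N a i = lift N i (sqb a)"
proof (intro ext)
  fix r c
  show "pauli N a i r c = lift N i (sqb a) r c"
    unfolding pauli_def lift_def agree_off_def sqb_def bitv_eq_iff unfolding bitv_eq by simp
qed

section \<open>Support of an operator as commutation with outside sites\<close>

lemma acts_within_commute:
  assumes A: "is_op N A" "acts_within N S A" and j: "j < N" "j \<notin> S"
  shows "mmul N A (lift N j m) = mmul N (lift N j m) A"
proof (rule op_eqI[of N])
  fix r c :: nat assume *: "r < 2^N" "c < 2^N"
  have f: "flip_bit j r < 2^N" "flip_bit j c < 2^N" using * j by (simp_all add: flip_lt)
  have z: "A r c = 0" if "r < 2^N" "c < 2^N" "i < N" "i \<notin> S" "bit r i \<noteq> bit c i" for i r c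
  proof -
    have "\<exists>j<N. j \<notin> S \<and> bitv r j \<noteq> bitv c j" using that by (auto simp: bitv_eq)
    then show ?thesis using A(2) that unfolding acts_within_def by blast
  qed
  show "mmul N A (lift N j m) r c = mmul N (lift N j m) A r c"
  proof (cases "bit r j = bit c j")
    case True
    then have "A r (flip_bit j c) = 0" "A (flip_bit j r) c = 0"
      using z[OF _ _ j] * f by (auto simp: bit_flip)
    then show ?thesis using True by (simp add: lift_mmul mmul_lift * j)
  next
    case False
    then have "A r c = 0" using z[OF _ _ j] * by auto
    moreover have "A r (flip_bit j c) = A (flip_bit j r) c"
    proof (cases "\<exists>i<N. i \<notin> S \<and> i \<noteq> j \<and> bit r i \<noteq> bit c i")
      case True
      then obtain i where i: "i < N" "i \<notin> S" "i \<noteq> j" "bit r i \<noteq> bit c i" by blast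
      then have "A r (flip_bit j c) = 0" "A (flip_bit j r) c = 0"
        using z[of _ _ i] * f by (auto simp: bit_flip)
      then show ?thesis by simp
    next
      case F: False
      have "(\<forall>i<N. i \<notin> S \<longrightarrow> bitv r i = bitv (flip_bit j c) i \<and> bitv (flip_bit j r) i = bitv c i) \<and>
        (\<forall>i\<in>S. bitv r i = bitv (flip_bit j r) i \<and> bitv (flip_bit j c) i = bitv c i)"
        using F False j by (auto simp: bitv_eq bit_flip)
      then show ?thesis using A(2) * f unfolding acts_within_def by blast
    qed
    ultimately show ?thesis using False by (auto simp: lift_mmul mmul_lift * j mult.commute)
  qed
qed (simp_all add: is_op_mmul A(1))

text \<open>Commuting with \<open>Z\<close> at a site kills the entries that change its bit;
  commuting with \<open>X\<close> makes entries invariant under flipping that bit in row and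
  column.\<close>

lemma commute_acts_within:
  assumes A: "is_op N A"
    and comm: "\<And>j a. j < N \<Longrightarrow> j \<notin> S \<Longrightarrow> mmul N A (pauli N a j) = mmul N (pauli N a j) A"
  shows "acts_within N S A"
proof -
  have z: "A r c = 0" if "r < 2^N" "c < 2^N" "j < N" "j \<notin> S" "bit r j \<noteq> bit c j" for r c j
  proof -
    have "mmul N A (pauli N pZ j) r c = mmul N (pauli N pZ j) A r c"
      unfolding comm[OF that(3,4)] ..
    then show ?thesis using that
      by (cases "bit r j") (auto simp: pauli_lift lift_mmul mmul_lift sqb_simps)
  qed
  have fl: "A (flip_bit j r) (flip_bit j c) = A r c" if "r < 2^N" "c < 2^N" "j < N" "j \<notin> S" for r c j
  proof -
    have "mmul N A (pauli N pX j) (flip_bit j r) c = mmul N (pauli N pX j) A (flip_bit j r) c"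
      unfolding comm[OF that(3,4)] ..
    then show ?thesis using that flip_lt[OF that(3,1)]
      by (cases "bit r j"; cases "bit c j")
         (auto simp: pauli_lift lift_mmul mmul_lift sqb_simps bit_flip)
  qed
  \<comment> \<open>Pass from \<open>(r, c)\<close> to \<open>(r', c')\<close> by flipping the
    differing outside sites one at a time.\<close>
  have main: "A r c = A r' c'" if "finite D" "D \<subseteq> {j. j < N \<and> j \<notin> S}" 
    "r < 2^N" "c < 2^N" "r' < 2^N" "c' < 2^N"
    "\<And>j. j \<notin> D \<Longrightarrow> bit r j = bit r' j \<and> bit c j = bit c' j"
    "\<And>j. j \<in> D \<Longrightarrow> bit r j = bit c j \<and> bit r' j = bit c' j" for D r c r' c'
    using that
  proof (induction D arbitrary: r c rule: finite_induct)
    case empty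
    then have "r = r'" "c = c'" by (auto intro: bit_eqI)
    then show ?case by simp
  next
    case (insert j D)
    have j: "j < N" "j \<notin> S" using insert.prems by auto
    show ?case
    proof (cases "bit r j = bit r' j")
      case True
      show ?thesis
      proof (rule insert.IH)
        show "bit r i = bit r' i \<and> bit c i = bit c' i" if "i \<notin> D" for i
          using insert.prems(6)[of i] insert.prems(7)[of j] True that by (cases "i = j") auto
        show "bit r i = bit c i \<and> bit r' i = bit c' i" if "i \<in> D" for i
          using insert.prems(7)[of i] that by auto
      qed (use insert.prems in auto)
    next
      case False
      have "A (flip_bit j r) (flip_bit j c) = A r' c'"
      proof (rule insert.IH)
        show "bit (flip_bit j r) i = bit r' i \<and> bit (flip_bit j c) i = bit c' i" if "i \<notin> D" for i
          using insert.prems(6)[of i] insert.prems(7)[of j] False that by (cases "i = j") (auto simp: bit_flip)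
        show "bit (flip_bit j r) i = bit (flip_bit j c) i \<and> bit r' i = bit c' i" if "i \<in> D" for i
          using insert.prems(7)[of i] that by (auto simp: bit_flip)
      qed (use insert.prems flip_lt[OF j(1)] in auto)
      then show ?thesis using fl[OF insert.prems(2,3) j] by simp
    qed
  qed
  show ?thesis unfolding acts_within_def
  proof (intro conjI allI impI)
    fix r c :: nat assume "r < 2^N" "c < 2^N" "\<exists>j<N. j \<notin> S \<and> bitv r j \<noteq> bitv c j"
    then show "A r c = 0" using z unfolding bitv_eq_iff by blast
  next
    fix r c r' c' :: nat assume *: "r < 2^N" "c < 2^N" "r' < 2^N" "c' < 2^N"
      "(\<forall>j<N. j \<notin> S \<longrightarrow> bitv r j = bitv c j \<and> bitv r' j = bitv c' j) \<and>
       (\<forall>j\<in>S. bitv r j = bitv r' j \<and> bitv c j = bitv c' j)"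
    show "A r c = A r' c'"
    proof (rule main[of "{j. j < N \<and> j \<notin> S}"])
      show "bit r j = bit r' j \<and> bit c j = bit c' j" if "j \<notin> {j. j < N \<and> j \<notin> S}" for j
        using that *(1-4) *(5)[unfolded bitv_eq_iff] bit_ge_size[of _ N j] by (cases "j < N") auto
      show "bit r j = bit c j \<and> bit r' j = bit c' j" if "j \<in> {j. j < N \<and> j \<notin> S}" for j
        using that *(5)[unfolded bitv_eq_iff] by auto
    qed (use * in auto)
  qed
qed

section \<open>Pauli phases and conjugation characters\<close>

definition pm :: "letter \<Rightarrow> letter \<Rightarrow> complex" where
  "pm a b = (if a = LI \<or> b = LI \<or> a = b then 1 else - \<i> * eps a b)"

lemma pm_LI [simp]: "pm LI a = 1" "pm a LI = 1" "pm a a = 1"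
  by (simp_all add: pm_def)

lemma pm_diff: "pm t a - pm a t = 2 * \<i> * eps a t"
  by (cases a; cases t; simp add: pm_def)

lemma pm_diff2: "pm s a * pm t a - pm a s * pm a t = 2 * \<i> * bsg a s t"
  by (cases a; cases s; cases t; simp add: pm_def bsg_def)

text \<open>The sign that \<open>b\<close> acquires under conjugation by \<open>a\<close>; these are
  the characters of the four-group.\<close>

definition chi :: "letter \<Rightarrow> letter \<Rightarrow> complex" where
  "chi a b = (if a = LI \<or> b = LI \<or> a = b then 1 else -1)"

lemma pm_conj: "pm a t * pm (a * t) a = chi a t"
  by (cases a; cases t; simp add: pm_def chi_def)

lemma chi_sq [simp]: "chi a b * chi a b = 1"
  by (simp add: chi_def)

lemma chi_separates: "s \<noteq> t \<Longrightarrow> \<exists>a. chi a s * chi a t = -1"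
proof -
  assume "s \<noteq> t"
  then have "chi LX s * chi LX t = -1 \<or> chi LY s * chi LY t = -1 \<or> chi LZ s * chi LZ t = -1"
    by (cases s; cases t; simp add: chi_def)
  then show ?thesis by blast
qed

lemma chi_mult: "chi (a * b) l = chi a l * chi b l"
  by (cases a; cases b; cases l; simp add: chi_def)

lemma chi_sum: "(\<Sum>l\<in>UNIV. chi m l) = (if m = LI then 4 else 0)"
  by (cases m; simp only: sum_letter; simp add: chi_def)

text \<open>An interface satisfied by every right-handed frame. The string calculus thus works
  directly in rotated axes, without a unitary that implements the rotation.\<close>

locale pauli_basis =
  fixes N :: nat and sm :: "letter \<Rightarrow> mat2"
  assumes sm_LI: "sm LI = id2"
    and sm_mult: "\<And>a b. mul2 (sm a) (sm b) = (\<lambda>x y. pm a b * sm (a * b) x y)"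
    and sm_span: "\<And>b. \<exists>l. sqb b = (\<lambda>x y. \<Sum>a\<in>UNIV. l a * sm a x y)"
begin

definition P :: "letter \<Rightarrow> nat \<Rightarrow> qop" where
  "P a i = lift N i (sm a)"

abbreviation mm :: "qop \<Rightarrow> qop \<Rightarrow> qop" (infixl "\<odot>" 70) where "A \<odot> B \<equiv> mmul N A B"

lemma is_op_P [simp]: "is_op N (P a i)"
  by (simp add: P_def)

lemma P_LI: "i < N \<Longrightarrow> P LI i = idop N"
  by (simp add: P_def sm_LI lift_id2)

lemma P_mult: "i < N \<Longrightarrow> P a i \<odot> P b i = smul (pm a b) (P (a * b) i)"
  by (simp add: P_def lift_mult sm_mult lift_smul)

lemma P_commute: "i < N \<Longrightarrow> j < N \<Longrightarrow> i \<noteq> j \<Longrightarrow> P a i \<odot> P b j = P b j \<odot> P a i"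
  unfolding P_def by (rule lift_commute)

primrec strop :: "nat \<Rightarrow> (nat \<Rightarrow> letter) \<Rightarrow> qop" where
  "strop 0 f = idop N"
| "strop (Suc n) f = strop n f \<odot> P (f n) n"

lemma is_op_strop [simp]: "is_op N (strop n f)"
  by (induction n) (auto intro: is_op_mmul)

lemma strop_cong: "(\<And>i. i < n \<Longrightarrow> f i = g i) \<Longrightarrow> strop n f = strop n g"
  by (induction n) auto

lemma P_strop_commute: "n \<le> i \<Longrightarrow> i < N \<Longrightarrow> P a i \<odot> strop n f = strop n f \<odot> P a i"
proof (induction n)
  case (Suc n)
  have "P a i \<odot> strop (Suc n) f = (P a i \<odot> strop n f) \<odot> P (f n) n" by (simp add: mmul_assoc)
  also have "\<dots> = strop n f \<odot> (P a i \<odot> P (f n) n)" using Suc by (simp add: mmul_assoc)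
  also have "P a i \<odot> P (f n) n = P (f n) n \<odot> P a i" using Suc by (intro P_commute) auto
  finally show ?case by (simp add: mmul_assoc)
qed simp

lemma P_strop: "i < n \<Longrightarrow> n \<le> N \<Longrightarrow> P a i \<odot> strop n f = smul (pm a (f i)) (strop n (f(i := a * f i)))"
proof (induction n)
  case (Suc n)
  have e: "P a i \<odot> strop (Suc n) f = (P a i \<odot> strop n f) \<odot> P (f n) n" by (simp add: mmul_assoc)
  show ?case
  proof (cases "i = n")
    case True
    have "strop n (f(n := a * f n)) = strop n f" by (rule strop_cong) auto
    then have "strop (Suc n) (f(n := a * f n)) = strop n f \<odot> P (a * f n) n"
      by (simp only: strop.simps fun_upd_same)
    then show ?thesis using Suc.prems e[unfolded True] unfolding True
      by (simp only: P_strop_commute mmul_assoc P_mult mmul_smul_right le_refl Suc_le_eq)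
  next
    case False
    then show ?thesis using Suc unfolding e by (simp add: mmul_smul_left)
  qed
qed simp

lemma strop_P: "i < n \<Longrightarrow> n \<le> N \<Longrightarrow> strop n f \<odot> P a i = smul (pm (f i) a) (strop n (f(i := a * f i)))"
proof (induction n)
  case (Suc n)
  show ?case
  proof (cases "i = n")
    case True
    have "strop n (f(n := a * f n)) = strop n f" by (rule strop_cong) auto
    then have "strop (Suc n) (f(n := a * f n)) = strop n f \<odot> P (a * f n) n"
      by (simp only: strop.simps fun_upd_same)
    then show ?thesis using Suc.prems unfolding True
      by (simp only: strop.simps mmul_assoc P_mult mmul_smul_right mult.commute Suc_le_eq)
  next
    case False
    then have "P (f n) n \<odot> P a i = P a i \<odot> P (f n) n" using Suc.prems by (intro P_commute) auto
    then have "strop (Suc n) f \<odot> P a i = (strop n f \<odot> P a i) \<odot> P (f n) n" by (simp add: mmul_assoc)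
    then show ?thesis using Suc False by (simp add: mmul_smul_left)
  qed
qed simp

text \<open>\<open>2^N\<close> times the coefficient of \<open>strop N f\<close>; the normalisation
  is irrelevant for homogeneous equations.\<close>

definition q :: "qop \<Rightarrow> (nat \<Rightarrow> letter) \<Rightarrow> complex" where
  "q Q f = tr N (strop N f \<odot> Q)"

definition hamL :: "(letter \<Rightarrow> complex) \<Rightarrow> (letter \<Rightarrow> complex) \<Rightarrow> qop" where
  "hamL J h = (\<Sum>i<N. \<Sum>a\<in>UNIV. smul (J a) (P a i \<odot> P a ((i+1) mod N)))
            + (\<Sum>i<N. \<Sum>a\<in>UNIV. smul (h a) (P a i))"

text \<open>The trace of \<open>strop N f\<close> against the commutator. Cyclicity moves the
  commutator onto the string, and each term of the Hamiltonian maps the string to a single string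
  with factor \<open>2 * \<i>\<close> times a sign.\<close>

lemma ring_eq:
  assumes N: "N \<ge> 2" and comm: "hamL J h \<odot> Q = Q \<odot> hamL J h"
  shows "(\<Sum>i<N. (\<Sum>a\<in>UNIV. h a * eps a (f i) * q Q (f(i := a * f i)))
     + (\<Sum>a\<in>UNIV. J a * bsg a (f i) (f ((i+1) mod N)) *
          q Q (f(i := a * f i, (i+1) mod N := a * f ((i+1) mod N))))) = 0"
proof -
  define D where "D B = tr N (strop N f \<odot> B \<odot> Q) - tr N (B \<odot> strop N f \<odot> Q)" for B
  have D0: "D 0 = 0" by (simp add: D_def)
  have Dadd: "D (A + B) = D A + D B" for A B
    by (simp add: D_def mmul_add_left mmul_add_right tr_add)
  have Dsum: "D (\<Sum>i\<in>I. f i) = (\<Sum>i\<in>I. D (f i))" for f :: "'b \<Rightarrow> qop" and I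
    by (rule additive_sum[where F = D]) (fact D0 Dadd)+
  have Dsmul: "D (smul x A) = x * D A" for x A
    by (simp add: D_def mmul_smul_left mmul_smul_right tr_smul algebra_simps)
  have DP: "D (P a i) = 2 * \<i> * (eps a (f i) * q Q (f(i := a * f i)))" if "i < N" for a i
  proof -
    have "D (P a i) = (pm (f i) a - pm a (f i)) * q Q (f(i := a * f i))"
      using that by (simp add: D_def P_strop strop_P mmul_smul_left tr_smul q_def algebra_simps)
    then show ?thesis by (simp only: pm_diff mult.assoc)
  qed
  have DPP: "D (P a i \<odot> P a j) = 2 * \<i> * (bsg a (f i) (f j) * q Q (f(i := a * f i, j := a * f j)))"
    if "i < N" "j < N" "i \<noteq> j" for a i j
  proof -
    have "strop N f \<odot> (P a i \<odot> P a j) = smul (pm (f i) a * pm (f j) a) (strop N (f(i := a * f i, j := a * f j)))"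
      using that by (simp add: mmul_assoc[symmetric] strop_P mmul_smul_left)
    moreover have "P a i \<odot> P a j \<odot> strop N f = smul (pm a (f i) * pm a (f j)) (strop N (f(i := a * f i, j := a * f j)))"
      using that by (simp add: mmul_assoc P_strop mmul_smul_right fun_upd_twist mult.commute)
    ultimately have "D (P a i \<odot> P a j) = (pm (f i) a * pm (f j) a - pm a (f i) * pm a (f j)) * q Q (f(i := a * f i, j := a * f j))"
      by (simp add: D_def mmul_smul_left tr_smul q_def algebra_simps)
    then show ?thesis by (simp only: pm_diff2 mult.assoc)
  qed
  have ne: "i \<noteq> (i+1) mod N" "(i+1) mod N < N" if "i < N" for i
    using that N by (auto simp: mod_if)
  have "tr N (hamL J h \<odot> strop N f \<odot> Q) = tr N (strop N f \<odot> hamL J h \<odot> Q)"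
  proof -
    have "tr N (hamL J h \<odot> strop N f \<odot> Q) = tr N (strop N f \<odot> (Q \<odot> hamL J h))"
      unfolding mmul_assoc by (subst tr_mmul_commute) (simp only: mmul_assoc)
    then show ?thesis by (simp only: comm[symmetric] mmul_assoc)
  qed
  then have "0 = D (hamL J h)" by (simp add: D_def)
  also have "\<dots> = (\<Sum>i<N. \<Sum>a\<in>UNIV. J a * D (P a i \<odot> P a ((i+1) mod N))) + (\<Sum>i<N. \<Sum>a\<in>UNIV. h a * D (P a i))"
    unfolding hamL_def Dadd Dsum Dsmul ..
  also have "\<dots> = (\<Sum>i<N. \<Sum>a\<in>UNIV. J a * (2 * \<i> * (bsg a (f i) (f ((i+1) mod N)) *
          q Q (f(i := a * f i, (i+1) mod N := a * f ((i+1) mod N)))))) + 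
        (\<Sum>i<N. \<Sum>a\<in>UNIV. h a * (2 * \<i> * (eps a (f i) * q Q (f(i := a * f i)))))"
    by (intro arg_cong2[where f = "(+)"] sum.cong refl) (simp_all only: lessThan_iff DP DPP[OF _ ne(2) ne(1)])
  also have "\<dots> = 2 * \<i> * (\<Sum>i<N. (\<Sum>a\<in>UNIV. h a * eps a (f i) * q Q (f(i := a * f i)))
     + (\<Sum>a\<in>UNIV. J a * bsg a (f i) (f ((i+1) mod N)) *
          q Q (f(i := a * f i, (i+1) mod N := a * f ((i+1) mod N)))))"
    by (simp add: sum.distrib sum_distrib_left distrib_left mult_ac del: fun_upd_apply)
  finally show ?thesis by simp
qed

lemma conj_strop: "i < N \<Longrightarrow> P a i \<odot> strop N f \<odot> P a i = smul (chi a (f i)) (strop N f)"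
  by (simp add: P_strop mmul_smul_left strop_P pm_conj)

lemma P_sq: "i < N \<Longrightarrow> P a i \<odot> P a i = idop N"
  by (simp add: P_mult P_LI)

text \<open>Insert squares of \<open>P a i\<close> on both sides of \<open>B\<close> and use
  cyclicity. If the signs of \<open>B\<close> and of \<open>f\<close> under conjugation differ, the
  coefficient is its own negative.\<close>

lemma q_conj:
  assumes "i < N" "is_op N B" "P a i \<odot> B \<odot> P a i = smul x B"
  shows "q B f = chi a (f i) * x * q B f"
proof -
  have "q B f = tr N (strop N f \<odot> (P a i \<odot> P a i) \<odot> B \<odot> (P a i \<odot> P a i))"
    using assms by (simp add: P_sq q_def is_op_mmul)
  also have "\<dots> = tr N ((strop N f \<odot> P a i) \<odot> (P a i \<odot> B \<odot> P a i) \<odot> P a i)"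
    by (simp add: mmul_assoc)
  also have "\<dots> = x * tr N ((strop N f \<odot> P a i) \<odot> B \<odot> P a i)"
    by (simp add: assms mmul_smul_left mmul_smul_right tr_smul)
  also have "tr N ((strop N f \<odot> P a i) \<odot> B \<odot> P a i) = tr N (P a i \<odot> strop N f \<odot> P a i \<odot> B)"
    by (subst tr_mmul_commute) (simp add: mmul_assoc)
  also have "\<dots> = chi a (f i) * q B f"
    using assms by (simp add: conj_strop mmul_smul_left tr_smul q_def)
  finally have "q B f = x * (chi a (f i) * q B f)" .
  also have "\<dots> = chi a (f i) * x * q B f" by (simp only: mult_ac)
  finally show ?thesis .
qed

lemma q_acts_within_zero:
  assumes "is_op N A" "acts_within N S A" "j < N" "j \<notin> S" "f j \<noteq> LI"
  shows "q A f = 0"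
proof -
  obtain a where a: "chi a (f j) = -1" using chi_separates[OF assms(5)] by (auto simp: chi_def)
  have "A \<odot> P a j = P a j \<odot> A"
    unfolding P_def by (rule acts_within_commute[OF assms(1-4)])
  then have "P a j \<odot> A \<odot> P a j = (P a j \<odot> P a j) \<odot> A" by (simp only: mmul_assoc)
  then have "P a j \<odot> A \<odot> P a j = smul 1 A" using assms by (simp add: P_sq)
  from q_conj[OF assms(3,1) this, of f] a show ?thesis by simp
qed

lemma q_add: "q (A + B) f = q A f + q B f"
  by (simp add: q_def mmul_add_right tr_add)

lemma q_zero: "q 0 f = 0"
  by (simp add: q_def)

lemma q_sum: "q (\<Sum>i\<in>I. A i) f = (\<Sum>i\<in>I. q (A i) f)"
  by (rule additive_sum[where F = "\<lambda>A. q A f"]) (fact q_zero q_add)+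

lemma q_sum_list: "q (sum_list As) f = (\<Sum>A\<leftarrow>As. q A f)"
proof (induction As)
  case Nil
  show ?case by (simp only: sum_list.Nil q_zero list.map)
next
  case (Cons A As)
  then show ?case by (simp only: sum_list.Cons q_add list.map)
qed

lemma q_cong: "(\<And>i. i < N \<Longrightarrow> f i = g i) \<Longrightarrow> q Q f = q Q g"
  unfolding q_def using strop_cong[of N f g] by simp

lemma commute_all_scalar:
  assumes B: "is_op N B" and comm: "\<And>i a. i < N \<Longrightarrow> P a i \<odot> B = B \<odot> P a i"
  shows "\<exists>z. B = smul z (idop N)"
proof -
  have "acts_within N {} B"
  proof (rule commute_acts_within[OF B])
    fix j b assume j: "j < N"
    obtain l where l: "sqb b = (\<lambda>x y. \<Sum>a\<in>UNIV. l a * sm a x y)" using sm_span by blast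
    have "pauli N b j = (\<Sum>a\<in>UNIV. smul (l a) (P a j))"
      unfolding pauli_lift l lift_sum P_def lift_smul ..
    then show "B \<odot> pauli N b j = pauli N b j \<odot> B"
      by (simp only: mmul_sum_left mmul_sum_right mmul_smul_left mmul_smul_right comm[OF j])
  qed
  note aw = this[unfolded acts_within_def]
  have off: "B r c = 0" if "r < 2^N" "c < 2^N" "\<exists>j<N. bitv r j \<noteq> bitv c j" for r c
    using aw that by blast
  have dia: "B r r = B c c" if "r < 2^N" "c < 2^N" for r c
    using aw that by blast
  have "B = smul (B 0 0) (idop N)"
  proof (rule op_eqI[of N])
    fix r c :: nat assume *: "r < 2^N" "c < 2^N"
    show "B r c = smul (B 0 0) (idop N) r c"
    proof (cases "r = c")
      case True then show ?thesis using dia[of r 0] * by (simp add: smul_def idop_def)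
    next
      case False
      then obtain j where "bit r j \<noteq> bit c j" using bit_eqI by blast
      moreover then have "j < N" using bit_ge_size[of _ N j] * by (meson not_less)
      ultimately have "B r c = 0" using off[OF *] by (metis bitv_eq_iff)
      then show ?thesis using False by (simp add: smul_def idop_def)
    qed
  qed (use B in \<open>auto intro: is_op_smul\<close>)
  then show ?thesis by blast
qed

lemma strop_sq: "n \<le> N \<Longrightarrow> strop n f \<odot> strop n f = idop N"
proof (induction n)
  case (Suc n)
  have "strop (Suc n) f \<odot> strop (Suc n) f = strop n f \<odot> (P (f n) n \<odot> strop n f) \<odot> P (f n) n"
    by (simp add: mmul_assoc)
  also have "P (f n) n \<odot> strop n f = strop n f \<odot> P (f n) n"
    using Suc.prems by (intro P_strop_commute) auto
  also have "strop n f \<odot> (strop n f \<odot> P (f n) n) \<odot> P (f n) n = (strop n f \<odot> strop n f) \<odot> (P (f n) n \<odot> P (f n) n)"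
    by (simp add: mmul_assoc)
  also have "\<dots> = idop N" using Suc P_sq[of n "f n"] by simp
  finally show ?case .
qed simp

section \<open>Completeness of the Pauli strings\<close>

definition strings :: "nat \<Rightarrow> (nat \<Rightarrow> letter) set" where
  "strings n = {f. \<forall>i\<ge>n. f i = LI}"

lemma strings_Suc: "bij_betw (\<lambda>(f, l). f(n := l)) (strings n \<times> UNIV) (strings (Suc n))"
proof (rule bij_betwI[where g = "\<lambda>f. (f(n := LI), f n)"])
  show "(\<lambda>(f, l). f(n := l)) \<in> strings n \<times> UNIV \<rightarrow> strings (Suc n)"
    by (auto simp: strings_def)
  show "(\<lambda>f. (f(n := LI), f n)) \<in> strings (Suc n) \<rightarrow> strings n \<times> UNIV"
    by (auto simp: strings_def le_Suc_eq Suc_le_eq)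
qed (auto simp: strings_def fun_eq_iff)

lemma finite_strings: "finite (strings n)"
proof (induction n)
  case 0
  have "strings 0 = {\<lambda>_. LI}" by (auto simp: strings_def)
  then show ?case by simp
next
  case (Suc n)
  then have "finite (strings n \<times> (UNIV :: letter set))" by (simp add: letter_UNIV)
  then show ?case using bij_betw_finite[OF strings_Suc] by blast
qed

text \<open>Character projection: the part of \<open>A\<close> that behaves like the letter
  \<open>l\<close> under conjugations at site \<open>j\<close>.\<close>

definition proj :: "nat \<Rightarrow> letter \<Rightarrow> qop \<Rightarrow> qop" where
  "proj j l A = smul (1/4) (\<Sum>m\<in>UNIV. smul (chi m l) (P m j \<odot> A \<odot> P m j))"

lemma is_op_proj: "is_op N A \<Longrightarrow> is_op N (proj j l A)"
  unfolding proj_def by (intro is_op_smul is_op_sum is_op_mmul is_op_P)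

lemma proj_sum: "j < N \<Longrightarrow> is_op N A \<Longrightarrow> (\<Sum>l\<in>UNIV. proj j l A) = A"
proof -
  assume j: "j < N" and A: "is_op N A"
  define C where "C m = P m j \<odot> A \<odot> P m j" for m
  have "(\<Sum>l\<in>UNIV. proj j l A) = smul (1/4) (\<Sum>l\<in>UNIV. \<Sum>m\<in>UNIV. smul (chi m l) (C m))"
    unfolding proj_def C_def by (rule smul_sum[symmetric])
  also have "(\<Sum>l\<in>UNIV. \<Sum>m\<in>UNIV. smul (chi m l) (C m)) = (\<Sum>m\<in>UNIV. \<Sum>l\<in>UNIV. smul (chi m l) (C m))"
    by (rule sum.swap)
  also have "\<dots> = (\<Sum>m\<in>UNIV. smul (\<Sum>l\<in>UNIV. chi m l) (C m))"
    by (intro sum.cong refl, rule additive_sum[where F = "\<lambda>x. smul x (C m)" for m, symmetric])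
       (simp_all only: smul_simps smul_add)
  also have "\<dots> = smul 4 (C LI)"
    by (simp only: chi_sum) (simp add: sum_letter)
  also have "C LI = A" using j A by (simp add: C_def P_LI)
  finally show ?thesis by simp
qed

lemma proj_conj:
  assumes j: "j < N"
  shows "P a j \<odot> proj j l A \<odot> P a j = smul (chi a l) (proj j l A)"
proof -
  have conj2: "P a j \<odot> (P m j \<odot> A \<odot> P m j) \<odot> P a j = P (a * m) j \<odot> A \<odot> P (a * m) j" for m
  proof -
    have "P a j \<odot> (P m j \<odot> A \<odot> P m j) \<odot> P a j = (P a j \<odot> P m j) \<odot> A \<odot> (P m j \<odot> P a j)"
      by (simp add: mmul_assoc)
    also have "\<dots> = smul (pm a m * pm m a) (P (a * m) j \<odot> A \<odot> P (a * m) j)"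
      using j by (simp add: P_mult mmul_smul_left mmul_smul_right mult.commute)
    also have "pm a m * pm m a = 1" by (cases a; cases m; simp add: pm_def)
    finally show ?thesis by simp
  qed
  have "P a j \<odot> proj j l A \<odot> P a j = smul (1/4) (\<Sum>m\<in>UNIV. smul (chi m l) (P (a*m) j \<odot> A \<odot> P (a*m) j))"
    by (simp only: proj_def mmul_smul_left mmul_smul_right mmul_sum_left mmul_sum_right conj2)
  also have "(\<Sum>m\<in>UNIV. smul (chi m l) (P (a*m) j \<odot> A \<odot> P (a*m) j)) = 
     (\<Sum>m\<in>UNIV. smul (chi (a*m) l) (P m j \<odot> A \<odot> P m j))"
    by (rule sum.reindex_bij_witness[of _ "\<lambda>m. a*m" "\<lambda>m. a*m"]) auto
  also have "\<dots> = smul (chi a l) (\<Sum>m\<in>UNIV. smul (chi m l) (P m j \<odot> A \<odot> P m j))"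
    by (simp only: smul_sum smul_simps(1) chi_mult)
  also have "smul (1/4) (smul (chi a l) (\<Sum>m\<in>UNIV. smul (chi m l) (P m j \<odot> A \<odot> P m j))) = smul (chi a l) (proj j l A)"
    unfolding proj_def by (simp only: smul_simps(1) mult.commute)
  finally show ?thesis .
qed

lemma proj_conj_other:
  assumes "i < N" "j < N" "i \<noteq> j" and A: "P a i \<odot> A \<odot> P a i = smul x A"
  shows "P a i \<odot> proj j l A \<odot> P a i = smul x (proj j l A)"
proof -
  have "P a i \<odot> (P m j \<odot> A \<odot> P m j) \<odot> P a i = smul x (P m j \<odot> A \<odot> P m j)" for m
  proof -
    have "P a i \<odot> (P m j \<odot> A \<odot> P m j) \<odot> P a i = (P a i \<odot> P m j) \<odot> A \<odot> (P m j \<odot> P a i)"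
      by (simp add: mmul_assoc)
    also have "\<dots> = (P m j \<odot> P a i) \<odot> A \<odot> (P a i \<odot> P m j)"
      by (simp only: P_commute[OF assms(1-3), of a m])
    also have "\<dots> = P m j \<odot> (P a i \<odot> A \<odot> P a i) \<odot> P m j"
      by (simp only: mmul_assoc)
    finally show ?thesis by (simp add: A mmul_smul_left mmul_smul_right)
  qed
  then show ?thesis
    unfolding proj_def mmul_smul_left mmul_smul_right mmul_sum_left mmul_sum_right smul_sum
    by (simp add: mult_ac)
qed

text \<open>Splitting site by site into joint eigenspaces of the conjugations replaces a dimension
  count.\<close>

lemma decompose:
  assumes "n \<le> N" "is_op N A"
  shows "\<exists>B. A = (\<Sum>f\<in>strings n. B f) \<and>
     (\<forall>f. is_op N (B f) \<and> (\<forall>i<n. \<forall>a. P a i \<odot> B f \<odot> P a i = smul (chi a (f i)) (B f)))"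
  using assms(1)
proof (induction n)
  case 0
  have "strings 0 = {\<lambda>_. LI}" by (auto simp: strings_def)
  then have "A = (\<Sum>f\<in>strings 0. A)" by simp
  then show ?case using assms(2) by (intro exI[of _ "\<lambda>_. A"]) simp
next
  case (Suc n)
  then obtain B where B: "A = (\<Sum>f\<in>strings n. B f)" "\<And>f. is_op N (B f)"
    "\<And>f i a. i < n \<Longrightarrow> P a i \<odot> B f \<odot> P a i = smul (chi a (f i)) (B f)" by auto
  define B' where "B' f = proj n (f n) (B (f(n := LI)))" for f
  have "A = (\<Sum>f\<in>strings n. \<Sum>l\<in>UNIV. proj n l (B f))"
    unfolding B(1) using Suc.prems B(2) by (intro sum.cong) (simp_all add: proj_sum)
  also have "\<dots> = (\<Sum>(f,l)\<in>strings n \<times> UNIV. proj n l (B f))"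
    by (rule sum.cartesian_product)
  also have "\<dots> = (\<Sum>x\<in>strings n \<times> UNIV. B' (case x of (f, l) \<Rightarrow> f(n := l)))"
  proof (rule sum.cong[OF refl])
    fix x assume "x \<in> strings n \<times> (UNIV :: letter set)"
    then obtain f l where x: "x = (f, l)" "f \<in> strings n" by auto
    then have "f(n := LI) = f" by (auto simp: strings_def fun_eq_iff)
    then show "(case x of (f, l) \<Rightarrow> proj n l (B f)) = B' (case x of (f, l) \<Rightarrow> f(n := l))"
      by (simp add: x B'_def)
  qed
  also have "\<dots> = (\<Sum>f\<in>strings (Suc n). B' f)"
    by (rule sum.reindex_bij_betw[OF strings_Suc])
  finally have "A = (\<Sum>f\<in>strings (Suc n). B' f)" .
  moreover have "is_op N (B' f)" for f unfolding B'_def by (intro is_op_proj B)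
  moreover have "P a i \<odot> B' f \<odot> P a i = smul (chi a (f i)) (B' f)" if "i < Suc n" for f i a
  proof (cases "i = n")
    case True
    then show ?thesis using Suc.prems unfolding B'_def by (simp add: proj_conj)
  next
    case False
    then have "i < n" using that by simp
    note conj = B(3)[OF this, of a "f(n := LI)", unfolded fun_upd_other[OF False]]
    show ?thesis
      using that False Suc.prems unfolding B'_def by (intro proj_conj_other conj) auto
  qed
  ultimately show ?case by blast
qed

text \<open>Each joint eigenspace is a line: \<open>B f\<close> times \<open>strop N f\<close>
  commutes with all single-site matrices, hence is scalar, and \<open>strop N f\<close> squares to
  the identity.\<close>

theorem pauli_expansion:
  assumes "is_op N A"
  shows "A = (\<Sum>f\<in>strings N. smul (q A f / 2^N) (strop N f))"
proof -
  obtain B where B: "A = (\<Sum>f\<in>strings N. B f)" "\<And>f. is_op N (B f)"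
    "\<And>f i a. i < N \<Longrightarrow> P a i \<odot> B f \<odot> P a i = smul (chi a (f i)) (B f)" 
    using decompose[OF le_refl assms] by auto
  have B_P: "P a i \<odot> B f = smul (chi a (f i)) (B f \<odot> P a i)" if "i < N" for a i f
  proof -
    have "P a i \<odot> B f = (P a i \<odot> B f \<odot> P a i) \<odot> P a i"
      using that B(2) by (simp add: mmul_assoc P_sq is_op_mmul)
    then show ?thesis using that by (simp add: B mmul_smul_left)
  qed
  have S_P: "P a i \<odot> strop N f = smul (chi a (f i)) (strop N f \<odot> P a i)" if "i < N" for a i f
  proof -
    have "P a i \<odot> strop N f = (P a i \<odot> strop N f \<odot> P a i) \<odot> P a i"
      using that by (simp add: mmul_assoc P_sq is_op_mmul)
    then show ?thesis using that by (simp add: conj_strop mmul_smul_left)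
  qed
  have "\<exists>z. B f = smul z (strop N f)" for f
  proof -
    have "\<exists>z. B f \<odot> strop N f = smul z (idop N)"
    proof (rule commute_all_scalar)
      fix i a assume i: "i < N"
      have "P a i \<odot> (B f \<odot> strop N f) = smul (chi a (f i)) (B f \<odot> (P a i \<odot> strop N f))"
        unfolding mmul_assoc[symmetric] B_P[OF i] by (simp add: mmul_smul_left)
      also have "\<dots> = B f \<odot> (strop N f \<odot> P a i)"
        unfolding S_P[OF i] by (simp add: mmul_smul_right)
      finally show "P a i \<odot> (B f \<odot> strop N f) = B f \<odot> strop N f \<odot> P a i" by (simp add: mmul_assoc)
    qed (auto intro: is_op_mmul B(2))
    then obtain z where z: "B f \<odot> strop N f = smul z (idop N)" by blast
    have "B f = B f \<odot> strop N f \<odot> strop N f"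
      using B(2) by (simp add: mmul_assoc strop_sq)
    then show ?thesis unfolding z by (auto simp: mmul_smul_left)
  qed
  then obtain z where z: "\<And>f. B f = smul (z f) (strop N f)" by metis
  have qB: "q (B f) g = 0" if "f \<in> strings N" "g \<in> strings N" "f \<noteq> g" for f g
  proof -
    have "\<exists>i. f i \<noteq> g i" using that(3) by (simp add: fun_eq_iff)
    then obtain i where i: "f i \<noteq> g i" by blast
    then have iN: "i < N" using that unfolding strings_def by (metis (mono_tags) mem_Collect_eq not_less)
    obtain a where a: "chi a (g i) * chi a (f i) = -1" using chi_separates[of "g i" "f i"] i by auto
    from q_conj[OF iN B(2) B(3)[OF iN], of f g a] show ?thesis unfolding a by simp
  qed
  have "q A f = z f * 2^N" if f: "f \<in> strings N" for f
  proof -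
    have "q A f = (\<Sum>g\<in>strings N. q (B g) f)" unfolding B(1) q_sum ..
    also have "\<dots> = (\<Sum>g\<in>{f}. q (B g) f)"
      by (rule sum.mono_neutral_right) (use f qB finite_strings in auto)
    also have "\<dots> = z f * 2^N" by (simp add: z q_def mmul_smul_right tr_smul strop_sq tr_idop)
    finally show ?thesis .
  qed
  then have "smul (q A f / 2^N) (strop N f) = B f" if "f \<in> strings N" for f
    using that z[of f] by simp
  then have "(\<Sum>f\<in>strings N. B f) = (\<Sum>f\<in>strings N. smul (q A f / 2^N) (strop N f))"
    by (intro sum.cong refl) simp
  with B(1) show ?thesis by (rule trans)
qed

lemma strop_acts_within:
  assumes "\<And>j. j < N \<Longrightarrow> j \<notin> S \<Longrightarrow> f j = LI"
  shows "acts_within N S (strop N f)"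
proof (rule commute_acts_within)
  fix j b assume j: "j < N" "j \<notin> S"
  obtain l where l: "sqb b = (\<lambda>x y. \<Sum>a\<in>UNIV. l a * sm a x y)" using sm_span by blast
  have p: "pauli N b j = (\<Sum>a\<in>UNIV. smul (l a) (P a j))"
    unfolding pauli_lift l lift_sum P_def lift_smul ..
  have "P a j \<odot> strop N f = strop N f \<odot> P a j" for a
    using P_strop[of j N a f] strop_P[of j N f a] j assms[OF j] by simp
  then show "strop N f \<odot> pauli N b j = pauli N b j \<odot> strop N f"
    by (simp only: p mmul_sum_left mmul_sum_right mmul_smul_left mmul_smul_right)
qed simp

end

section \<open>From the ring to the line\<close>

text \<open>The choice is unambiguous as soon as the support fits into \<open>N\<close> consecutive
  integers, see \<open>wrap_eq\<close>.\<close>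

definition wrap :: "nat \<Rightarrow> (int \<Rightarrow> letter) \<Rightarrow> nat \<Rightarrow> letter" where
  "wrap N g i = (if i < N \<and> (\<exists>j. j mod int N = int i \<and> g j \<noteq> LI)
                 then g (SOME j. j mod int N = int i \<and> g j \<noteq> LI) else LI)"

lemma mod_unique:
  assumes "j mod int N = j' mod int N" "m \<le> j" "j < m + int N" "m \<le> j'" "j' < m + int N"
  shows "j = j'"
proof -
  have "int N dvd (j - j')" using assms(1) by (simp add: mod_eq_dvd_iff)
  moreover have "\<bar>j - j'\<bar> < int N" using assms by linarith
  ultimately have "j - j' = 0" using zdvd_imp_le[of "int N" "\<bar>j - j'\<bar>"] by (cases "j = j'") auto
  then show ?thesis by simp
qed

lemma wrap_eq:
  assumes supp: "\<And>i. g i \<noteq> LI \<Longrightarrow> m \<le> i \<and> i < m + int N" and j: "m \<le> j" "j < m + int N" and N: "N > 0"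
  shows "wrap N g (nat (j mod int N)) = g j"
proof -
  let ?i = "nat (j mod int N)"
  have i: "int ?i = j mod int N" "?i < N" using N by (auto simp: nat_less_iff)
  have u: "j' = j" if "j' mod int N = int ?i" "g j' \<noteq> LI" for j'
    using mod_unique[of j' N j m] supp[OF that(2)] j that i by simp
  show ?thesis
  proof (cases "g j = LI")
    case True
    then have "\<not> (\<exists>j'. j' mod int N = int ?i \<and> g j' \<noteq> LI)" using u by metis
    then have "\<not> (?i < N \<and> (\<exists>j'. j' mod int N = int ?i \<and> g j' \<noteq> LI))" by blast
    then show ?thesis unfolding wrap_def True by (rule if_not_P)
  next
    case False
    then have "(SOME j'. j' mod int N = int ?i \<and> g j' \<noteq> LI) = j"
      using u i by (intro some_equality) auto
    moreover have "\<exists>j'. j' mod int N = int ?i \<and> g j' \<noteq> LI" 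
      by (intro exI[of _ j] conjI, simp only: i(1), rule False)
    ultimately show ?thesis unfolding wrap_def using i by simp
  qed
qed

lemma ex_rep:
  assumes "i < N"
  shows "\<exists>j. m \<le> j \<and> j < m + int N \<and> nat (j mod int N) = i"
proof -
  let ?j = "m + ((int i - m) mod int N)"
  have "?j mod int N = int i" using assms by (simp add: mod_add_right_eq)
  then show ?thesis using assms by (intro exI[of _ ?j]) auto
qed

lemma wrap_upd:
  assumes supp: "\<And>i. g i \<noteq> LI \<Longrightarrow> m \<le> i \<and> i < m + int N" and j: "m \<le> j" "j < m + int N" and i: "i < N"
  shows "wrap N (g(j := x)) i = ((wrap N g)(nat (j mod int N) := x)) i"
proof -
  have N: "N > 0" using i by simp
  obtain j' where j': "m \<le> j'" "j' < m + int N" "nat (j' mod int N) = i" using ex_rep[OF i] by blast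
  have supp': "m \<le> i \<and> i < m + int N" if "(g(j := x)) i \<noteq> LI" for i
    using that supp[of i] j by (auto split: if_splits)
  have "wrap N (g(j := x)) i = (g(j := x)) j'"
    using wrap_eq[of "g(j:=x)", OF supp' j'(1,2) N] j'(3) by simp
  moreover have "wrap N g i = g j'"
    using wrap_eq[of g, OF supp j'(1,2) N] j'(3) by simp
  moreover have "nat (j mod int N) = i \<longleftrightarrow> j = j'"
  proof
    assume "nat (j mod int N) = i"
    then have "j mod int N = j' mod int N" using j'(3) N by (metis int_nat_eq pos_mod_sign of_nat_0_less_iff)
    then show "j = j'" using mod_unique j j' by blast
  qed (use j' in simp)
  ultimately show ?thesis by (auto simp: fun_upd_def)
qed

definition ring_window :: "nat \<Rightarrow> nat \<Rightarrow> (nat \<Rightarrow> letter) \<Rightarrow> bool" where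
  "ring_window N k f \<longleftrightarrow> (\<exists>s<N. \<forall>j<N. f j \<noteq> LI \<longrightarrow> j \<in> window N s k)"

text \<open>This is where \<open>2 k \<le> N\<close> enters: around the other side of the ring the
  two sites are \<open>N - k \<ge> k\<close> apart, so no window of \<open>k\<close> sites holds
  both.\<close>

lemma ring_window_far:
  assumes supp: "\<And>i. g i \<noteq> LI \<Longrightarrow> m \<le> i \<and> i < m + int N" and N: "N > 0" "2 * k \<le> N"
    and far: "g i \<noteq> LI" "g (i + int k) \<noteq> LI" 
  shows "\<not> ring_window N k (wrap N g)"
proof
  assume "ring_window N k (wrap N g)"
  then obtain s where s: "\<And>j. j < N \<Longrightarrow> wrap N g j \<noteq> LI \<Longrightarrow> j \<in> window N s k"
    unfolding ring_window_def by blast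
  have mem: "\<exists>t<k. int (s + t) mod int N = j mod int N" if "g j \<noteq> LI" for j
  proof -
    have "wrap N g (nat (j mod int N)) \<noteq> LI" using wrap_eq[of g m N j, OF supp] supp[OF that] that N by auto
    moreover have "nat (j mod int N) < N" using N by (simp add: nat_less_iff)
    ultimately obtain t where "t < k" "nat (j mod int N) = (s + t) mod N"
      using s unfolding window_def by blast
    moreover then have "j mod int N = int ((s + t) mod N)" using N by (metis int_nat_eq pos_mod_sign of_nat_0_less_iff)
    ultimately show ?thesis by (auto simp: zmod_int)
  qed
  obtain t1 t2 where t: "t1 < k" "t2 < k" "int (s + t1) mod int N = i mod int N" "int (s + t2) mod int N = (i + int k) mod int N"
    using mem[OF far(1)] mem[OF far(2)] by blast
  have "(int (s + t1) + int k) mod int N = (i + int k) mod int N" using t(3) by (metis mod_add_left_eq)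
  then have "int (s + t2) mod int N = (int (s + t1) + int k) mod int N" using t(4) by simp
  then have "int (s + t2) = int (s + t1) + int k"
    by (rule mod_unique[of _ _ _ "int (s+t2)"]) (use t N in auto) 
  then show False using t by simp
qed

lemma acts_within_smul:
  assumes "acts_within N S A"
  shows "acts_within N S (smul x A)"
  unfolding acts_within_def
proof (intro conjI allI impI)
  fix r c :: nat assume "r < 2^N" "c < 2^N" "\<exists>j<N. j \<notin> S \<and> bitv r j \<noteq> bitv c j"
  then have "A r c = 0" using assms unfolding acts_within_def by blast
  then show "smul x A r c = 0" by (simp add: smul_def)
next
  fix r c r' c' :: nat assume "r < 2^N" "c < 2^N" "r' < 2^N" "c' < 2^N"
    "(\<forall>j<N. j \<notin> S \<longrightarrow> bitv r j = bitv c j \<and> bitv r' j = bitv c' j) \<and>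
     (\<forall>j\<in>S. bitv r j = bitv r' j \<and> bitv c j = bitv c' j)"
  then have "A r c = A r' c'" using assms unfolding acts_within_def by blast
  then show "smul x A r c = smul x A r' c'" by (simp add: smul_def)
qed

lemma window_mono: "l \<le> k \<Longrightarrow> window N s l \<subseteq> window N s k"
  by (auto simp: window_def)

context pauli_basis begin

lemma q_ring_window:
  assumes Q: "sum_of_le_support N k Q" and f: "\<not> ring_window N k f"
  shows "q Q f = 0"
proof -
  obtain As where As: "Q = sum_list As" "\<And>A. A \<in> set As \<Longrightarrow> is_op N A \<and> (\<exists>l\<le>k. support_op N l A)"
    using Q unfolding sum_of_le_support_def by blast
  have "q A f = 0" if "A \<in> set As" for A
  proof -
    from As(2)[OF that] obtain l s where A: "is_op N A" "l \<le> k" "s < N" "acts_within N (window N s l) A"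
      unfolding support_op_def on_consecutive_def by blast
    from f A(3) obtain j where "j < N" "f j \<noteq> LI" "j \<notin> window N s k"
      unfolding ring_window_def by blast
    then show ?thesis using q_acts_within_zero[OF A(1,4), of j f] window_mono[OF A(2)] by blast
  qed
  then show ?thesis unfolding As(1) q_sum_list by (induction As) auto
qed

text \<open>The cut-off is imposed by hand because a very wide string on the line may look narrow
  after wrapping.\<close>

definition coeffZ :: "nat \<Rightarrow> qop \<Rightarrow> (int \<Rightarrow> letter) \<Rightarrow> complex" where
  "coeffZ k Q g = (if \<exists>m. \<forall>i. g i \<noteq> LI \<longrightarrow> m \<le> i \<and> i < m + int k then q Q (wrap N g) else 0)"

lemma coeffZ_eq:
  assumes Q: "sum_of_le_support N k Q" and N: "N > 0" "2 * k \<le> N"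
    and supp: "\<And>i. g i \<noteq> LI \<Longrightarrow> m \<le> i \<and> i < m + int N"
    and alt: "(\<exists>m. \<forall>i. g i \<noteq> LI \<longrightarrow> m \<le> i \<and> i < m + int k) \<or> (\<exists>i. g i \<noteq> LI \<and> g (i + int k) \<noteq> LI)"
  shows "coeffZ k Q g = q Q (wrap N g)"
proof (cases "\<exists>m. \<forall>i. g i \<noteq> LI \<longrightarrow> m \<le> i \<and> i < m + int k")
  case False
  then obtain i where "g i \<noteq> LI" "g (i + int k) \<noteq> LI" using alt by blast
  then have "\<not> ring_window N k (wrap N g)" by (intro ring_window_far[of g m N k i, OF supp N])
  then have "q Q (wrap N g) = 0" by (rule q_ring_window[OF Q])
  then show ?thesis using False by (simp add: coeffZ_def)
qed (simp add: coeffZ_def)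

lemma sum_ring_int: "N > 0 \<Longrightarrow> (\<Sum>i<N. G i) = (\<Sum>j\<in>{m..<m + int N}. G (nat (j mod int N)))" for G :: "nat \<Rightarrow> complex"
proof -
  assume N: "N > 0"
  have "bij_betw (\<lambda>j. nat (j mod int N)) {m..<m + int N} {..<N}"
    unfolding bij_betw_def
  proof
    show "inj_on (\<lambda>j. nat (j mod int N)) {m..<m + int N}"
    proof (rule inj_onI)
      fix x y assume *: "x \<in> {m..<m + int N}" "y \<in> {m..<m + int N}" "nat (x mod int N) = nat (y mod int N)"
      then have "x mod int N = y mod int N" using N by (metis int_nat_eq pos_mod_sign of_nat_0_less_iff)
      then show "x = y" using mod_unique[of x N y m] * by auto
    qed
    show "(\<lambda>j. nat (j mod int N)) ` {m..<m + int N} = {..<N}"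
    proof
      show "{..<N} \<subseteq> (\<lambda>j. nat (j mod int N)) ` {m..<m + int N}"
      proof
        fix i assume "i \<in> {..<N}"
        then obtain j where "m \<le> j" "j < m + int N" "nat (j mod int N) = i" using ex_rep[of i N m] by auto
        then show "i \<in> (\<lambda>j. nat (j mod int N)) ` {m..<m + int N}" by (intro image_eqI[of _ _ j]) simp_all
      qed
    qed (use N in \<open>auto simp: nat_less_iff\<close>)
  qed
  from sum.reindex_bij_betw[OF this, of G] show ?thesis by simp
qed

lemma in_window_or_far:
  assumes supp: "\<And>i. g i \<noteq> LI \<Longrightarrow> m \<le> i \<and> i \<le> m + int k"
  shows "(\<exists>m. \<forall>i. g i \<noteq> LI \<longrightarrow> m \<le> i \<and> i < m + int k) \<or> (\<exists>i. g i \<noteq> LI \<and> g (i + int k) \<noteq> LI)"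
proof -
  consider "g m = LI" | "g (m + int k) = LI" | "g m \<noteq> LI" "g (m + int k) \<noteq> LI" by blast
  then show ?thesis
  proof cases
    case 1
    have "m+1 \<le> i \<and> i < m+1 + int k" if "g i \<noteq> LI" for i
    proof -
      have "i \<noteq> m" using that 1 by auto
      then show ?thesis using supp[OF that] by linarith
    qed
    then show ?thesis by blast
  next
    case 2
    have "m \<le> i \<and> i < m + int k" if "g i \<noteq> LI" for i
    proof -
      have "i \<noteq> m + int k" using that 2 by auto
      then show ?thesis using supp[OF that] by linarith
    qed
    then show ?thesis by blast
  qed blast
qed

text \<open>The ring sum for \<open>wrap N T\<close> is read along the \<open>N\<close> integers
  from \<open>m - 1\<close> on. Every source differs from \<open>T\<close> at no more than two
  neighbouring sites; it either fits into \<open>k\<close> sites or has two nontrivial sites at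
  distance exactly \<open>k\<close>, so \<open>coeffZ_eq\<close> applies.\<close>

theorem unrolled:
  assumes k: "3 \<le> k" "2 * k \<le> N" and Q: "sum_of_le_support N k Q"
    and comm: "hamL J h \<odot> Q = Q \<odot> hamL J h"
  shows "spin_string_eq k J h (coeffZ k Q)"
proof
  show "3 \<le> k" by fact
  show "\<exists>m. \<forall>i. g i \<noteq> LI \<longrightarrow> m \<le> i \<and> i < m + int k" if "coeffZ k Q g \<noteq> 0" for g
    using that by (auto simp: coeffZ_def split: if_splits)
  fix T :: "int \<Rightarrow> letter" and m
  assume T: "\<And>i. T i \<noteq> LI \<Longrightarrow> m \<le> i \<and> i \<le> m + int k"
  let ?c = "coeffZ k Q" and ?f = "wrap N T"
  have N: "N > 0" "N \<ge> 2" "k + 3 \<le> N" using k by auto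
  have supp: "m-1 \<le> i \<and> i < m-1 + int N" if "T i \<noteq> LI" for i using T[OF that] N by auto
  define F where "F j = (\<Sum>a\<in>UNIV. h a * eps a (T j) * ?c (T(j := a * T j)))
       + (\<Sum>a\<in>UNIV. J a * bsg a (T j) (T (j+1)) * ?c (T(j := a * T j, j+1 := a * T (j+1))))" for j
  define G where "G i = (\<Sum>a\<in>UNIV. h a * eps a (?f i) * q Q (?f(i := a * ?f i)))
     + (\<Sum>a\<in>UNIV. J a * bsg a (?f i) (?f ((i+1) mod N)) *
          q Q (?f(i := a * ?f i, (i+1) mod N := a * ?f ((i+1) mod N))))" for i
  have Gsum: "(\<Sum>i<N. G i) = 0"
    unfolding G_def by (rule ring_eq[OF N(2) comm])
  have GF: "G (nat (j mod int N)) = F j" if j: "m-1 \<le> j" "j < m-1 + int N" for j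
  proof -
    define i where "i = nat (j mod int N)"
    have fi: "?f i = T j" unfolding i_def by (rule wrap_eq[of T "m-1" N j, OF supp j N(1)])
    have ii: "(i+1) mod N = nat ((j+1) mod int N)"
    proof -
      have "int i = j mod int N" unfolding i_def using N by simp
      then have "int ((i+1) mod N) = (j mod int N + 1) mod int N" by (simp add: zmod_int add.commute)
      then have "int ((i+1) mod N) = (j+1) mod int N" by (simp only: mod_add_left_eq)
      then show ?thesis by (metis nat_int)
    qed
    have fii: "?f ((i+1) mod N) = T (j+1)"
    \<comment> \<open>The last bond of the ring closes up at \<open>m - 1\<close>, where
      \<open>T\<close> is trivial.\<close>
    proof (cases "j + 1 < m-1 + int N")
      case True
      then show ?thesis unfolding ii using j by (intro wrap_eq[OF supp _ _ N(1)]) auto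
    next
      case False
      then have e: "j + 1 = m-1 + int N" using j by simp
      have "(j+1) mod int N = (m-1) mod int N" unfolding e by (rule mod_add_self2)
      then have "?f ((i+1) mod N) = T (m-1)" unfolding ii using wrap_eq[of T "m-1" N "m-1", OF supp] N by simp
      moreover have "T (m-1) = LI" using T[of "m-1"] by force
      moreover have "T (j+1) = LI"
      proof (rule ccontr)
        assume "T (j+1) \<noteq> LI"
        from T[OF this] e N show False by linarith
      qed
      ultimately show ?thesis by simp
    qed
    have field: "h a * eps a (T j) * q Q (?f(i := a * T j)) = h a * eps a (T j) * ?c (T(j := a * T j))" for a
    proof (cases "eps a (T j) = 0")
      case False
      then have Tj: "T j \<noteq> LI" by auto
      let ?g = "T(j := a * T j)"
      have g: "m \<le> i \<and> i \<le> m + int k" if "?g i \<noteq> LI" for i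
        using that T[of i] T[OF Tj] by (auto split: if_splits)
      have "?c ?g = q Q (wrap N ?g)"
      proof (rule coeffZ_eq[OF Q N(1) k(2)])
        show "m-1 \<le> i \<and> i < m-1 + int N" if "?g i \<noteq> LI" for i using g[OF that] N by auto
        show "(\<exists>m. \<forall>i. ?g i \<noteq> LI \<longrightarrow> m \<le> i \<and> i < m + int k) \<or> (\<exists>i. ?g i \<noteq> LI \<and> ?g (i + int k) \<noteq> LI)"
          by (rule in_window_or_far[OF g])
      qed
      also have "\<dots> = q Q (?f(i := a * T j))"
        unfolding i_def by (rule q_cong, rule wrap_upd[OF supp j])
      finally show ?thesis by simp
    qed simp
    have bond: "J a * bsg a (T j) (T (j+1)) * q Q (?f(i := a * T j, (i+1) mod N := a * T (j+1)))
        = J a * bsg a (T j) (T (j+1)) * ?c (T(j := a * T j, j+1 := a * T (j+1)))" for a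
    proof (cases "bsg a (T j) (T (j+1)) = 0")
      case False
      then have nz: "a \<noteq> LI" "(T j \<noteq> LI \<and> T j \<noteq> a) \<or> (T (j+1) \<noteq> LI \<and> T (j+1) \<noteq> a)"
        by (auto simp: bsg_def split: if_splits)
      then have jr: "m - 1 \<le> j" "j \<le> m + int k" using T[of j] T[of "j+1"] by auto
      let ?g1 = "T(j := a * T j)" let ?g = "?g1(j+1 := a * T (j+1))"
      have g1: "m-1 \<le> i \<and> i < m-1 + int N" if "?g1 i \<noteq> LI" for i
        using that T[of i] jr N by (auto split: if_splits)
      have g: "m-1 \<le> i \<and> i < m-1 + int N" if "?g i \<noteq> LI" for i
        using that T[of i] jr N by (auto split: if_splits)
      have "?c ?g = q Q (wrap N ?g)"
      proof (rule coeffZ_eq[OF Q N(1) k(2) g])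
        \<comment> \<open>A bond sticking out at one end may create width \<open>k + 2\<close>; then
          two sites at distance exactly \<open>k\<close> must be exhibited.\<close>
        consider "m \<le> j" "j < m + int k" | "j = m-1" | "j = m + int k" using jr by linarith
        then show "(\<exists>m. \<forall>i. ?g i \<noteq> LI \<longrightarrow> m \<le> i \<and> i < m + int k) \<or> (\<exists>i. ?g i \<noteq> LI \<and> ?g (i + int k) \<noteq> LI)"
        proof cases
          case 1
          show ?thesis
          proof (rule in_window_or_far)
            show "m \<le> i \<and> i \<le> m + int k" if "?g i \<noteq> LI" for i
              using that T[of i] 1 by (auto split: if_splits)
          qed
        next
          case 2
          have Tm: "T (m-1) = LI" using T[of "m-1"] by force
          then have gm: "?g (m-1) \<noteq> LI" "?g m \<noteq> LI" using nz 2 by auto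
          consider "T (m + int k) \<noteq> LI" | "T (m - 1 + int k) \<noteq> LI" | "T (m + int k) = LI" "T (m - 1 + int k) = LI" by blast
          then show ?thesis
          proof cases
            case a: 1
            then have "?g (m + int k) \<noteq> LI" using 2 k by auto
            then show ?thesis using gm by blast
          next
            case a: 2
            then have "?g (m - 1 + int k) \<noteq> LI" using 2 k by auto
            then show ?thesis using gm by blast
          next
            case a: 3
            have "m-1 \<le> i \<and> i < m-1 + int k" if "?g i \<noteq> LI" for i
            proof -
              have "i = m-1 \<or> i = m \<or> T i \<noteq> LI" using that 2 by (auto split: if_splits)
              moreover have "i \<noteq> m + int k" "i \<noteq> m - 1 + int k" using that a 2 k by auto
              ultimately show ?thesis using T[of i] k by auto
            qed
            then show ?thesis by blast
          qed
        next
          case 3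
          have Tm: "T (m+int k+1) = LI" using T[of "m+int k+1"] by force
          then have gm: "?g (m+int k) \<noteq> LI" "?g (m + 1 + int k) \<noteq> LI" using nz 3 by (auto simp: add_ac)
          consider "T m \<noteq> LI" | "T (m + 1) \<noteq> LI" | "T m = LI" "T (m + 1) = LI" by blast
          then show ?thesis
          proof cases
            case a: 1
            then have "?g m \<noteq> LI" using 3 k by auto
            then show ?thesis using gm by blast
          next
            case a: 2
            then have "?g (m + 1) \<noteq> LI" using 3 k by auto
            then show ?thesis using gm by blast
          next
            case a: 3
            have "m+2 \<le> i \<and> i < m+2 + int k" if "?g i \<noteq> LI" for i
            proof -
              have "i = m+int k \<or> i = m + int k + 1 \<or> T i \<noteq> LI" using that 3 by (auto split: if_splits)
              moreover have "i \<noteq> m" "i \<noteq> m + 1" using that a 3 k by auto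
              ultimately show ?thesis using T[of i] k by auto
            qed
            then show ?thesis by blast
          qed
        qed
      qed
      also have "\<dots> = q Q (?f(i := a * T j, (i+1) mod N := a * T (j+1)))"
      proof (rule q_cong)
        fix l assume l: "l < N"
        have "wrap N ?g l = ((wrap N ?g1)(nat ((j+1) mod int N) := a * T (j+1))) l"
          by (rule wrap_upd[OF g1 _ _ l]) (use jr N in auto)
        moreover have "wrap N ?g1 l = (?f(i := a * T j)) l"
          unfolding i_def by (rule wrap_upd[OF supp j l])
        ultimately show "wrap N ?g l = (?f(i := a * T j, (i+1) mod N := a * T (j+1))) l"
          unfolding ii by (simp add: fun_upd_def)
      qed
      finally show ?thesis by simp
    qed simp
    show ?thesis unfolding i_def[symmetric] G_def F_def fi fii by (simp only: field bond)
  qed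
  have "0 = (\<Sum>j\<in>{m-1..<m-1 + int N}. F j)"
    using sum_ring_int[OF N(1), of G "m-1"] Gsum GF by simp
  also have "\<dots> = (\<Sum>j\<in>{m-1..m + int k + 1}. F j)"
  proof (rule sum.mono_neutral_right)
    show "\<forall>j\<in>{m-1..<m-1 + int N} - {m-1..m + int k + 1}. F j = 0"
    proof
      fix j assume "j \<in> {m-1..<m-1 + int N} - {m-1..m + int k + 1}"
      then have "T j = LI" "T (j+1) = LI" using T[of j] T[of "j+1"] by force+
      then show "F j = 0" by (simp add: F_def)
    qed
  qed (use N in auto)
  finally show "(\<Sum>j\<in>{m-1..m + int k + 1}. (\<Sum>a\<in>UNIV. h a * eps a (T j) * ?c (T(j := a * T j)))
       + (\<Sum>a\<in>UNIV. J a * bsg a (T j) (T (j+1)) * ?c (T(j := a * T j, j+1 := a * T (j+1))))) = 0"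
    unfolding F_def by simp
qed

lemma sum_of_le_supportI:
  assumes "is_op N A" "acts_within N (window N s k) A" "s < N"
  shows "sum_of_le_support N k A"
proof -
  have oc: "on_consecutive N k A" using assms unfolding on_consecutive_def by blast
  define l where "l = (LEAST l. on_consecutive N l A)"
  have "on_consecutive N l A" unfolding l_def by (rule LeastI[of _ k]) (rule oc)
  moreover have "l \<le> k" unfolding l_def by (rule Least_le) (rule oc)
  moreover have "\<not> on_consecutive N l' A" if "l' < l" for l'
    using not_less_Least that unfolding l_def by blast
  ultimately have "\<exists>l\<le>k. support_op N l A" unfolding support_op_def by blast
  then show ?thesis
    unfolding sum_of_le_support_def using assms(1) by (intro exI[of _ "[A]"]) simp
qed

lemma sum_of_le_support_add:
  "sum_of_le_support N k A \<Longrightarrow> sum_of_le_support N k B \<Longrightarrow> sum_of_le_support N k (A + B)"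
  unfolding sum_of_le_support_def
  by (metis (no_types, lifting) Un_iff set_append sum_list.append)

lemma sum_of_le_support_sum:
  assumes "finite I" "\<And>i. i \<in> I \<Longrightarrow> sum_of_le_support N k (A i)"
  shows "sum_of_le_support N k (\<Sum>i\<in>I. A i)"
  using assms
proof (induction I rule: finite_induct)
  case empty
  have "sum_of_le_support N k 0"
    unfolding sum_of_le_support_def by (intro exI[of _ "[]"]) (simp del: zero_fun_apply)
  then show ?case by (simp only: sum.empty)
next
  case (insert i I)
  then have "sum_of_le_support N k (A i + (\<Sum>i\<in>I. A i))"
    by (intro sum_of_le_support_add) auto
  then show ?case using insert by (simp only: sum.insert not_False_eq_True)
qed

text \<open>A ring string with non-zero coefficient fits into \<open>k\<close> sites and comes from
  a string on the line. By \<open>zero\<close> one of the end sites of its window is trivial, so the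
  window shrinks by one site.\<close>

theorem no_wide_strings:
  assumes k: "3 \<le> k" "2 * k \<le> N" and Q: "is_op N Q" "sum_of_le_support N k Q"
    and zero: "\<And>g m. g m \<noteq> LI \<Longrightarrow> g (m + int k - 1) \<noteq> LI \<Longrightarrow> coeffZ k Q g = 0"
  shows "sum_of_le_support N (k - 1) Q"
proof -
  have N: "N > 0" "k < N" using k by auto
  have narrow: "ring_window N (k-1) f" if qf: "q Q f \<noteq> 0" for f
  proof -
    obtain s where s: "s < N" "\<And>j. j < N \<Longrightarrow> f j \<noteq> LI \<Longrightarrow> j \<in> window N s k"
      using q_ring_window[OF Q(2)] qf unfolding ring_window_def by blast
    define g where "g j = (if int s \<le> j \<and> j < int s + int k then f (nat (j mod int N)) else LI)" for j
    have supp: "int s \<le> i \<and> i < int s + int N" if "g i \<noteq> LI" for i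
      using that N by (auto simp: g_def split: if_splits)
    have supp': "int s \<le> i \<and> i < int s + int k" if "g i \<noteq> LI" for i
      using that by (auto simp: g_def split: if_splits)
    have "wrap N g l = f l" if l: "l < N" for l
    proof -
      obtain j where j: "int s \<le> j" "j < int s + int N" "nat (j mod int N) = l" using ex_rep[OF l] by blast
      have w: "wrap N g l = g j" using wrap_eq[of g "int s" N j, OF supp j(1,2) N(1)] j(3) by simp
      show ?thesis
      proof (cases "j < int s + int k")
        case True then show ?thesis using w j by (simp add: g_def)
      next
        case False
        have "f l = LI"
        proof (rule ccontr)
          assume "f l \<noteq> LI"
          then obtain t where t: "t < k" "l = (s + t) mod N" using s(2)[OF l] unfolding window_def by blast
          have "j mod int N = int l" using j(3) N by auto
          then have "j mod int N = (int s + int t) mod int N" by (simp add: t(2) zmod_int)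
          then have "j = int s + int t" by (rule mod_unique) (use t j N in auto)
          then show False using False t by simp
        qed
        then show ?thesis using w False by (simp add: g_def)
      qed
    qed
    then have "q Q (wrap N g) = q Q f" by (rule q_cong)
    moreover have "coeffZ k Q g = q Q (wrap N g)" using supp' unfolding coeffZ_def by auto
    ultimately have "g (int s) = LI \<or> g (int s + int k - 1) = LI" using zero[of g "int s"] qf by auto
    then show ?thesis
    proof
      assume "g (int s) = LI"
      then have fs: "f s = LI" using k s(1) by (simp add: g_def)
      have "j \<in> window N ((s+1) mod N) (k-1)" if j: "j < N" "f j \<noteq> LI" for j
      proof -
        obtain t where t: "t < k" "j = (s + t) mod N" using s(2)[OF j] unfolding window_def by blast
        have "t \<noteq> 0"
        proof
          assume "t = 0"
          then have "j = s" using t s(1) by simp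
          then show False using j fs by simp
        qed
        then have "s + t = (s+1) + (t-1)" by simp
        then have "j = ((s+1) mod N + (t-1)) mod N" unfolding t(2) by (simp only: mod_add_left_eq)
        moreover have "t - 1 < k - 1" using t(1) \<open>t \<noteq> 0\<close> by simp
        ultimately show ?thesis unfolding window_def by blast
      qed
      then show ?thesis unfolding ring_window_def using N by (intro exI[of _ "(s+1) mod N"]) auto
    next
      assume "g (int s + int k - 1) = LI"
      then have fs: "f ((s + k - 1) mod N) = LI"
      proof -
        have "int s + int k - 1 = int (s + k - 1)" using k by simp
        then have "nat ((int s + int k - 1) mod int N) = (s + k - 1) mod N" by (metis nat_int zmod_int)
        with \<open>g (int s + int k - 1) = LI\<close> show ?thesis using k by (simp add: g_def)
      qed
      have "j \<in> window N s (k-1)" if j: "j < N" "f j \<noteq> LI" for j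
      proof -
        obtain t where t: "t < k" "j = (s + t) mod N" using s(2)[OF j] unfolding window_def by blast
        have "t \<noteq> k - 1"
        proof
          assume "t = k - 1"
          then have "j = (s + k - 1) mod N" using t k by simp
          then show False using j fs by simp
        qed
        then show ?thesis using t unfolding window_def by auto
      qed
      then show ?thesis unfolding ring_window_def using s(1) by blast
    qed
  qed
  have "sum_of_le_support N (k-1) (smul (q Q f / 2^N) (strop N f))" for f
  proof (cases "q Q f = 0")
    case True
    have "sum_of_le_support N (k-1) 0"
      using sum_of_le_support_sum[of "{} :: nat set" "k-1" undefined] by (simp only: sum.empty) simp
    then show ?thesis using True by (simp only: div_0 smul_simps)
  next
    case False
    then obtain s where s: "s < N" "\<And>j. j < N \<Longrightarrow> f j \<noteq> LI \<Longrightarrow> j \<in> window N s (k-1)"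
      using narrow unfolding ring_window_def by blast
    have "acts_within N (window N s (k-1)) (strop N f)"
      by (rule strop_acts_within) (use s in blast)
    then have "acts_within N (window N s (k-1)) (smul (q Q f / 2^N) (strop N f))"
      by (rule acts_within_smul)
    then show ?thesis using s(1) by (intro sum_of_le_supportI[of _ s]) (auto intro: is_op_smul)
  qed
  then show ?thesis
    by (subst pauli_expansion[OF Q(1)]) (rule sum_of_le_support_sum[OF finite_strings])
qed

end

section \<open>Rotated Pauli frames\<close>

text \<open>In type \<open>3\<close> the numeral 0 is 3. The order \<open>(3, 1, 2)\<close> is
  cyclic, so cross products keep their orientation.\<close>

lemma pauli_index: "pX = 3" "pY = 1" "pZ = 2"
  by (simp_all add: pX_def pY_def pZ_def)

lemma sum_pauli_index: "(\<Sum>a\<in>UNIV. f a) = f pX + f pY + f pZ" for f :: "3 \<Rightarrow> 'a::comm_monoid_add"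
  unfolding sum_3 pauli_index by (simp add: ac_simps)

lemma pauli_index_exhaust: "a = pX \<or> a = pY \<or> a = pZ"
  unfolding pauli_index using exhaust_3[of a] by blast

definition pvec :: "real^3 \<Rightarrow> mat2" where
  "pvec v x y = (\<Sum>b\<in>UNIV. complex_of_real (v $ b) * sqb b x y)"

lemma rot_pauli_lift: "rot_pauli N R a i = lift N i (pvec (R $ a))"
proof -
  have "lift N i (pvec (R $ a)) = lift N i (\<lambda>x y. \<Sum>b\<in>UNIV. complex_of_real (R $ a $ b) * sqb b x y)"
    by (rule arg_cong[where f = "lift N i"]) (simp add: pvec_def fun_eq_iff)
  then show ?thesis unfolding rot_pauli_def pauli_lift lift_sum lift_smul ..
qed

lemma mul2_pvec:
  "mul2 (pvec u) (pvec v) = (\<lambda>x y. complex_of_real (u \<bullet> v) * id2 x y + \<i> * pvec (cross3 u v) x y)"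
proof (intro ext)
  fix x y
  show "mul2 (pvec u) (pvec v) x y = complex_of_real (u \<bullet> v) * id2 x y + \<i> * pvec (cross3 u v) x y"
    unfolding mul2_def pvec_def sum_pauli_index sqb_simps id2_def inner_vec_def
    unfolding pauli_index cross_components
    by (cases x; cases y) (simp_all add: algebra_simps)
qed

definition right_handed :: "real^3 \<Rightarrow> real^3 \<Rightarrow> real^3 \<Rightarrow> bool" where
  "right_handed u v w \<longleftrightarrow> u \<bullet> u = 1 \<and> v \<bullet> v = 1 \<and> u \<bullet> v = 0 \<and> w = cross3 u v"

lemma right_handedD:
  assumes "right_handed u v w"
  shows "u \<bullet> u = 1" "v \<bullet> v = 1" "w \<bullet> w = 1" "u \<bullet> v = 0" "v \<bullet> u = 0" "u \<bullet> w = 0" "w \<bullet> u = 0" "v \<bullet> w = 0" "w \<bullet> v = 0"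
    "cross3 u v = w" "cross3 v w = u" "cross3 w u = v" "cross3 v u = - w" "cross3 w v = - u" "cross3 u w = - v"
proof -
  note a = assms[unfolded right_handed_def]
  show 1: "u \<bullet> u = 1" "v \<bullet> v = 1" "u \<bullet> v = 0" "v \<bullet> u = 0" using a by (auto simp: inner_commute)
  have w: "w = cross3 u v" using a by simp
  show "cross3 u v = w" using w by simp
  show "u \<bullet> w = 0" "w \<bullet> u = 0" "v \<bullet> w = 0" "w \<bullet> v = 0" unfolding w by (simp_all add: dot_cross_self)
  show "w \<bullet> w = 1" unfolding w dot_cross using 1 by simp
  show 2: "cross3 v w = u" unfolding w Lagrange using 1 by simp
  show 3: "cross3 w u = v" unfolding w cross_skew[of "cross3 u v" u] Lagrange using 1 by simp
  show "cross3 v u = - w" unfolding w by (rule cross_skew)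
  show "cross3 w v = - u" using cross_skew[of w v] 2 by simp
  show "cross3 u w = - v" using cross_skew[of u w] 3 by simp
qed

lemma right_handedI:
  "u \<bullet> u = 1 \<Longrightarrow> v \<bullet> v = 1 \<Longrightarrow> u \<bullet> v = 0 \<Longrightarrow> w = cross3 u v \<Longrightarrow> right_handed u v w"
  by (simp add: right_handed_def)

lemma right_handed_rotate: "right_handed u v w \<Longrightarrow> right_handed v w u"
  by (rule right_handedI) (simp_all add: right_handedD)

lemma right_handed_swap: "right_handed u v w \<Longrightarrow> right_handed w v (- u)"
  by (rule right_handedI) (simp_all add: right_handedD)

definition frame_matrix :: "real^3 \<Rightarrow> real^3 \<Rightarrow> real^3 \<Rightarrow> real^3^3" where
  "frame_matrix u v w = (\<chi> i. if i = pX then u else if i = pY then v else w)"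

lemma frame_matrix_rows [simp]: "frame_matrix u v w $ pX = u" "frame_matrix u v w $ pY = v" "frame_matrix u v w $ pZ = w"
  by (simp_all add: frame_matrix_def)

lemma rotation_frame_matrix:
  assumes "right_handed u v w"
  shows "rotation_matrix (frame_matrix u v w)"
proof -
  note r = right_handedD[OF assms]
  have e: "frame_matrix u v w $ 3 = u" "frame_matrix u v w $ 1 = v" "frame_matrix u v w $ 2 = w"
    using frame_matrix_rows[of u v w] unfolding pauli_index by simp_all
  have "frame_matrix u v w ** transpose (frame_matrix u v w) = mat 1"
    unfolding vec_eq_iff forall_3
    using r by (simp add: matrix_matrix_mult_def transpose_def mat_def e inner_vec_def sum_3)
  then have o: "orthogonal_matrix (frame_matrix u v w)"
    by (simp add: orthogonal_matrix_def matrix_left_right_inverse)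
  have "frame_matrix u v w = vector [v, w, u]"
    unfolding vec_eq_iff forall_3 by (simp add: e)
  then have "det (frame_matrix u v w) = v \<bullet> cross3 w u" by (simp add: dot_cross_det)
  then show ?thesis using o r by (simp add: rotation_matrix_def)
qed

lemma frame_columns:
  assumes "right_handed u v w"
  shows "u $ a * u $ b + v $ a * v $ b + w $ a * w $ b = (if a = b then 1 else 0)"
proof -
  let ?S = "frame_matrix u v w"
  have "transpose ?S ** ?S = mat 1"
    using rotation_frame_matrix[OF assms] by (simp add: rotation_matrix_def orthogonal_matrix_def)
  then have "(transpose ?S ** ?S) $ a $ b = (mat 1 :: real^3^3) $ a $ b" by simp
  then show ?thesis
    by (simp add: matrix_matrix_mult_def transpose_def mat_def sum_pauli_index)
qed

lemma frame_expand:
  assumes "right_handed u v w"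
  shows "x = (x \<bullet> u) *\<^sub>R u + (x \<bullet> v) *\<^sub>R v + (x \<bullet> w) *\<^sub>R w"
  unfolding vec_eq_iff
proof
  fix a
  have "((x \<bullet> u) *\<^sub>R u + (x \<bullet> v) *\<^sub>R v + (x \<bullet> w) *\<^sub>R w) $ a
      = (\<Sum>b\<in>UNIV. x $ b * (u $ a * u $ b + v $ a * v $ b + w $ a * w $ b))"
    by (simp add: inner_vec_def sum_3 algebra_simps)
  also have "\<dots> = x $ a" unfolding frame_columns[OF assms] by (simp add: if_distrib cong: if_cong)
  finally show "x $ a = ((x \<bullet> u) *\<^sub>R u + (x \<bullet> v) *\<^sub>R v + (x \<bullet> w) *\<^sub>R w) $ a" by simp
qed

definition frame_sm :: "real^3 \<Rightarrow> real^3 \<Rightarrow> real^3 \<Rightarrow> letter \<Rightarrow> mat2" where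
  "frame_sm u v w a = (case a of LI \<Rightarrow> id2 | LX \<Rightarrow> pvec u | LY \<Rightarrow> pvec v | LZ \<Rightarrow> pvec w)"

lemma frame_sm_simps [simp]: "frame_sm u v w LI = id2" "frame_sm u v w LX = pvec u"
  "frame_sm u v w LY = pvec v" "frame_sm u v w LZ = pvec w"
  by (simp_all add: frame_sm_def)

lemma mul2_id2 [simp]: "mul2 id2 m = m" "mul2 m id2 = m"
proof -
  show "mul2 id2 m = m"
  proof (intro ext) fix x y show "mul2 id2 m x y = m x y" by (cases x) (simp_all add: mul2_def id2_def) qed
  show "mul2 m id2 = m"
  proof (intro ext) fix x y show "mul2 m id2 x y = m x y" by (cases y) (simp_all add: mul2_def id2_def) qed
qed

lemma pvec_neg: "pvec (- v) x y = - pvec v x y"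
  by (simp add: pvec_def sum_negf)

lemma pvec_zero [simp]: "pvec 0 x y = 0"
  by (simp add: pvec_def)

lemma pauli_basis_frame:
  assumes rh: "right_handed u v w"
  shows "pauli_basis (frame_sm u v w)"
proof
  note r = right_handedD[OF rh]
  show "frame_sm u v w LI = id2" by simp
  show "mul2 (frame_sm u v w a) (frame_sm u v w b) = (\<lambda>x y. pm a b * frame_sm u v w (a * b) x y)" for a b
    by (cases a; cases b) (simp_all add: mul2_pvec r pm_def pvec_neg)
  show "\<exists>l. sqb b = (\<lambda>x y. \<Sum>a\<in>UNIV. l a * frame_sm u v w a x y)" for b
  proof -
    define l where "l a = complex_of_real (case a of LI \<Rightarrow> 0 | LX \<Rightarrow> u $ b | LY \<Rightarrow> v $ b | LZ \<Rightarrow> w $ b)" for a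
    have "(\<Sum>a\<in>UNIV. l a * frame_sm u v w a x y) = sqb b x y" for x y
    proof -
      have "(\<Sum>a\<in>UNIV. l a * frame_sm u v w a x y) = 
         (\<Sum>c\<in>UNIV. complex_of_real (u $ b * u $ c + v $ b * v $ c + w $ b * w $ c) * sqb c x y)"
        by (simp add: sum_letter l_def pvec_def sum_distrib_left sum.distrib algebra_simps)
      also have "\<dots> = sqb b x y"
        unfolding frame_columns[OF rh] by (simp add: if_distrib if_distribR cong: if_cong)
      finally show ?thesis .
    qed
    then show ?thesis by (intro exI[of _ l]) (simp add: fun_eq_iff)
  qed
qed


text \<open>As a matrix, \<open>transpose R ** J ** R\<close>.\<close>

definition conjJ :: "real^3^3 \<Rightarrow> (3 \<Rightarrow> 3 \<Rightarrow> real) \<Rightarrow> 3 \<Rightarrow> 3 \<Rightarrow> real" where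
  "conjJ R J c d = (\<Sum>a\<in>UNIV. \<Sum>b\<in>UNIV. R $ a $ c * J a b * R $ b $ d)"

definition conjh :: "real^3^3 \<Rightarrow> (3 \<Rightarrow> real) \<Rightarrow> 3 \<Rightarrow> real" where
  "conjh R h c = (\<Sum>a\<in>UNIV. R $ a $ c * h a)"

lemma smul_of_real_sum: "smul (complex_of_real (\<Sum>a\<in>A. f a)) X = (\<Sum>a\<in>A. smul (complex_of_real (f a)) X)"
  unfolding of_real_sum by (rule additive_sum[where F = "\<lambda>x. smul x X"]) (simp_all only: smul_simps smul_add)

lemma ham_rot_pauli:
  "ham N (rot_pauli N R) J h = ham N (pauli N) (conjJ R J) (conjh R h)"
proof -
  have bond: "(\<Sum>a\<in>UNIV. \<Sum>b\<in>UNIV. smul (complex_of_real (J a b)) (mmul N (rot_pauli N R a i) (rot_pauli N R b j)))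
      = (\<Sum>c\<in>UNIV. \<Sum>d\<in>UNIV. smul (complex_of_real (conjJ R J c d)) (mmul N (pauli N c i) (pauli N d j)))" for i j
  proof -
    define X where "X c d = mmul N (pauli N c i) (pauli N d j)" for c d
    have "(\<Sum>a\<in>UNIV. \<Sum>b\<in>UNIV. smul (complex_of_real (J a b)) (mmul N (rot_pauli N R a i) (rot_pauli N R b j)))
      = (\<Sum>a\<in>UNIV. \<Sum>b\<in>UNIV. \<Sum>d\<in>UNIV. \<Sum>c\<in>UNIV. smul (complex_of_real (R $ a $ c * J a b * R $ b $ d)) (X c d))"
      unfolding rot_pauli_def mmul_sum_left mmul_sum_right mmul_smul_left mmul_smul_right smul_sum smul_simps(1) X_def
      by (simp only: of_real_mult mult_ac)
    also have "\<dots> = (\<Sum>a\<in>UNIV. \<Sum>b\<in>UNIV. \<Sum>c\<in>UNIV. \<Sum>d\<in>UNIV. smul (complex_of_real (R $ a $ c * J a b * R $ b $ d)) (X c d))"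
      by (intro sum.cong refl sum.swap)
    also have "\<dots> = (\<Sum>a\<in>UNIV. \<Sum>c\<in>UNIV. \<Sum>b\<in>UNIV. \<Sum>d\<in>UNIV. smul (complex_of_real (R $ a $ c * J a b * R $ b $ d)) (X c d))"
      by (intro sum.cong refl sum.swap)
    also have "\<dots> = (\<Sum>a\<in>UNIV. \<Sum>c\<in>UNIV. \<Sum>d\<in>UNIV. \<Sum>b\<in>UNIV. smul (complex_of_real (R $ a $ c * J a b * R $ b $ d)) (X c d))"
      by (intro sum.cong refl sum.swap)
    also have "\<dots> = (\<Sum>c\<in>UNIV. \<Sum>a\<in>UNIV. \<Sum>d\<in>UNIV. \<Sum>b\<in>UNIV. smul (complex_of_real (R $ a $ c * J a b * R $ b $ d)) (X c d))"
      by (rule sum.swap)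
    also have "\<dots> = (\<Sum>c\<in>UNIV. \<Sum>d\<in>UNIV. \<Sum>a\<in>UNIV. \<Sum>b\<in>UNIV. smul (complex_of_real (R $ a $ c * J a b * R $ b $ d)) (X c d))"
      by (intro sum.cong refl sum.swap)
    also have "\<dots> = (\<Sum>c\<in>UNIV. \<Sum>d\<in>UNIV. smul (complex_of_real (conjJ R J c d)) (X c d))"
      by (simp only: conjJ_def smul_of_real_sum)
    finally show ?thesis unfolding X_def .
  qed
  have field: "(\<Sum>a\<in>UNIV. smul (complex_of_real (h a)) (rot_pauli N R a i))
     = (\<Sum>c\<in>UNIV. smul (complex_of_real (conjh R h c)) (pauli N c i))" for i
  proof -
    have "(\<Sum>a\<in>UNIV. smul (complex_of_real (h a)) (rot_pauli N R a i))
      = (\<Sum>a\<in>UNIV. \<Sum>c\<in>UNIV. smul (complex_of_real (R $ a $ c * h a)) (pauli N c i))"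
      unfolding rot_pauli_def smul_sum smul_simps(1) by (simp only: of_real_mult mult_ac)
    also have "\<dots> = (\<Sum>c\<in>UNIV. \<Sum>a\<in>UNIV. smul (complex_of_real (R $ a $ c * h a)) (pauli N c i))"
      by (rule sum.swap)
    finally show ?thesis by (simp only: conjh_def smul_of_real_sum)
  qed
  show ?thesis unfolding ham_def bond field ..
qed

definition vecL :: "real \<Rightarrow> real \<Rightarrow> real \<Rightarrow> letter \<Rightarrow> complex" where
  "vecL x y z a = complex_of_real (case a of LI \<Rightarrow> 0 | LX \<Rightarrow> x | LY \<Rightarrow> y | LZ \<Rightarrow> z)"

lemma vecL_simps [simp]: "vecL x y z LI = 0" "vecL x y z LX = of_real x" "vecL x y z LY = of_real y" "vecL x y z LZ = of_real z"
  by (simp_all add: vecL_def)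

lemma diagJ_simps [simp]: "diagJ x y z pX pX = x" "diagJ x y z pY pY = y" "diagJ x y z pZ pZ = z"
   "a \<noteq> b \<Longrightarrow> diagJ x y z a b = 0"
  by (simp_all add: diagJ_def)

lemma vecH_simps [simp]: "vecH x y z pX = x" "vecH x y z pY = y" "vecH x y z pZ = z"
  by (simp_all add: vecH_def)

lemma ham_frame:
  assumes rh: "right_handed u v w"
  shows "ham N (rot_pauli N (frame_matrix u v w)) (diagJ a b c) (vecH x y z)
       = pauli_basis.hamL N (frame_sm u v w) (vecL a b c) (vecL x y z)"
proof -
  interpret pauli_basis N "frame_sm u v w" by (rule pauli_basis_frame[OF rh])
  have P: "rot_pauli N (frame_matrix u v w) pX i = P LX i" "rot_pauli N (frame_matrix u v w) pY i = P LY i"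
    "rot_pauli N (frame_matrix u v w) pZ i = P LZ i" for i
    by (simp_all add: rot_pauli_lift P_def)
  show ?thesis unfolding ham_def hamL_def sum_pauli_index sum_letter P
    by (simp only: diagJ_simps vecH_simps vecL_simps pauli_index_distinct not_False_eq_True of_real_0 smul_simps add_0_left add_0_right add_0)
qed

definition diag_frame :: "real^3^3 \<Rightarrow> real^3 \<Rightarrow> real^3 \<Rightarrow> real^3 \<Rightarrow> bool" where
  "diag_frame A u v w \<longleftrightarrow> right_handed u v w \<and> u \<bullet> (A *v v) = 0 \<and> u \<bullet> (A *v w) = 0 \<and> v \<bullet> (A *v w) = 0"

lemma sym_inner:
  fixes A :: "real^3^3"
  assumes "transpose A = A"
  shows "x \<bullet> (A *v y) = y \<bullet> (A *v x)"
  using dot_matrix_vector_mul assms by (metis dot_lmul_matrix inner_commute transpose_matrix_vector)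

text \<open>The first form rotates the Hamiltonian into a diagonal one, to be compared with the
  excluded models. The second writes the original Hamiltonian in rotated Paulis, for the coefficient
  equations.\<close>

lemma diag_frame_ham:
  fixes A :: "real^3^3" and hv :: "real^3"
  assumes A: "transpose A = A" and fr: "diag_frame A u v w" 
    and J: "\<And>a b. J a b = A $ a $ b" and h: "\<And>a. h a = hv $ a"
  defines "a \<equiv> u \<bullet> (A *v u)" and "b \<equiv> v \<bullet> (A *v v)" and "c \<equiv> w \<bullet> (A *v w)"
  shows "ham N (rot_pauli N (transpose (frame_matrix u v w))) J h
       = ham N (pauli N) (diagJ a b c) (vecH (u \<bullet> hv) (v \<bullet> hv) (w \<bullet> hv))" (is ?A)
    and "ham N (pauli N) J h
       = ham N (rot_pauli N (frame_matrix u v w)) (diagJ a b c) (vecH (u \<bullet> hv) (v \<bullet> hv) (w \<bullet> hv))" (is ?B)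
proof -
  let ?S = "frame_matrix u v w"
  have rh: "right_handed u v w" using fr by (simp add: diag_frame_def)
  have cJ: "conjJ (transpose ?S) J p q = ?S $ p \<bullet> (A *v (?S $ q))" for p q
    unfolding conjJ_def transpose_def J
    by (simp add: inner_vec_def matrix_vector_mult_def sum_distrib_left mult_ac)
  have ch: "conjh (transpose ?S) h p = ?S $ p \<bullet> hv" for p
    unfolding conjh_def transpose_def h by (simp add: inner_vec_def)
  have off: "u \<bullet> (A *v v) = 0" "u \<bullet> (A *v w) = 0" "v \<bullet> (A *v w) = 0"
    using fr unfolding diag_frame_def by blast+
  have off': "v \<bullet> (A *v u) = 0" "w \<bullet> (A *v u) = 0" "w \<bullet> (A *v v) = 0"
    using off sym_inner[OF A, of v u] sym_inner[OF A, of w u] sym_inner[OF A, of w v] by auto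
  have D: "conjJ (transpose ?S) J = diagJ a b c"
  proof (intro ext)
    fix p q
    show "conjJ (transpose ?S) J p q = diagJ a b c p q"
      unfolding cJ using pauli_index_exhaust[of p] pauli_index_exhaust[of q] off off'
      by (auto simp: a_def b_def c_def)
  qed
  have H: "conjh (transpose ?S) h = vecH (u \<bullet> hv) (v \<bullet> hv) (w \<bullet> hv)"
  proof
    fix p show "conjh (transpose ?S) h p = vecH (u \<bullet> hv) (v \<bullet> hv) (w \<bullet> hv) p"
      unfolding ch using pauli_index_exhaust[of p] by auto
  qed
  show ?A unfolding ham_rot_pauli D H ..
  have T: "transpose ?S ** ?S = mat 1"
    using rotation_frame_matrix[OF rh] by (simp add: rotation_matrix_def orthogonal_matrix_def)
  have "conjJ ?S (conjJ (transpose ?S) J) p q = J p q" for p q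
  proof -
    have "conjJ ?S (conjJ (transpose ?S) J) p q = ((transpose ?S ** ?S) ** A ** (transpose ?S ** ?S)) $ p $ q"
      unfolding conjJ_def J matrix_matrix_mult_def transpose_def sum_3 by (simp add: algebra_simps)
    then show ?thesis by (simp add: T J)
  qed
  then have D': "conjJ ?S (diagJ a b c) = J" unfolding D[symmetric] by (intro ext)
  have "conjh ?S (conjh (transpose ?S) h) p = h p" for p
  proof -
    have "conjh ?S (conjh (transpose ?S) h) p = ((transpose ?S ** ?S) *v hv) $ p"
      unfolding conjh_def h matrix_matrix_mult_def transpose_def matrix_vector_mult_def sum_3 by (simp add: algebra_simps)
    then show ?thesis by (simp add: T h)
  qed
  then have H': "conjh ?S (vecH (u \<bullet> hv) (v \<bullet> hv) (w \<bullet> hv)) = h" unfolding H[symmetric] by (intro ext)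
  show ?B unfolding ham_rot_pauli D' H' ..
qed

text \<open>The quadratic form of \<open>A\<close> attains a maximum on the unit sphere of
  \<open>V\<close>, and its first variation along an orthogonal \<open>y\<close> vanishes
  there.\<close>

lemma constrained_max:
  fixes A :: "real^3^3"
  assumes A: "transpose A = A" and V: "subspace V" and ne: "x0 \<in> V" "x0 \<noteq> 0"
  obtains x where "x \<in> V" "x \<bullet> x = 1" "\<And>y. y \<in> V \<Longrightarrow> x \<bullet> y = 0 \<Longrightarrow> x \<bullet> (A *v y) = 0"
proof -
  let ?K = "V \<inter> sphere 0 1"
  have cK: "compact ?K" using V by (intro closed_Int_compact closed_subspace) auto
  have "(1 / norm x0) *\<^sub>R x0 \<in> ?K" using ne V by (simp add: subspace_scale)
  then have nK: "?K \<noteq> {}" by blast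
  have "continuous_on ?K (\<lambda>x. x \<bullet> (A *v x))"
    by (intro continuous_intros linear_continuous_on matrix_vector_mul_bounded_linear)
  from continuous_attains_sup[OF cK nK this]
  obtain x where x: "x \<in> ?K" "\<And>y. y \<in> ?K \<Longrightarrow> y \<bullet> (A *v y) \<le> x \<bullet> (A *v x)" by blast
  have xx: "x \<bullet> x = 1" using x(1) by (simp add: dot_square_norm)
  define l where "l = x \<bullet> (A *v x)"
  have le: "y \<bullet> (A *v y) \<le> l * (y \<bullet> y)" if "y \<in> V" for y
  proof (cases "y = 0")
    case False
    let ?z = "(1 / norm y) *\<^sub>R y"
    have "?z \<in> ?K" using that False V by (simp add: subspace_scale)
    then have "?z \<bullet> (A *v ?z) \<le> l" using x(2) unfolding l_def by blast
    moreover have "?z \<bullet> (A *v ?z) = (y \<bullet> (A *v y)) / (y \<bullet> y)"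
    proof -
      have "?z \<bullet> (A *v ?z) = (y \<bullet> (A *v y)) / (norm y * norm y)"
        by (simp add: matrix_vector_mult_scaleR)
      also have "norm y * norm y = y \<bullet> y" by (metis dot_square_norm power2_eq_square)
      finally show ?thesis .
    qed
    moreover have "y \<bullet> y > 0" using False by simp
    ultimately show ?thesis by (simp add: pos_divide_le_eq)
  qed simp
  show thesis
  proof (rule that)
    show "x \<in> V" using x(1) by simp
    show "x \<bullet> x = 1" by fact
    fix y assume y: "y \<in> V" "x \<bullet> y = 0"
    define m where "m = x \<bullet> (A *v y)"
    define r where "r = l * (y \<bullet> y) - y \<bullet> (A *v y)"
    have r: "r \<ge> 0" using le[OF y(1)] by (simp add: r_def)
    have q: "2 * t * m \<le> t\<^sup>2 * r" for t
    proof -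
      have "x + t *\<^sub>R y \<in> V" using \<open>x \<in> V\<close> y V by (simp add: subspace_add subspace_scale)
      from le[OF this] have "l + t * (y \<bullet> (A *v x)) + t * m + t\<^sup>2 * (y \<bullet> (A *v y)) \<le> l * (1 + t\<^sup>2 * (y \<bullet> y))"
      proof -
        have yx: "y \<bullet> x = 0" using y(2) by (simp add: inner_commute)
        have "(x + t *\<^sub>R y) \<bullet> (A *v (x + t *\<^sub>R y)) = l + t * (y \<bullet> (A *v x)) + t * m + t\<^sup>2 * (y \<bullet> (A *v y))"
          by (simp add: matrix_vector_right_distrib matrix_vector_mult_scaleR inner_add_left inner_add_right
            power2_eq_square l_def m_def distrib_left)
        moreover have "(x + t *\<^sub>R y) \<bullet> (x + t *\<^sub>R y) = 1 + t\<^sup>2 * (y \<bullet> y)"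
          by (simp add: inner_add_left inner_add_right xx y(2) yx power2_eq_square)
        ultimately show ?thesis using \<open>(x + t *\<^sub>R y) \<bullet> (A *v (x + t *\<^sub>R y)) \<le> l * ((x + t *\<^sub>R y) \<bullet> (x + t *\<^sub>R y))\<close>
          by simp
      qed
      moreover have "y \<bullet> (A *v x) = m" unfolding m_def by (rule sym_inner[OF A])
      ultimately show ?thesis by (simp add: r_def algebra_simps)
    qed
    have "m = 0"
    proof (rule ccontr)
      assume "m \<noteq> 0"
      \<comment> \<open>A small step in the direction of the sign of \<open>m\<close>;
        \<open>r + 1\<close> keeps the denominator positive.\<close>
      define t where "t = m / (r + 1)"
      have m: "m = t * (r + 1)" and "t \<noteq> 0" using r \<open>m \<noteq> 0\<close> by (simp_all add: t_def)
      have "2 * t * m \<le> t\<^sup>2 * r" by (rule q)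
      then have "t\<^sup>2 * (r + 2) \<le> 0" by (simp add: m algebra_simps power2_eq_square)
      moreover have "t\<^sup>2 * (r + 2) > 0" using r \<open>t \<noteq> 0\<close> by simp
      ultimately show False by linarith
    qed
    then show "x \<bullet> (A *v y) = 0" by (simp add: m_def)
  qed
qed

lemma ex_orthogonal: "u \<noteq> 0 \<Longrightarrow> \<exists>x. x \<noteq> 0 \<and> u \<bullet> x = 0" for u :: "real^3"
  using cross_basis_nonzero[of u] dot_cross_self(1)[of u] by blast

text \<open>Principal axes: maximise over the whole space, then over the plane orthogonal to the
  first vector; the cross product completes the frame.\<close>

lemma ex_diag_frame:
  fixes A :: "real^3^3"
  assumes A: "transpose A = A"
  shows "\<exists>u v w. diag_frame A u v w"
proof -
  have ax: "axis 1 1 \<noteq> (0 :: real^3)" by (simp add: axis_eq_0_iff)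
  obtain u where u: "u \<in> UNIV" "u \<bullet> u = 1" "\<And>y. y \<in> UNIV \<Longrightarrow> u \<bullet> y = 0 \<Longrightarrow> u \<bullet> (A *v y) = 0"
    by (rule constrained_max[OF A subspace_UNIV UNIV_I ax]) (rule that; assumption)
  have "u \<noteq> 0" using u(2) by auto
  then obtain x0 where x0: "x0 \<in> {y. u \<bullet> y = 0}" "x0 \<noteq> 0" using ex_orthogonal by blast
  obtain v where v: "v \<in> {y. u \<bullet> y = 0}" "v \<bullet> v = 1"
     "\<And>y. y \<in> {y. u \<bullet> y = 0} \<Longrightarrow> v \<bullet> y = 0 \<Longrightarrow> v \<bullet> (A *v y) = 0"
    by (rule constrained_max[OF A subspace_hyperplane x0]) (rule that; assumption)
  have rh: "right_handed u v (cross3 u v)" using u v by (intro right_handedI) auto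
  note r = right_handedD[OF rh]
  have "diag_frame A u v (cross3 u v)"
    unfolding diag_frame_def using rh u(3)[of v] u(3)[of "cross3 u v"] v(1) v(3)[of "cross3 u v"] r(6,8) by simp
  then show ?thesis by blast
qed

lemma ex_frame_along:
  assumes "x \<noteq> (0 :: real^3)"
  shows "\<exists>u v w. right_handed u v w \<and> u \<bullet> x = 0 \<and> v \<bullet> x = 0"
proof -
  obtain y where y: "y \<noteq> 0" "x \<bullet> y = 0" using ex_orthogonal[OF assms] by blast
  define u where "u = (1 / norm y) *\<^sub>R y"
  define w where "w = (1 / norm x) *\<^sub>R x"
  have uw: "u \<bullet> u = 1" "w \<bullet> w = 1" "w \<bullet> u = 0"
  proof -
    have "norm u = 1" "norm w = 1" using y assms by (simp_all add: u_def w_def)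
    then show "u \<bullet> u = 1" "w \<bullet> w = 1" by (simp_all add: dot_square_norm)
    show "w \<bullet> u = 0" using y by (simp add: u_def w_def)
  qed
  have "right_handed w u (cross3 w u)" using uw by (intro right_handedI) auto
  from right_handed_rotate[OF this] have "right_handed u (cross3 w u) w" .
  moreover have "u \<bullet> x = 0" using y by (simp add: u_def inner_commute)
  moreover have "cross3 w u \<bullet> x = 0"
    using dot_cross_self(1)[of x u] by (simp add: w_def cross_mult_left inner_commute)
  ultimately show ?thesis by blast
qed

definition dj :: "real^3^3 \<Rightarrow> real^3 \<Rightarrow> real" where
  "dj A u = u \<bullet> (A *v u)"

lemma matrix_vector_mult_minus: "A *v (- x) = - (A *v x)" for A :: "real^3^3"
  using matrix_vector_mult_scaleR[of A "-1" x] by simp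

lemma dj_neg [simp]: "dj A (- u) = dj A u"
  by (simp add: dj_def matrix_vector_mult_minus)

lemma diag_frame_rotate: "transpose A = A \<Longrightarrow> diag_frame A u v w \<Longrightarrow> diag_frame A v w u"
  using sym_inner[of A v u] sym_inner[of A w u] by (auto simp: diag_frame_def right_handed_rotate)

lemma diag_frame_swap: "transpose A = A \<Longrightarrow> diag_frame A u v w \<Longrightarrow> diag_frame A w v (- u)"
  using sym_inner[of A w v] sym_inner[of A w u] sym_inner[of A v u]
  by (auto simp: diag_frame_def right_handed_swap matrix_vector_mult_minus)

lemma scalar_frame:
  assumes A: "transpose A = A" and fr: "diag_frame A u v w" and eq: "dj A u = a" "dj A v = a" "dj A w = a"
  shows "A *v x = a *\<^sub>R x"
proof -
  have rh: "right_handed u v w" using fr by (simp add: diag_frame_def)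
  have off: "u \<bullet> (A *v v) = 0" "u \<bullet> (A *v w) = 0" "v \<bullet> (A *v w) = 0"
    using fr unfolding diag_frame_def by blast+
  have off': "v \<bullet> (A *v u) = 0" "w \<bullet> (A *v u) = 0" "w \<bullet> (A *v v) = 0"
    using off sym_inner[OF A, of v u] sym_inner[OF A, of w u] sym_inner[OF A, of w v] by auto
  have d: "u \<bullet> (A *v u) = a" "v \<bullet> (A *v v) = a" "w \<bullet> (A *v w) = a" using eq by (simp_all add: dj_def)
  have Au: "A *v u = a *\<^sub>R u"
    using frame_expand[OF rh, of "A *v u"] d off' by (simp add: inner_commute)
  have Av: "A *v v = a *\<^sub>R v"
    using frame_expand[OF rh, of "A *v v"] d off off' by (simp add: inner_commute)
  have Aw: "A *v w = a *\<^sub>R w"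
    using frame_expand[OF rh, of "A *v w"] d off by (simp add: inner_commute)
  define p q r where "p = x \<bullet> u" "q = x \<bullet> v" "r = x \<bullet> w"
  have x: "x = p *\<^sub>R u + q *\<^sub>R v + r *\<^sub>R w" using frame_expand[OF rh, of x] by (simp add: p_q_r_def)
  show ?thesis unfolding x
    by (simp add: matrix_vector_right_distrib matrix_vector_mult_scaleR Au Av Aw scaleR_add_right mult.commute)
qed

text \<open>The patterns of a diagonal coupling \<open>(a, b, c)\<close> and a field \<open>(x, y, z)\<close> covered by the excluded models:
  XXZ (including XXX, the longitudinal Ising model and free spins), XYZ, XY, transverse-field Ising.\<close>
definition excluded_pattern :: "real \<Rightarrow> real \<Rightarrow> real \<Rightarrow> real \<Rightarrow> real \<Rightarrow> real \<Rightarrow> bool" where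
  "excluded_pattern a b c x y z \<longleftrightarrow> a = b \<and> x = 0 \<and> y = 0 \<or> x = 0 \<and> y = 0 \<and> z = 0
     \<or> c = 0 \<and> x = 0 \<and> y = 0 \<or> a = 0 \<and> b = 0 \<and> y = 0 \<and> z = 0"

text \<open>The three alternatives are the hypotheses of \<open>rank3_string_eq\<close>,
  \<open>rank2_string_eq\<close> and \<open>rank1_string_eq\<close>.\<close>

definition nonintegrable_pattern :: "real \<Rightarrow> real \<Rightarrow> real \<Rightarrow> real \<Rightarrow> real \<Rightarrow> real \<Rightarrow> bool" where
  "nonintegrable_pattern a b c x y z \<longleftrightarrow> a \<noteq> 0 \<and> b \<noteq> 0 \<and> c \<noteq> 0 \<and> z \<noteq> 0 \<and> a \<noteq> b
     \<or> b = 0 \<and> a \<noteq> 0 \<and> c \<noteq> 0 \<and> z \<noteq> 0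
     \<or> a = 0 \<and> b = 0 \<and> c \<noteq> 0 \<and> y = 0 \<and> x \<noteq> 0 \<and> z \<noteq> 0"

lemma nonintegrable_patternD:
  "\<not> nonintegrable_pattern a b c x y z \<Longrightarrow> a \<noteq> 0 \<Longrightarrow> b \<noteq> 0 \<Longrightarrow> c \<noteq> 0 \<Longrightarrow> z = 0 \<or> a = b"
  by (auto simp: nonintegrable_pattern_def)

lemma excluded_patternD:
  "\<not> excluded_pattern a b c x y z \<Longrightarrow> z = 0 \<or> a = b \<Longrightarrow> x \<noteq> 0 \<or> y \<noteq> 0"
  by (auto simp: excluded_pattern_def)

lemma all_equal_couplings:
  fixes a b c x y z :: real
  shows "z = 0 \<or> a = b \<Longrightarrow> x = 0 \<or> b = c \<Longrightarrow> y = 0 \<or> c = a \<Longrightarrow>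
    x \<noteq> 0 \<or> y \<noteq> 0 \<Longrightarrow> y \<noteq> 0 \<or> z \<noteq> 0 \<Longrightarrow> z \<noteq> 0 \<or> x \<noteq> 0 \<Longrightarrow> a = b \<and> b = c"
  by auto

lemma all_zero_couplings:
  fixes a b c :: real
  shows "\<not> (b = 0 \<and> a \<noteq> 0 \<and> c \<noteq> 0) \<Longrightarrow> \<not> (c = 0 \<and> b \<noteq> 0 \<and> a \<noteq> 0) \<Longrightarrow> \<not> (a = 0 \<and> c \<noteq> 0 \<and> b \<noteq> 0) \<Longrightarrow>
    \<not> (a = 0 \<and> b = 0 \<and> c \<noteq> 0) \<Longrightarrow> \<not> (b = 0 \<and> c = 0 \<and> a \<noteq> 0) \<Longrightarrow> \<not> (c = 0 \<and> a = 0 \<and> b \<noteq> 0) \<Longrightarrow>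
    \<not> (a \<noteq> 0 \<and> b \<noteq> 0 \<and> c \<noteq> 0) \<Longrightarrow> a = b \<and> b = c"
  by auto

lemma ex_nonintegrable_frame:
  fixes A :: "real^3^3" and h :: "real^3"
  assumes A: "transpose A = A"
    and NE: "\<And>u v w. diag_frame A u v w \<Longrightarrow> \<not> excluded_pattern (dj A u) (dj A v) (dj A w) (u \<bullet> h) (v \<bullet> h) (w \<bullet> h)"
  shows "\<exists>u v w. diag_frame A u v w \<and> nonintegrable_pattern (dj A u) (dj A v) (dj A w) (u \<bullet> h) (v \<bullet> h) (w \<bullet> h)"
proof (rule ccontr)
  assume neg: "\<not> ?thesis"
  have NG: "\<not> nonintegrable_pattern (dj A u) (dj A v) (dj A w) (u \<bullet> h) (v \<bullet> h) (w \<bullet> h)" if "diag_frame A u v w" for u v w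
    using neg that by blast
  note rot = diag_frame_rotate[OF A] and swap = diag_frame_swap[OF A]
  \<comment> \<open>Rank two: the pattern fails for both coupled axes, so the field lies along the
    uncoupled axis. This is the XY chain.\<close>
  have one_zero: False if fr: "diag_frame A u v w" and nz: "dj A v = 0" "dj A u \<noteq> 0" "dj A w \<noteq> 0" for u v w
  proof -
    have "w \<bullet> h = 0" using NG[OF fr] nz unfolding nonintegrable_pattern_def by argo
    moreover have "- u \<bullet> h = 0"
      using NG[OF swap[OF fr]] nz unfolding nonintegrable_pattern_def dj_neg by argo
    then have "u \<bullet> h = 0" by simp
    ultimately show False using NE[OF rot[OF rot[OF fr]]] nz unfolding excluded_pattern_def by argo
  qed
  \<comment> \<open>Rank one: a rotation in the plane of \<open>u\<close> and \<open>v\<close> keeps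
    the frame diagonal and can remove the second field component.\<close>
  have two_zero: False if fr: "diag_frame A u v w" and z: "dj A u = 0" "dj A v = 0" "dj A w \<noteq> 0" for u v w
  proof -
    have rh: "right_handed u v w" using fr by (simp add: diag_frame_def)
    note r = right_handedD[OF rh]
    have off: "u \<bullet> (A *v v) = 0" "u \<bullet> (A *v w) = 0" "v \<bullet> (A *v w) = 0"
      using fr unfolding diag_frame_def by blast+
    have off': "v \<bullet> (A *v u) = 0" using off sym_inner[OF A, of v u] by auto
    have d: "u \<bullet> (A *v u) = 0" "v \<bullet> (A *v v) = 0" using z by (simp_all add: dj_def)
    define n where "n = sqrt ((u \<bullet> h)\<^sup>2 + (v \<bullet> h)\<^sup>2)"
    have "u \<bullet> h \<noteq> 0 \<or> v \<bullet> h \<noteq> 0"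
      using NE[OF fr] z unfolding excluded_pattern_def by argo
    then have "(u \<bullet> h)\<^sup>2 + (v \<bullet> h)\<^sup>2 > 0" by (metis sum_power2_gt_zero_iff)
    then have n: "n > 0" "n * n = (u \<bullet> h) * (u \<bullet> h) + (v \<bullet> h) * (v \<bullet> h)"
      by (simp_all add: n_def power2_eq_square)
    define s t where "s = (u \<bullet> h) / n" "t = (v \<bullet> h) / n"
    have st: "s * s + t * t = 1"
      unfolding s_t_def using n(1) by (simp add: add_divide_distrib[symmetric] n(2)[symmetric])
    define u' where "u' = s *\<^sub>R u + t *\<^sub>R v"
    define v' where "v' = (- t) *\<^sub>R u + s *\<^sub>R v"
    have "cross3 u' v' = (s * s + t * t) *\<^sub>R w"
      unfolding u'_def v'_def
      by (simp add: cross_add_left cross_add_right cross_mult_left cross_mult_right r scaleR_add_left mult.commute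
          Cross3.right_diff_distrib scaleR_diff_right)
    then have "right_handed u' v' w"
      using st r by (intro right_handedI) (simp_all add: u'_def v'_def inner_add_left inner_add_right algebra_simps)
    then have fr': "diag_frame A u' v' w"
      unfolding diag_frame_def
      by (simp add: u'_def v'_def inner_add_left inner_add_right matrix_vector_right_distrib matrix_vector_mult_scaleR
          matrix_vector_mult_diff_distrib inner_diff_left inner_diff_right off off' d)
    have "dj A u' = 0" "dj A v' = 0"
      by (simp_all add: dj_def u'_def v'_def inner_add_left inner_add_right matrix_vector_right_distrib matrix_vector_mult_scaleR
          matrix_vector_mult_diff_distrib inner_diff_left inner_diff_right off off' d)
    moreover have "v' \<bullet> h = 0" by (simp add: v'_def inner_diff_left s_t_def)
    moreover have "u' \<bullet> h = n"
      using n by (simp add: u'_def inner_add_left s_t_def add_divide_distrib[symmetric] n(2)[symmetric])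
    ultimately show False
      using NG[OF fr'] NE[OF fr'] z(3) n(1) unfolding nonintegrable_pattern_def excluded_pattern_def by argo
  qed
  obtain u v w where fr: "diag_frame A u v w" using ex_diag_frame[OF A] by blast
  note fr1 = rot[OF fr] and fr2 = rot[OF rot[OF fr]]
  \<comment> \<open>Only ranks three and zero are left. For rank three the failure of both patterns
    in all cyclic orders forces equal couplings.\<close>
  have "dj A u = dj A v \<and> dj A v = dj A w"
  proof (cases "dj A u \<noteq> 0 \<and> dj A v \<noteq> 0 \<and> dj A w \<noteq> 0")
    case True
    then have nz: "dj A u \<noteq> 0" "dj A v \<noteq> 0" "dj A w \<noteq> 0" by auto
    note p = nonintegrable_patternD[OF NG[OF fr] nz] nonintegrable_patternD[OF NG[OF fr1] nz(2,3,1)]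
      nonintegrable_patternD[OF NG[OF fr2] nz(3,1,2)]
    show ?thesis
      by (rule all_equal_couplings[OF p excluded_patternD[OF NE[OF fr] p(1)] excluded_patternD[OF NE[OF fr1] p(2)]
          excluded_patternD[OF NE[OF fr2] p(3)]])
  next
    case False
    have "\<not> (dj A v = 0 \<and> dj A u \<noteq> 0 \<and> dj A w \<noteq> 0)" by (intro notI, elim conjE, rule one_zero[OF fr])
    moreover have "\<not> (dj A w = 0 \<and> dj A v \<noteq> 0 \<and> dj A u \<noteq> 0)" by (intro notI, elim conjE, rule one_zero[OF fr1])
    moreover have "\<not> (dj A u = 0 \<and> dj A w \<noteq> 0 \<and> dj A v \<noteq> 0)" by (intro notI, elim conjE, rule one_zero[OF fr2])
    moreover have "\<not> (dj A u = 0 \<and> dj A v = 0 \<and> dj A w \<noteq> 0)" by (intro notI, elim conjE, rule two_zero[OF fr])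
    moreover have "\<not> (dj A v = 0 \<and> dj A w = 0 \<and> dj A u \<noteq> 0)" by (intro notI, elim conjE, rule two_zero[OF fr1])
    moreover have "\<not> (dj A w = 0 \<and> dj A u = 0 \<and> dj A v \<noteq> 0)" by (intro notI, elim conjE, rule two_zero[OF fr2])
    ultimately show ?thesis using False by (rule all_zero_couplings)
  qed
  then have eq: "dj A u = dj A w" "dj A v = dj A w" by auto
  \<comment> \<open>With a scalar coupling every frame is diagonal, so the third axis can be put
    along the field, which is an excluded model.\<close>
  obtain a where sc: "\<And>x. A *v x = a *\<^sub>R x"
    using scalar_frame[OF A fr eq refl] by blast
  have "h \<noteq> 0"
  proof
    assume "h = 0"
    then have "u \<bullet> h = 0" "v \<bullet> h = 0" "w \<bullet> h = 0" by simp_all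
    with NE[OF fr] show False unfolding excluded_pattern_def by argo
  qed
  then obtain u' v' w' where f: "right_handed u' v' w'" "u' \<bullet> h = 0" "v' \<bullet> h = 0"
    using ex_frame_along by blast
  have "diag_frame A u' v' w'" unfolding diag_frame_def using f(1) right_handedD(4,6,8)[OF f(1)] by (simp add: sc)
  note fr' = this
  have "dj A u' = dj A v'" using right_handedD(1,2)[OF f(1)] by (simp add: dj_def sc)
  with NE[OF fr'] f(2,3) show False unfolding excluded_pattern_def by argo
qed

lemma excluded_pattern_model:
  assumes "excluded_pattern a b c x y z"
  shows "excluded_model N (ham N (pauli N) (diagJ a b c) (vecH x y z))"
  using assms unfolding excluded_pattern_def excluded_model_def by blast

theorem theorem1:
  fixes N :: nat and J :: "3 \<Rightarrow> 3 \<Rightarrow> real" and h :: "3 \<Rightarrow> real"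
  assumes "N \<ge> 6"
    and "\<forall>a b. J a b = J b a"
    and "\<not> (\<exists>R. rotation_matrix R \<and> excluded_model N (ham N (rot_pauli N R) J h))"
  shows "\<forall>k Q. 3 \<le> k \<and> 2 * k \<le> N \<and> is_op N Q \<and> support_quantity N k Q
           \<longrightarrow> mmul N (ham N (pauli N) J h) Q \<noteq> mmul N Q (ham N (pauli N) J h)"
proof (intro allI impI notI, elim conjE)
  fix k Q
  assume k: "3 \<le> k" "2 * k \<le> N" and Q: "is_op N Q" "support_quantity N k Q"
    and comm: "mmul N (ham N (pauli N) J h) Q = mmul N Q (ham N (pauli N) J h)"
  define A :: "real^3^3" where "A = (\<chi> a b. J a b)"
  define hv :: "real^3" where "hv = (\<chi> a. h a)"
  have A: "transpose A = A" using assms(2) by (simp add: A_def transpose_def vec_eq_iff)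
  have J: "J a b = A $ a $ b" for a b by (simp add: A_def)
  have h: "h a = hv $ a" for a by (simp add: hv_def)
  obtain u v w where fr: "diag_frame A u v w"
    and pat: "nonintegrable_pattern (dj A u) (dj A v) (dj A w) (u \<bullet> hv) (v \<bullet> hv) (w \<bullet> hv)"
  proof -
    have "\<exists>u v w. diag_frame A u v w \<and> nonintegrable_pattern (dj A u) (dj A v) (dj A w) (u \<bullet> hv) (v \<bullet> hv) (w \<bullet> hv)"
    \<comment> \<open>An excluded pattern in a diagonalising frame would make the transposed frame
      matrix a rotation onto an excluded model.\<close>
    proof (rule ex_nonintegrable_frame[OF A], rule notI)
      fix u v w assume fr: "diag_frame A u v w"
        and ex: "excluded_pattern (dj A u) (dj A v) (dj A w) (u \<bullet> hv) (v \<bullet> hv) (w \<bullet> hv)"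
      have "excluded_model N (ham N (rot_pauli N (transpose (frame_matrix u v w))) J h)"
        unfolding diag_frame_ham(1)[OF A fr J h] using ex unfolding dj_def by (rule excluded_pattern_model)
      moreover have "rotation_matrix (frame_matrix u v w)"
        using fr by (intro rotation_frame_matrix) (simp add: diag_frame_def)
      then have "rotation_matrix (transpose (frame_matrix u v w))"
        by (simp add: rotation_matrix_def orthogonal_matrix_transpose det_transpose)
      ultimately show False using assms(3) by blast
    qed
    then show thesis using that by blast
  qed
  have rh: "right_handed u v w" using fr by (simp add: diag_frame_def)
  interpret pauli_basis N "frame_sm u v w" by (rule pauli_basis_frame[OF rh])
  define Jl where "Jl = vecL (dj A u) (dj A v) (dj A w)"
  define hl where "hl = vecL (u \<bullet> hv) (v \<bullet> hv) (w \<bullet> hv)"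
  have H: "ham N (pauli N) J h = hamL Jl hl"
    unfolding diag_frame_ham(2)[OF A fr J h] ham_frame[OF rh] Jl_def hl_def dj_def ..
  have le: "sum_of_le_support N k Q" and nle: "\<not> sum_of_le_support N (k - 1) Q"
    using Q(2) unfolding support_quantity_def by auto
  interpret spin_string_eq k Jl hl "coeffZ k Q"
    by (rule unrolled[OF k le comm[unfolded H]])
  have "coeffZ k Q g = 0" if "g m \<noteq> LI" "g (m + int k - 1) \<noteq> LI" for g m
  proof -
    consider "dj A u \<noteq> 0" "dj A v \<noteq> 0" "dj A w \<noteq> 0" "w \<bullet> hv \<noteq> 0" "dj A u \<noteq> dj A v"
      | "dj A v = 0" "dj A u \<noteq> 0" "dj A w \<noteq> 0" "w \<bullet> hv \<noteq> 0"
      | "dj A u = 0" "dj A v = 0" "dj A w \<noteq> 0" "v \<bullet> hv = 0" "u \<bullet> hv \<noteq> 0" "w \<bullet> hv \<noteq> 0"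
      using pat unfolding nonintegrable_pattern_def by blast
    then show ?thesis
    proof cases
      case 1
      interpret rank3_string_eq k Jl hl "coeffZ k Q"
        by unfold_locales (use 1 in \<open>simp_all add: Jl_def hl_def\<close>)
      show ?thesis by (rule c_zero[OF that])
    next
      case 2
      interpret rank2_string_eq k Jl hl "coeffZ k Q"
        by unfold_locales (use 2 in \<open>simp_all add: Jl_def hl_def\<close>)
      show ?thesis by (rule c_zero[OF that])
    next
      case 3
      interpret rank1_string_eq k Jl hl "coeffZ k Q"
        by unfold_locales (use 3 in \<open>simp_all add: Jl_def hl_def\<close>)
      show ?thesis by (rule c_zero[OF that])
    qed
  qed
  then have "sum_of_le_support N (k - 1) Q"
    by (rule no_wide_strings[OF k Q(1) le])
  with nle show False by contradiction
qed

end
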